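(* Let $\lambda_a\in\{2,3\}$ and let $m,n$ be positive integers with $m\equiv 2\pmod 4$ and $n\equiv 2\pmod 4$. Let $\omega=0$ if $\lambda_a=2$, and let $\omega=\xi$ if $\lambda_a=3$, where $\xi$ is the number of subgroups of order $3$ in $\mathbb{Z}_m\times\mathbb{Z}_n$. Then $$\Theta(m,n,3,\lambda_a,1)=\left\lfloor\frac{5mn+4+8\omega}{24}\right\rfloor.$$
   Context: For positive integers $m,n,k,\lambda_a,\lambda_c$, an $(m,n,k,\lambda_a,\lambda_c)$ optical orthogonal signature pattern code (OOSPC) is a set $\mathcal F$ of $k$-subsets (codewords) of the group $\mathbb{Z}_m\times\mathbb{Z}_n$ such that (1) $|X\cap (X+g)|\le\lambda_a$ for every $X\in\mathcal F$ and every $g\in\mathbb{Z}_m\times\mathbb{Z}_n\setminus\{(0,0)\}$; (2) $|X\cap(Y+g)|\le\lambda_c$ for all distinct $X,Y\in\mathcal F$ and every $g\in\mathbb{Z}_m\times\mathbb{Z}_n$. $\Theta(m,n,k,\lambda_a,\lambda_c)$ denotes the largest possible number of codewords of an $(m,n,k,\lambda_a,\lambda_c)$-OOSPC. Explicitly, $\xi=0$ if $3\nmid mn$, $\xi=1$ if $3\mid mn$ and $\gcd(m,n,3)=1$, and $\xi=4$ if $\gcd(m,n,3)=3$. *)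

theory Defs
  imports Complex_Main "HOL-Algebra.Elementary_Groups" "HOL-Number_Theory.Cong"
begin

text \<open>Note that \<^const>\<open>integer_mod_group\<close> is the infinite cyclic group for modulus 0;
  for a positive modulus it is the additive group on \<open>{0..<n}\<close>.\<close>

abbreviation Zmn :: "nat \<Rightarrow> nat \<Rightarrow> (int \<times> int) monoid" where
  "Zmn m n \<equiv> integer_mod_group m \<times>\<times> integer_mod_group n"

text \<open>The right coset \<open>X #> g\<close>, taken here for an arbitrary subset \<open>X\<close> of the group,
  is the translate \<open>X + g\<close>.\<close>

definition is_OOSPC ::
  "nat \<Rightarrow> nat \<Rightarrow> nat \<Rightarrow> nat \<Rightarrow> nat \<Rightarrow> (int \<times> int) set set \<Rightarrow> bool" where
  "is_OOSPC m n k la lc F \<longleftrightarrow>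
     (\<forall>X\<in>F. X \<subseteq> carrier (Zmn m n) \<and> finite X \<and> card X = k) \<and>
     (\<forall>X\<in>F. \<forall>g\<in>carrier (Zmn m n) - {\<one>\<^bsub>Zmn m n\<^esub>}.
        card (X \<inter> (X #>\<^bsub>Zmn m n\<^esub> g)) \<le> la) \<and>
     (\<forall>X\<in>F. \<forall>Y\<in>F. X \<noteq> Y \<longrightarrow>
        (\<forall>g\<in>carrier (Zmn m n). card (X \<inter> (Y #>\<^bsub>Zmn m n\<^esub> g)) \<le> lc))"

text \<open>For positive \<open>m\<close> and \<open>n\<close> the group is finite, so there are only finitely many codes;
  the empty code is always one of them. Hence the maximum is attained.\<close>

definition Theta :: "nat \<Rightarrow> nat \<Rightarrow> nat \<Rightarrow> nat \<Rightarrow> nat \<Rightarrow> nat" where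
  "Theta m n k la lc = Max {card F |F. is_OOSPC m n k la lc F}"

definition xi :: "nat \<Rightarrow> nat \<Rightarrow> nat" where
  "xi m n = card {H. subgroup H (Zmn m n) \<and> card H = 3}"

end

theory Submission
  imports Defs "HOL-Library.Product_Plus"
begin

text \<open>Write \<open>m = 2p\<close> and \<open>n = 2q\<close> with \<open>p\<close>, \<open>q\<close> odd, and let \<open>H\<close> be the subgroup of order \<open>h = pq\<close>
  formed by the elements with two even coordinates. A set of codewords is a code precisely when
  their difference sets are pairwise disjoint.

  Upper bound: give a nonzero group element the weight 1, increased by 1 if it lies in \<open>H\<close>, by 1 if it is
  an involution, and, for \<open>\<lambda>\<^sub>a = 3\<close>, by 1 if it has order 3. Every difference set has weight at least 6
  and the total weight is \<open>5h + 1 + 2\<omega>\<close>.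

  Lower bound: \<open>y \<in> H\<close> spans the block of the elements \<open>\<plusminus>2y\<close> and \<open>\<plusminus>y + u\<close>, where \<open>u\<close> runs through the three
  involutions. If \<open>a + b + c = 0\<close>, the three blocks of \<open>a\<close>, \<open>b\<close>, \<open>c\<close> are partitioned by the difference sets of
  three codewords \<open>{0, x, -x}\<close> and two codewords \<open>{0, x, x + y}\<close>. One block together with one involution
  contains two difference sets, and so does the block of an element of order 3 if \<open>\<lambda>\<^sub>a = 3\<close>. So it is enough
  to partition the nonzero classes \<open>\<plusminus>y\<close> of \<open>H\<close>, without those of order 3 if \<open>\<lambda>\<^sub>a = 3\<close>, into zero-sum
  triples up to at most three classes. For cyclic groups such partitions come from Skolem-type
  sequences, and they are lifted to \<open>\<int>\<^sub>p \<times> \<int>\<^sub>q\<close> along the projection to \<open>\<int>\<^sub>q\<close>.\<close>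

section \<open>Zero-sum triples in cyclic groups\<close>

text \<open>The construction is shaped by equality in the weight bound. A block weighs 4 + 6 = 10,
  no multiple of 6, but three blocks weigh 30, exactly five codewords. A block together with an
  involution (weight 2), or with the extra weight 2 of its two elements of order 3, weighs 12,
  exactly two codewords; the three involutions alone weigh 6, exactly one. All these packings are
  perfect, and rounding is caused only by the number of leftover classes. A class counts for both
  signs, so in Z_q the task is to split {1, ..., (q - 1) / 2} into signed zero-sum triples. For q =
  1 or 3 modulo 6 these are Heffter's difference problems. If both factors are 5 modulo 6, both
  projections leave two classes over; in Z_q they are chosen as d and 2 * d, because (d, d, -2 * d)
  can then be combined with triples of the other factor. Two moduli are exceptional: for 9 the
  classes 1, 2, 4 have no signed sum divisible by 9, and for 11 no leftover pair d, 2 * d exists.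
  Since the two factors may be exchanged, only 9 x 9 and 11 x 11 need explicit lists.\<close>

definition pm :: "'a::ab_group_add set \<Rightarrow> 'a \<Rightarrow> 'a set" where
  "pm N e = {v. v - e \<in> N \<or> v + e \<in> N}"

definition supp :: "('a \<times> 'a \<times> 'a) set \<Rightarrow> 'a set" where
  "supp T = (\<Union>(a, b, c)\<in>T. {a, b, c})"

text \<open>The inequality on the cardinalities leaves no room for a class to be covered twice when \<open>h\<close> is the
  index of \<open>N\<close>, so a cover is then a partition.\<close>

definition zs_cover :: "'a::ab_group_add set \<Rightarrow> nat \<Rightarrow> ('a \<times> 'a \<times> 'a) set \<Rightarrow> 'a set \<Rightarrow> bool" where
  "zs_cover N h T E \<longleftrightarrow> finite T \<and> finite E \<and> 6 * card T + 2 * card E + 1 \<le> h \<and>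
     (\<forall>(a, b, c)\<in>T. a + b + c \<in> N) \<and> (\<forall>v. v \<in> N \<or> (\<exists>e\<in>supp T \<union> E. v \<in> pm N e))"

lemma zs_coverI:
  assumes "finite T" "finite E" "6 * card T + 2 * card E + 1 \<le> h"
    and "\<And>a b c. (a, b, c) \<in> T \<Longrightarrow> a + b + c \<in> N"
    and "\<And>v. v \<notin> N \<Longrightarrow> \<exists>e\<in>supp T \<union> E. v \<in> pm N e"
  shows "zs_cover N h T E"
  using assms unfolding zs_cover_def by blast

lemma zs_coverD:
  assumes "zs_cover N h T E"
  shows "finite T" "finite E" "6 * card T + 2 * card E + 1 \<le> h"
    and "\<And>a b c. (a, b, c) \<in> T \<Longrightarrow> a + b + c \<in> N"
    and "\<And>v. v \<notin> N \<Longrightarrow> \<exists>e\<in>supp T \<union> E. v \<in> pm N e"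
  using assms unfolding zs_cover_def by blast+

lemma supp_simps [simp]: "supp {} = {}" "supp (insert (a, b, c) T) = {a, b, c} \<union> supp T"
  "supp (T \<union> T') = supp T \<union> supp T'"
  by (auto simp: supp_def)

lemma supp_triple: "(a, b, c) \<in> T \<Longrightarrow> {a, b, c} \<subseteq> supp T"
  unfolding supp_def by blast

lemma suppE:
  assumes "x \<in> supp T" obtains a b c where "(a, b, c) \<in> T" "x \<in> {a, b, c}"
  using assms unfolding supp_def by blast

definition cyc :: "nat \<Rightarrow> int set" where
  "cyc q = {x. int q dvd x}"

lemma half_range:
  assumes "odd p" "\<not> int p dvd x"
  obtains r where "1 \<le> r" "2 * r < int p" "int p dvd x - r \<or> int p dvd x + r"
proof -
  have p0: "int p > 0" using assms(1) by (cases p) auto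
  define s where "s = x mod int p"
  have s: "0 < s" "s < int p" "int p dvd x - s"
  proof -
    have "s \<noteq> 0" using assms(2) by (auto simp: s_def dvd_eq_mod_eq_0)
    then show "0 < s" using pos_mod_sign[OF p0, of x] by (simp add: s_def)
    show "s < int p" using pos_mod_bound[OF p0] by (simp add: s_def)
    show "int p dvd x - s" by (simp add: s_def)
  qed
  have "2 * s \<noteq> int p" using assms(1) by presburger
  then have "2 * s < int p \<or> 2 * (int p - s) < int p" by presburger
  then show thesis
  proof
    assume "2 * s < int p"
    then show thesis using s by (intro that[of s]) auto
  next
    assume *: "2 * (int p - s) < int p"
    have "int p dvd (x - s) + int p" using s(3) by simp
    then have "int p dvd x + (int p - s)" by (simp add: algebra_simps)
    then show thesis using s * by (intro that[of "int p - s"]) auto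
  qed
qed

lemma cyclic_coverI:
  assumes q: "odd q" and "finite T" "finite E" "6 * card T + 2 * card E + 1 \<le> q"
    and "\<And>a b c. (a, b, c) \<in> T \<Longrightarrow> int q dvd a + b + c"
    and cov: "\<And>v. 1 \<le> v \<Longrightarrow> 2 * v < int q \<Longrightarrow> \<exists>e\<in>supp T \<union> E. v = e \<or> v = - e"
  shows "zs_cover (cyc q) q T E"
proof (rule zs_coverI)
  fix v assume "v \<notin> cyc q"
  then obtain r where r: "1 \<le> r" "2 * r < int q" "int q dvd v - r \<or> int q dvd v + r"
    using half_range[OF q] by (auto simp: cyc_def)
  obtain e where e: "e \<in> supp T \<union> E" "r = e \<or> r = - e" using cov[OF r(1,2)] by blast
  then show "\<exists>e\<in>supp T \<union> E. v \<in> pm (cyc q) e"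
    using r(3) by (intro bexI[OF _ e(1)]) (auto simp: pm_def cyc_def)
qed (use assms(2-5) in \<open>simp_all add: cyc_def\<close>)

text \<open>The differences of the pairs symmetric about the centre of an interval are all the odd
  numbers up to its length, or all the even ones, according to the parity of the length.
  So one interval of each kind, followed by finitely many repairs, yields a cover.\<close>

lemma nest_cover:
  fixes k j A B :: int and FO FE W G :: "int set"
  assumes q: "odd q"
    and cov: "\<And>v. 1 \<le> v \<Longrightarrow> 2 * v < int q \<Longrightarrow> v \<notin> G \<Longrightarrow> k + j < v \<Longrightarrow>
         v < A \<or> A + 2 * k \<le> v \<Longrightarrow> v < B \<or> B + 2 * j < v \<Longrightarrow> False"
    and j: "k \<le> j + 1" "j \<le> k" "0 \<le> j"
    and F: "FO \<subseteq> {1..k}" "FE \<subseteq> {1..j}"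
    and cF: "fo \<le> card FO" "fe \<le> card FE" and TE: "T = set ts" "E = set es"
    and card: "6 * (k - int fo + (j - int fe) + int (length ts)) + 2 * int (length es) + 1 \<le> int q"
    and zs: "\<And>a b c. (a, b, c) \<in> T \<Longrightarrow> int q dvd a + b + c"
    and W: "\<And>v. v \<in> W \<Longrightarrow> v \<in> supp T \<union> E \<or> - v \<in> supp T \<union> E"
    and G: "G \<subseteq> W"
    and holes: "B + j \<in> W" "\<And>i. i \<in> FO \<Longrightarrow> {2 * i - 1, A + k - i, A + k - 1 + i} \<subseteq> W"
       "\<And>i. i \<in> FE \<Longrightarrow> {2 * i, B + j - i, B + j + i} \<subseteq> W"
  shows "\<exists>T'. zs_cover (cyc q) q T' E"
proof -
  \<comment> \<open>\<open>f i\<close> joins the difference \<open>2 * i - 1\<close> to two points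
    of the interval of length \<open>2 * k\<close> from \<open>A\<close>; \<open>g i\<close> joins
    \<open>2 * i\<close> to two points of the interval of length \<open>2 * j + 1\<close> from
    \<open>B\<close>, whose midpoint stays single. \<open>FO\<close> and \<open>FE\<close> index the
    triples that are broken up. Their entries, the midpoint and the values \<open>G\<close> outside
    all ranges lie in \<open>W\<close>, which \<open>T\<close> and \<open>E\<close> have to
    cover.\<close>
  define f g where "f = (\<lambda>i. (2 * i - 1, A + k - i, - (A + k - 1 + i)))"
    and "g = (\<lambda>i. (2 * i, B + j - i, - (B + j + i)))"
  define TO TE where "TO = f ` ({1..k} - FO)" and "TE = g ` ({1..j} - FE)"
  have fF: "finite FO" "finite FE" using F finite_subset by blast+
  have "int (card TO) \<le> k - card FO"
  proof -
    have "card TO \<le> card ({1..k} - FO)" unfolding TO_def by (rule card_image_le) simp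
    also have "int \<dots> = k - card FO"
      using F j card_mono[OF _ F(1)] by (subst card_Diff_subset) (auto simp: fF)
    finally show ?thesis by linarith
  qed
  moreover have "int (card TE) \<le> j - card FE"
  proof -
    have "card TE \<le> card ({1..j} - FE)" unfolding TE_def by (rule card_image_le) simp
    also have "int \<dots> = j - card FE"
      using F j card_mono[OF _ F(2)] by (subst card_Diff_subset) (auto simp: fF)
    finally show ?thesis by linarith
  qed
  moreover have "int (card (TO \<union> TE \<union> T)) \<le> int (card TO) + int (card TE) + int (card T)"
    using card_Un_le[of "TO \<union> TE" T] card_Un_le[of TO TE] by linarith
  \<comment> \<open>The lengths of the lists bound \<open>card T\<close> and \<open>card E\<close>
    from above, which spares a proof that entries depending on a parameter are distinct.\<close>
  ultimately have "int (6 * card (TO \<union> TE \<union> T) + 2 * card E + 1) \<le> int q"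
    using card cF card_length[of ts] card_length[of es] unfolding TE by (simp add: algebra_simps)
  then have c: "6 * card (TO \<union> TE \<union> T) + 2 * card E + 1 \<le> q" by linarith
  have "zs_cover (cyc q) q (TO \<union> TE \<union> T) E"
  proof (rule cyclic_coverI[OF q _ _ c])
    fix v :: int assume v: "1 \<le> v" "2 * v < int q"
    let ?C = "\<exists>e\<in>supp (TO \<union> TE \<union> T) \<union> E. v = e \<or> v = - e"
    have W': ?C if "v \<in> W"
    proof -
      from W[OF that] have "v \<in> supp (TO \<union> TE \<union> T) \<union> E \<or> - v \<in> supp (TO \<union> TE \<union> T) \<union> E" by auto
      then show ?thesis by (metis minus_minus)
    qed
    have odd_nest: ?C
      if i: "1 \<le> i" "i \<le> k" "v \<in> {2 * i - 1, A + k - i, A + k - 1 + i}" for i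
    proof (cases "i \<in> FO")
      case True
      then have "v \<in> W" using holes(2) i(3) by blast
      then show ?thesis using W' by blast
    next
      case False
      then have "f i \<in> TO" using i by (auto simp: TO_def)
      then have "{2 * i - 1, A + k - i, - (A + k - 1 + i)} \<subseteq> supp (TO \<union> TE \<union> T) \<union> E"
        using supp_triple[of _ _ _ TO] unfolding f_def supp_simps by blast
      moreover have "\<exists>e\<in>{2 * i - 1, A + k - i, - (A + k - 1 + i)}. v = e \<or> v = - e" using i(3) by auto
      ultimately show ?thesis by blast
    qed
    have even_nest: ?C
      if i: "1 \<le> i" "i \<le> j" "v \<in> {2 * i, B + j - i, B + j + i}" for i
    proof (cases "i \<in> FE")
      case True
      then have "v \<in> W" using holes(3) i(3) by blast
      then show ?thesis using W' by blast
    next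
      case False
      then have "g i \<in> TE" using i by (auto simp: TE_def)
      then have "{2 * i, B + j - i, - (B + j + i)} \<subseteq> supp (TO \<union> TE \<union> T) \<union> E"
        using supp_triple[of _ _ _ TE] unfolding g_def supp_simps by blast
      moreover have "\<exists>e\<in>{2 * i, B + j - i, - (B + j + i)}. v = e \<or> v = - e" using i(3) by auto
      ultimately show ?thesis by blast
    qed
    have cov': "v \<in> G \<or> v \<le> k + j \<or> A \<le> v \<and> v < A + 2 * k \<or> B \<le> v \<and> v \<le> B + 2 * j"
      using cov[OF v] by (meson linorder_not_le)
    \<comment> \<open>As \<open>k\<close> is \<open>j\<close> or \<open>j + 1\<close>, the odd
      numbers below \<open>2 * k\<close> and the even ones up to \<open>2 * j\<close> together fill
      an initial segment without a gap.\<close>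
    have "odd v \<and> v < 2 * k \<or> even v \<and> v \<le> 2 * j" if "v \<le> k + j" using that j by presburger
    moreover have "v < A + k \<or> A + k \<le> v" "v < B + j \<or> v = B + j \<or> B + j < v" by linarith+
    ultimately consider "v \<in> W" | "odd v" "v < 2 * k" | "even v" "v \<le> 2 * j" | "A \<le> v" "v < A + k"
      | "A + k \<le> v" "v < A + 2 * k" | "B \<le> v" "v < B + j" | "v = B + j" | "B + j < v" "v \<le> B + 2 * j"
      using cov' G by blast
    then show ?C
    proof cases
      case 2
      from 2(1) obtain i where "v = 2 * i + 1" by (rule oddE)
      then show ?thesis using v 2(2) by (intro odd_nest[of "i + 1"]) auto
    next
      case 3
      from 3(1) obtain i where "v = 2 * i" by (rule evenE)
      then show ?thesis using v 3(2) by (intro even_nest[of i]) auto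
    next
      case 4
      then show ?thesis by (intro odd_nest[of "A + k - v"]) auto
    next
      case 5
      then show ?thesis by (intro odd_nest[of "v - (A + k - 1)"]) auto
    next
      case 6
      then show ?thesis by (intro even_nest[of "B + j - v"]) auto
    next
      case 8
      then show ?thesis by (intro even_nest[of "v - (B + j)"]) auto
    qed (use W' holes(1) in blast)+
  next
    show "finite (TO \<union> TE \<union> T)" by (simp add: TO_def TE_def TE)
    show "finite E" by (simp add: TE)
  next
    fix a b c assume "(a, b, c) \<in> TO \<union> TE \<union> T"
    then consider "a + b + c = 0" | "(a, b, c) \<in> T"
      unfolding TO_def TE_def f_def g_def by fastforce
    then show "int q dvd a + b + c" using zs by cases auto
  qed
  then show ?thesis by blast
qed

section \<open>Cyclic covers by the residue of the modulus\<close>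

lemma full_cover_0:
  fixes M :: int assumes "int q = 24 * M + 1" "M \<ge> 1"
  shows "\<exists>T. zs_cover (cyc q) q T {}"
  \<comment> \<open>The differences fill 1, ..., 4M - 1 and the intervals are 4M, ..., 8M - 1 and
    8M, ..., 12M - 2. The midpoint 10M - 1 and the top values 12M - 1 and 12M remain. Breaking up
    the triple of the difference 2M + 1 also frees 5M - 1 and 7M, and the six free values form two
    new triples. Most of the covers below use the same kind of repair.\<close>
  by (rule nest_cover[where q = q and k = "2 * M" and j = "2 * M - 1" and FO = "{M + 1}" and FE = "{}"
      and T = "{(2 * M + 1, 10 * M - 1, - (12 * M)), (5 * M - 1, 7 * M, - (12 * M - 1))}"
      and E = "{}" and fo = 1 and fe = 0 and ts = "[(2 * M + 1, 10 * M - 1, - (12 * M)), (5 * M - 1, 7 * M, - (12 * M - 1))]" and es = "[]"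
      and G = "{12 * M - 1, 12 * M}"
      and W = "{2 * M + 1, 10 * M - 1, 12 * M, 5 * M - 1, 7 * M, 12 * M - 1}" and A = "4 * M" and B = "8 * M"],
      use assms(1) in presburger, (elim disjE; use assms in \<open>clarsimp; linarith\<close>),
      (use assms in \<open>(auto simp: card_insert_if)[1]\<close>)+)

text \<open>The difference 1 is among the three that are broken up because it joins the two values
  12M + 2 and 12M + 3 above the intervals.\<close>

lemma full_cover_1:
  fixes M :: int assumes "int q = 24 * M + 7" "M \<ge> 1"
  shows "\<exists>T. zs_cover (cyc q) q T {}"
  by (rule nest_cover[where q = q and k = "2 * M" and j = "2 * M" and FO = "{1, M + 1}" and FE = "{2 * M}"
      and T = "{(1, 12 * M + 2, - (12 * M + 3)), (5 * M, 7 * M + 1, - (12 * M + 1)), (4 * M, 6 * M + 1, - (10 * M + 1)), (2 * M + 1, 6 * M, - (8 * M + 1))}"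
      and E = "{}" and fo = 2 and fe = 1 and ts = "[(1, 12 * M + 2, - (12 * M + 3)), (5 * M, 7 * M + 1, - (12 * M + 1)), (4 * M, 6 * M + 1, - (10 * M + 1)), (2 * M + 1, 6 * M, - (8 * M + 1))]" and es = "[]"
      and G = "{12 * M + 2, 12 * M + 3}"
      and W = "{1, 12 * M + 2, 12 * M + 3, 5 * M, 7 * M + 1, 12 * M + 1, 4 * M, 6 * M + 1, 10 * M + 1, 2 * M + 1, 6 * M, 8 * M + 1}" and A = "4 * M + 1" and B = "8 * M + 1"],
      use assms(1) in presburger, (elim disjE; use assms in \<open>clarsimp; linarith\<close>),
      (use assms in \<open>(auto simp: card_insert_if)[1]\<close>)+)

lemma full_cover_2:
  fixes M :: int assumes "int q = 24 * M + 13" "M \<ge> 1"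
  shows "\<exists>T. zs_cover (cyc q) q T {}"
  by (rule nest_cover[where q = q and k = "2 * M + 1" and j = "2 * M" and FO = "{M + 2}" and FE = "{}"
      and T = "{(2 * M + 3, 10 * M + 4, 12 * M + 6), (5 * M + 1, 7 * M + 4, - (12 * M + 5))}"
      and E = "{}" and fo = 1 and fe = 0 and ts = "[(2 * M + 3, 10 * M + 4, 12 * M + 6), (5 * M + 1, 7 * M + 4, - (12 * M + 5))]" and es = "[]"
      and G = "{12 * M + 5, 12 * M + 6}"
      and W = "{2 * M + 3, 10 * M + 4, 12 * M + 6, 5 * M + 1, 7 * M + 4, 12 * M + 5}" and A = "4 * M + 2" and B = "8 * M + 4"],
      use assms(1) in presburger, (elim disjE; use assms in \<open>clarsimp; linarith\<close>),
      (use assms in \<open>(auto simp: card_insert_if)[1]\<close>)+)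

text \<open>With the interval of odd length first, the values 4M + 3 and 12M + 9 remain outside, and
  one broken triple suffices; one of the repairs has sum q instead of 0.\<close>

lemma full_cover_3:
  fixes M :: int assumes "int q = 24 * M + 19" "M \<ge> 0"
  shows "\<exists>T. zs_cover (cyc q) q T {}"
  by (rule nest_cover[where q = q and k = "2 * M + 1" and j = "2 * M + 1" and FO = "{}" and FE = "{M + 1}"
      and T = "{(5 * M + 4, 7 * M + 6, 12 * M + 9), (2 * M + 2, 4 * M + 3, - (6 * M + 5))}"
      and E = "{}" and fo = 0 and fe = 1 and ts = "[(5 * M + 4, 7 * M + 6, 12 * M + 9), (2 * M + 2, 4 * M + 3, - (6 * M + 5))]" and es = "[]"
      and G = "{4 * M + 3, 12 * M + 9}"
      and W = "{5 * M + 4, 7 * M + 6, 12 * M + 9, 2 * M + 2, 4 * M + 3, 6 * M + 5}" and A = "8 * M + 7" and B = "4 * M + 4"],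
      use assms(1) in presburger, (elim disjE; use assms in \<open>clarsimp; linarith\<close>),
      (use assms in \<open>(auto simp: card_insert_if)[1]\<close>)+)

text \<open>In this and the next three lemmas the two intervals lie on either side of the third of
  q, which has to stay uncovered because it has order 3.\<close>

lemma third_cover_0:
  fixes M :: int assumes "int q = 24 * M + 3" "M \<ge> 1"
  shows "\<exists>T. zs_cover (cyc q) q T {8 * M + 1}"
  by (rule nest_cover[where q = q and k = "2 * M" and j = "2 * M - 1" and FO = "{1, 2 * M}" and FE = "{M}"
      and T = "{(4 * M - 1, 9 * M + 2, 11 * M + 2), (6 * M - 1, 8 * M + 2, 10 * M + 2), (1, 8 * M - 1, - (8 * M)), (2 * M, 4 * M, - (6 * M))}"
      and E = "{8 * M + 1}" and fo = 2 and fe = 1 and ts = "[(4 * M - 1, 9 * M + 2, 11 * M + 2), (6 * M - 1, 8 * M + 2, 10 * M + 2), (1, 8 * M - 1, - (8 * M)), (2 * M, 4 * M, - (6 * M))]" and es = "[8 * M + 1]"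
      and G = "{8 * M, 8 * M + 1, 8 * M + 2}"
      and W = "{4 * M - 1, 9 * M + 2, 11 * M + 2, 6 * M - 1, 8 * M + 2, 10 * M + 2, 1, 8 * M - 1, 8 * M, 2 * M, 4 * M, 6 * M, 8 * M + 1}" and A = "4 * M" and B = "8 * M + 3"],
      use assms(1) in presburger, (elim disjE; use assms in \<open>clarsimp; linarith\<close>),
      (use assms in \<open>(auto simp: card_insert_if)[1]\<close>)+)

lemma third_cover_1:
  fixes M :: int assumes "int q = 24 * M + 9" "M \<ge> 1"
  shows "\<exists>T. zs_cover (cyc q) q T {8 * M + 3}"
  by (rule nest_cover[where q = q and k = "2 * M" and j = "2 * M" and FO = "{}" and FE = "{M + 1}"
      and T = "{(4 * M + 1, 9 * M + 3, 11 * M + 5), (2 * M + 2, 8 * M + 2, - (10 * M + 4))}"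
      and E = "{8 * M + 3}" and fo = 0 and fe = 1 and ts = "[(4 * M + 1, 9 * M + 3, 11 * M + 5), (2 * M + 2, 8 * M + 2, - (10 * M + 4))]" and es = "[8 * M + 3]"
      and G = "{4 * M + 1, 8 * M + 2, 8 * M + 3}"
      and W = "{4 * M + 1, 9 * M + 3, 11 * M + 5, 2 * M + 2, 8 * M + 2, 10 * M + 4, 8 * M + 3}" and A = "4 * M + 2" and B = "8 * M + 4"],
      use assms(1) in presburger, (elim disjE; use assms in \<open>clarsimp; linarith\<close>),
      (use assms in \<open>(auto simp: card_insert_if)[1]\<close>)+)

lemma third_cover_2:
  fixes M :: int assumes "int q = 24 * M + 15" "M \<ge> 0"
  shows "\<exists>T. zs_cover (cyc q) q T {8 * M + 5}"
  by (rule nest_cover[where q = q and k = "2 * M + 1" and j = "2 * M" and FO = "{M + 1}" and FE = "{}"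
      and T = "{(4 * M + 2, 9 * M + 6, 11 * M + 7), (2 * M + 1, 6 * M + 3, - (8 * M + 4))}"
      and E = "{8 * M + 5}" and fo = 1 and fe = 0 and ts = "[(4 * M + 2, 9 * M + 6, 11 * M + 7), (2 * M + 1, 6 * M + 3, - (8 * M + 4))]" and es = "[8 * M + 5]"
      and G = "{4 * M + 2, 8 * M + 4, 8 * M + 5}"
      and W = "{4 * M + 2, 9 * M + 6, 11 * M + 7, 2 * M + 1, 6 * M + 3, 8 * M + 4, 8 * M + 5}" and A = "8 * M + 6" and B = "4 * M + 3"],
      use assms(1) in presburger, (elim disjE; use assms in \<open>clarsimp; linarith\<close>),
      (use assms in \<open>(auto simp: card_insert_if)[1]\<close>)+)

lemma third_cover_3:
  fixes M :: int assumes "int q = 24 * M + 21" "M \<ge> 0"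
  shows "\<exists>T. zs_cover (cyc q) q T {8 * M + 7}"
  by (rule nest_cover[where q = q and k = "2 * M + 1" and j = "2 * M + 1" and FO = "{}" and FE = "{M + 1}"
      and T = "{(5 * M + 4, 7 * M + 6, - (12 * M + 10)), (2 * M + 2, 4 * M + 3, - (6 * M + 5))}"
      and E = "{8 * M + 7}" and fo = 0 and fe = 1 and ts = "[(5 * M + 4, 7 * M + 6, - (12 * M + 10)), (2 * M + 2, 4 * M + 3, - (6 * M + 5))]" and es = "[8 * M + 7]"
      and G = "{4 * M + 3, 8 * M + 7, 12 * M + 10}"
      and W = "{5 * M + 4, 7 * M + 6, 12 * M + 10, 2 * M + 2, 4 * M + 3, 6 * M + 5, 8 * M + 7}" and A = "8 * M + 8" and B = "4 * M + 4"],
      use assms(1) in presburger, (elim disjE; use assms in \<open>clarsimp; linarith\<close>),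
      (use assms in \<open>(auto simp: card_insert_if)[1]\<close>)+)

text \<open>With the interval of odd length first, its midpoint 3M + 1 and the top value 6M + 2 are
  all that remains, and the second is already the double of the first.\<close>

lemma double_cover_0:
  fixes M :: int assumes "int q = 12 * M + 5" "M \<ge> 0"
  shows "\<exists>T. zs_cover (cyc q) q T {3 * M + 1, 6 * M + 2}"
  by (rule nest_cover[where q = q and k = "M" and j = "M" and FO = "{}" and FE = "{}"
      and T = "{}"
      and E = "{3 * M + 1, 6 * M + 2}" and fo = 0 and fe = 0 and ts = "[]" and es = "[3 * M + 1, 6 * M + 2]"
      and G = "{6 * M + 2}"
      and W = "{3 * M + 1, 6 * M + 2}" and A = "4 * M + 2" and B = "2 * M + 1"],
      use assms(1) in presburger, (elim disjE; use assms in \<open>clarsimp; linarith\<close>),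
      (use assms in \<open>(auto simp: card_insert_if)[1]\<close>)+)

text \<open>One leftover is the gap 4M + 2 below the intervals. Breaking up the outermost pair of
  the upper interval frees its end 8M + 4, the double.\<close>

lemma double_cover_1:
  fixes M :: int assumes "int q = 24 * M + 11" "M \<ge> 1"
  shows "\<exists>T. zs_cover (cyc q) q T {4 * M + 2, 8 * M + 4}"
  by (rule nest_cover[where q = q and k = "2 * M + 1" and j = "2 * M" and FO = "{2 * M + 1}" and FE = "{M + 1}"
      and T = "{(5 * M + 2, 7 * M + 4, 12 * M + 5), (2 * M + 2, 4 * M + 1, - (6 * M + 3))}"
      and E = "{4 * M + 2, 8 * M + 4}" and fo = 1 and fe = 1 and ts = "[(5 * M + 2, 7 * M + 4, 12 * M + 5), (2 * M + 2, 4 * M + 1, - (6 * M + 3))]" and es = "[4 * M + 2, 8 * M + 4]"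
      and G = "{4 * M + 2}"
      and W = "{5 * M + 2, 7 * M + 4, 12 * M + 5, 2 * M + 2, 4 * M + 1, 6 * M + 3, 4 * M + 2, 8 * M + 4}" and A = "8 * M + 4" and B = "4 * M + 3"],
      use assms(1) in presburger, (elim disjE; use assms in \<open>clarsimp; linarith\<close>),
      (use assms in \<open>(auto simp: card_insert_if)[1]\<close>)+)

text \<open>The leftovers are in the ratio 2 only modulo q: twice 8M + 7 is q - (8M + 9), hence the
  minus sign.\<close>

lemma double_cover_3:
  fixes M :: int assumes "int q = 24 * M + 23" "M \<ge> 1"
  shows "\<exists>T. zs_cover (cyc q) q T {8 * M + 7, - (8 * M + 9)}"
  by (rule nest_cover[where q = q and k = "2 * M + 2" and j = "2 * M + 1" and FO = "{2 * M + 1}" and FE = "{M + 2}"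
      and T = "{(5 * M + 3, 7 * M + 7, - (12 * M + 10)), (2 * M + 4, 4 * M + 1, - (6 * M + 5))}"
      and E = "{8 * M + 7, - (8 * M + 9)}" and fo = 1 and fe = 1 and ts = "[(5 * M + 3, 7 * M + 7, - (12 * M + 10)), (2 * M + 4, 4 * M + 1, - (6 * M + 5))]" and es = "[8 * M + 7, - (8 * M + 9)]"
      and G = "{8 * M + 7}"
      and W = "{5 * M + 3, 7 * M + 7, 12 * M + 10, 2 * M + 4, 4 * M + 1, 6 * M + 5, 8 * M + 7, 8 * M + 9}" and A = "8 * M + 8" and B = "4 * M + 4"],
      use assms(1) in presburger, (elim disjE; use assms in \<open>clarsimp; linarith\<close>),
      (use assms in \<open>(auto simp: card_insert_if)[1]\<close>)+)

text \<open>The two intervals adjoin each other and reach (q - 1) / 2, so the midpoint of the second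
  is the only leftover. In the next lemma the top value joins it.\<close>

lemma one_hole_cover:
  fixes k j :: int assumes "int q = 6 * (k + j) + 3" "0 \<le> j" "j \<le> k" "k \<le> j + 1"
  shows "\<exists>T. zs_cover (cyc q) q T {3 * k + 2 * j + 1}"
  by (rule nest_cover[where q = q and k = k and j = j and FO = "{}" and FE = "{}"
      and T = "{}"
      and E = "{3 * k + 2 * j + 1}" and fo = 0 and fe = 0 and ts = "[]" and es = "[3 * k + 2 * j + 1]"
      and G = "{}"
      and W = "{3 * k + 2 * j + 1}" and A = "k + j + 1" and B = "3 * k + j + 1"],
      use assms(1) in presburger, (elim disjE; use assms in \<open>clarsimp; linarith\<close>),
      (use assms in \<open>(auto simp: card_insert_if)[1]\<close>)+)

lemma two_hole_cover:
  fixes k j :: int assumes "int q = 6 * (k + j) + 5" "0 \<le> j" "j \<le> k" "k \<le> j + 1"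
  shows "\<exists>T. zs_cover (cyc q) q T {3 * k + 2 * j + 1, 3 * k + 3 * j + 2}"
  by (rule nest_cover[where q = q and k = k and j = j and FO = "{}" and FE = "{}"
      and T = "{}"
      and E = "{3 * k + 2 * j + 1, 3 * k + 3 * j + 2}" and fo = 0 and fe = 0 and ts = "[]" and es = "[3 * k + 2 * j + 1, 3 * k + 3 * j + 2]"
      and G = "{3 * k + 3 * j + 2}"
      and W = "{3 * k + 2 * j + 1, 3 * k + 3 * j + 2}" and A = "k + j + 1" and B = "3 * k + j + 1"],
      use assms(1) in presburger, (elim disjE; use assms in \<open>clarsimp; linarith\<close>),
      (use assms in \<open>(auto simp: card_insert_if)[1]\<close>)+)

text \<open>Turns a doubling modulo q into a doubling of integers, the form in which the pair enters
  \<open>quint\<close>.\<close>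

lemma zs_cover_double:
  assumes "zs_cover (cyc q) q T {d, d'}" "int q dvd 2 * d - d'" "d \<noteq> d'"
  shows "zs_cover (cyc q) q T {d, 2 * d}"
proof (rule zs_coverI)
  have "card {d, 2 * d} \<le> 2" by (simp add: card_insert_if)
  moreover have "6 * card T + 2 * 2 + 1 \<le> q"
    using zs_coverD(3)[OF assms(1)] assms(3) by simp
  ultimately show "6 * card T + 2 * card {d, 2 * d} + 1 \<le> q" by linarith
next
  fix v assume "v \<notin> cyc q"
  then obtain e where e: "e \<in> supp T \<union> {d, d'}" "v \<in> pm (cyc q) e"
    using zs_coverD(5)[OF assms(1)] by blast
  show "\<exists>e\<in>supp T \<union> {d, 2 * d}. v \<in> pm (cyc q) e"
  proof (cases "e = d'")
    case True
    have "int q dvd v - d' \<Longrightarrow> int q dvd v - 2 * d"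
      using dvd_diff[OF _ assms(2), of "v - d'"] by simp
    moreover have "int q dvd v + d' \<Longrightarrow> int q dvd v + 2 * d"
      using dvd_add[OF _ assms(2), of "v + d'"] by simp
    ultimately have "v \<in> pm (cyc q) (2 * d)" using e(2) True by (auto simp: pm_def cyc_def)
    then show ?thesis by blast
  qed (use e in auto)
qed (use zs_coverD[OF assms(1)] in auto)

section \<open>Cyclic covers for all odd moduli\<close>

lemma mod_24_cases:
  obtains M :: int where "0 \<le> M" "int q = 24 * M + int (q mod 6) \<or> int q = 24 * M + (6 + int (q mod 6)) \<or>
    int q = 24 * M + (12 + int (q mod 6)) \<or> int q = 24 * M + (18 + int (q mod 6))"
proof -
  define k r l s where "k = q div 6" and "r = q mod 6" and "l = k div 4" and "s = k mod 4"
  have "q = 6 * k + r" "k = 4 * l + s" by (simp_all add: k_def r_def l_def s_def)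
  moreover have "s < 4" by (simp add: s_def)
  then have "s = 0 \<or> s = 1 \<or> s = 2 \<or> s = 3" by linarith
  ultimately have "int q = 24 * int l + int r \<or> int q = 24 * int l + (6 + int r) \<or>
      int q = 24 * int l + (12 + int r) \<or> int q = 24 * int l + (18 + int r)" by auto
  then show thesis unfolding r_def by (intro that[of "int l"]) simp_all
qed

text \<open>This is Heffter's first difference problem. The moduli 1, 7 and 13 are listed separately
  because the general parameters degenerate there: an index leaves its range or \<open>j\<close>
  becomes negative.\<close>

lemma full_cover:
  assumes "q mod 6 = 1"
  shows "\<exists>T. zs_cover (cyc q) q T {}"
proof -
  have q1: ?thesis if "q = 1"
  proof -
    have "zs_cover (cyc q) q {} {}" using that by (intro cyclic_coverI) auto
    then show ?thesis by blast
  qed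
  have q7: ?thesis if q: "q = 7"
  proof -
    have "v = 1 \<or> v = 2 \<or> v = 3" if "1 \<le> v" "2 * v < int q" for v
      using q that by presburger
    with q have "zs_cover (cyc q) q {(1, 2, - 3)} {}" by (intro cyclic_coverI) auto
    then show ?thesis by blast
  qed
  have q13: ?thesis if q: "q = 13"
  proof -
    have "v = 1 \<or> v = 2 \<or> v = 3 \<or> v = 4 \<or> v = 5 \<or> v = 6" if "1 \<le> v" "2 * v < int q" for v
      using q that by presburger
    with q have "zs_cover (cyc q) q {(2, 5, 6), (1, 3, - 4)} {}" by (intro cyclic_coverI) auto
    then show ?thesis by blast
  qed
  obtain M where M: "M \<ge> 0"
    and "int q = 24 * M + 1 \<or> int q = 24 * M + 7 \<or> int q = 24 * M + 13 \<or> int q = 24 * M + 19"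
    using mod_24_cases[of q] assms by auto
  then show ?thesis
  proof (elim disjE)
    assume q: "int q = 24 * M + 1"
    show ?thesis
    proof (cases "M = 0")
      case True
      with q have "q = 1" by simp
      then show ?thesis by (rule q1)
    next
      case False
      with M have "M \<ge> 1" by simp
      from full_cover_0[OF q this] show ?thesis .
    qed
  next
    assume q: "int q = 24 * M + 7"
    show ?thesis
    proof (cases "M = 0")
      case True
      with q have "q = 7" by simp
      then show ?thesis by (rule q7)
    next
      case False
      with M have "M \<ge> 1" by simp
      from full_cover_1[OF q this] show ?thesis .
    qed
  next
    assume q: "int q = 24 * M + 13"
    show ?thesis
    proof (cases "M = 0")
      case True
      with q have "q = 13" by simp
      then show ?thesis by (rule q13)
    next
      case False
      with M have "M \<ge> 1" by simp
      from full_cover_2[OF q this] show ?thesis .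
    qed
  next
    assume q: "int q = 24 * M + 19"
    from full_cover_3[OF q M] show ?thesis .
  qed
qed

text \<open>This is Heffter's second difference problem. Modulo 9 it has no solution: no signed sum
  of 1, 2, 4 is divisible by 9.\<close>

lemma third_cover:
  assumes "q mod 6 = 3" "q \<noteq> 9"
  shows "\<exists>T. zs_cover (cyc q) q T {int (q div 3)}"
proof -
  have third: "int (q div 3) = r" if "int q = 3 * r" for r
    using that by presburger
  have q3: ?thesis if q: "q = 3"
  proof -
    have "v = 1" if "1 \<le> v" "2 * v < int q" for v
      using q that by presburger
    with q have "zs_cover (cyc q) q {} {int (q div 3)}" by (intro cyclic_coverI) auto
    then show ?thesis by blast
  qed
  obtain M where M: "M \<ge> 0"
    and "int q = 24 * M + 3 \<or> int q = 24 * M + 9 \<or> int q = 24 * M + 15 \<or> int q = 24 * M + 21"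
    using mod_24_cases[of q] assms(1) by auto
  then show ?thesis
  proof (elim disjE)
    assume q: "int q = 24 * M + 3"
    show ?thesis
    proof (cases "M = 0")
      case True
      with q have "q = 3" by simp
      then show ?thesis by (rule q3)
    next
      case False
      with M have "M \<ge> 1" by simp
      from third_cover_0[OF q this] show ?thesis using third[of "8 * M + 1"] q by simp
    qed
  next
    assume q: "int q = 24 * M + 9"
    show ?thesis
    proof (cases "M = 0")
      case True
      with q have "q = 9" by simp
      then show ?thesis using assms(2) by simp
    next
      case False
      with M have "M \<ge> 1" by simp
      from third_cover_1[OF q this] show ?thesis using third[of "8 * M + 3"] q by simp
    qed
  next
    assume q: "int q = 24 * M + 15"
    from third_cover_2[OF q M] show ?thesis using third[of "8 * M + 5"] q by simp
  next
    assume q: "int q = 24 * M + 21"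
    from third_cover_3[OF q M] show ?thesis using third[of "8 * M + 7"] q by simp
  qed
qed

text \<open>Modulo 11 multiplication by a unit reduces any such pair to d = 1, and then no signed
  sum of the remaining classes 3, 4, 5 is divisible by 11.\<close>

lemma double_cover:
  assumes "q mod 6 = 5" "q \<noteq> 11"
  shows "\<exists>T d. zs_cover (cyc q) q T {d, 2 * d}"
proof -
  have q23: ?thesis if q: "q = 23"
  proof -
    have "v = 1 \<or> v = 2 \<or> v = 3 \<or> v = 4 \<or> v = 5 \<or> v = 6 \<or> v = 7 \<or> v = 8 \<or> v = 9 \<or> v = 10 \<or> v = 11"
      if "1 \<le> v" "2 * v < int q" for v using q that by presburger
    with q have "zs_cover (cyc q) q {(4, 7, - 11), (5, 8, 10), (3, 6, - 9)} {1, 2 * 1}"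
      by (intro cyclic_coverI) auto
    then show ?thesis by blast
  qed
  obtain M where M: "M \<ge> 0"
    and *: "int q = 24 * M + 5 \<or> int q = 24 * M + 11 \<or> int q = 24 * M + 17 \<or> int q = 24 * M + 23"
    using mod_24_cases[of q] assms(1) by auto
  have even_case: ?thesis if q: "int q = 12 * N + 5" "N \<ge> 0" for N
  proof -
    obtain T where T: "zs_cover (cyc q) q T {3 * N + 1, 6 * N + 2}"
      using double_cover_0[OF q] by blast
    have "3 * N + 1 \<noteq> 6 * N + 2" using q(2) by linarith
    then have "zs_cover (cyc q) q T {3 * N + 1, 2 * (3 * N + 1)}"
      by (intro zs_cover_double[OF T]) simp_all
    then show ?thesis by blast
  qed
  from * show ?thesis
  proof (elim disjE)
    assume "int q = 24 * M + 5"
    then show ?thesis using M by (intro even_case[of "2 * M"]) simp_all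
  next
    assume "int q = 24 * M + 17"
    then show ?thesis using M by (intro even_case[of "2 * M + 1"]) simp_all
  next
    assume q: "int q = 24 * M + 11"
    then have M1: "M \<ge> 1" using M assms(2) by (cases "M = 0") simp_all
    obtain T where T: "zs_cover (cyc q) q T {4 * M + 2, 8 * M + 4}"
      using double_cover_1[OF q M1] by blast
    have "4 * M + 2 \<noteq> 8 * M + 4" using M1 by linarith
    then have "zs_cover (cyc q) q T {4 * M + 2, 2 * (4 * M + 2)}"
      by (intro zs_cover_double[OF T]) simp_all
    then show ?thesis by blast
  next
    assume q: "int q = 24 * M + 23"
    show ?thesis
    proof (cases "M = 0")
      case True
      with q have "q = 23" by simp
      then show ?thesis by (rule q23)
    next
      case False
      with M have M1: "M \<ge> 1" by simp
      obtain T where T: "zs_cover (cyc q) q T {8 * M + 7, - (8 * M + 9)}"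
        using double_cover_3[OF q M1] by blast
      have "8 * M + 7 \<noteq> - (8 * M + 9)" using M1 by linarith
      with q have "zs_cover (cyc q) q T {8 * M + 7, 2 * (8 * M + 7)}"
        by (intro zs_cover_double[OF T]) simp_all
      then show ?thesis by blast
    qed
  qed
qed

lemma hole_cover:
  assumes "q mod 6 = 3"
  shows "\<exists>T d. zs_cover (cyc q) q T {d}"
proof -
  have half: "0 \<le> t div 2 \<and> t div 2 \<le> t - t div 2 \<and> t - t div 2 \<le> t div 2 + 1" if "0 \<le> t" for t :: int
    using that by presburger
  obtain t where q: "q = 6 * t + 3" using assms by (metis mult_div_mod_eq)
  obtain j where "0 \<le> j" "j \<le> int t - j" "int t - j \<le> j + 1" using half[of "int t"] by auto
  moreover have "int q = 6 * (int t - j + j) + 3" using q by simp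
  ultimately show ?thesis using one_hole_cover by blast
qed

lemma two_cover:
  assumes "q mod 6 = 5"
  shows "\<exists>T a b. zs_cover (cyc q) q T {a, b}"
proof -
  have half: "0 \<le> t div 2 \<and> t div 2 \<le> t - t div 2 \<and> t - t div 2 \<le> t div 2 + 1" if "0 \<le> t" for t :: int
    using that by presburger
  obtain t where q: "q = 6 * t + 5" using assms by (metis mult_div_mod_eq)
  obtain j where "0 \<le> j" "j \<le> int t - j" "int t - j \<le> j + 1" using half[of "int t"] by auto
  moreover have "int q = 6 * (int t - j + j) + 5" using q by simp
  ultimately show ?thesis using two_hole_cover by blast
qed

lemma small_cover:
  assumes "odd q"
  shows "\<exists>T E. zs_cover (cyc q) q T E \<and> card E \<le> 2"
proof -
  have "q mod 6 = 1 \<or> q mod 6 = 3 \<or> q mod 6 = 5" using assms by presburger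
  then consider T where "zs_cover (cyc q) q T {}" | T d where "zs_cover (cyc q) q T {d}"
    | T a b where "zs_cover (cyc q) q T {a, b}" using full_cover hole_cover two_cover by meson
  then show ?thesis
  proof cases
    case 3
    then show ?thesis by (intro exI[of _ T] exI[of _ "{a, b}"]) (simp add: card_insert_if)
  qed force+
qed

section \<open>Zero-sum triples in products of two cyclic groups\<close>

text \<open>A lattice of integer vectors replaces the quotient group, so that signs and multiples
  are those of integers and one vector can be read both modulo (p, q) and modulo (2p, 2q).\<close>

definition lat :: "nat \<Rightarrow> nat \<Rightarrow> (int \<times> int) set" where
  "lat p q = {v. int p dvd fst v \<and> int q dvd snd v}"

lemma lat_pair [simp]: "(x, y) \<in> lat p q \<longleftrightarrow> int p dvd x \<and> int q dvd y"
  by (simp add: lat_def)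

lemma half_range_double:
  assumes "odd p" "\<not> int p dvd x"
  obtains r where "1 \<le> r" "2 * r < int p" "int p dvd x - 2 * r \<or> int p dvd x + 2 * r"
proof -
  obtain k where k: "int p = 2 * k + 1" using assms(1) by (metis even_of_nat oddE)
  \<comment> \<open>Multiplication by \<open>k + 1\<close> is division by 2 modulo
    \<open>2 * k + 1\<close>.\<close>
  have "\<not> int p dvd x * (k + 1)"
  proof
    assume "int p dvd x * (k + 1)"
    then have "int p dvd 2 * (x * (k + 1)) - x * int p" by (metis dvd_diff dvd_mult dvd_refl)
    then show False using assms(2) k by (simp add: algebra_simps)
  qed
  then obtain r where r: "1 \<le> r" "2 * r < int p" "int p dvd x * (k + 1) - r \<or> int p dvd x * (k + 1) + r"
    using half_range[OF assms(1)] by blast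
  have "int p dvd 2 * (x * (k + 1) - r) - x * int p \<or> int p dvd 2 * (x * (k + 1) + r) - x * int p"
    using r(3) by (metis dvd_diff dvd_mult dvd_refl)
  moreover have "2 * (x * (k + 1) - r) - x * int p = x - 2 * r"
    "2 * (x * (k + 1) + r) - x * int p = x + 2 * r" using k by (simp_all add: algebra_simps)
  ultimately have "int p dvd x - 2 * r \<or> int p dvd x + 2 * r" by (simp only:)
  then show thesis using r by (intro that)
qed

lemma pm_lat_uminus: "v \<in> pm (lat p q) (- e) \<longleftrightarrow> v \<in> pm (lat p q) e"
  by (auto simp: pm_def)

lemma uminus_pm_lat: "- v \<in> pm (lat p q) e \<longleftrightarrow> v \<in> pm (lat p q) e"
proof -
  have "u \<in> lat p q \<longleftrightarrow> - u \<in> lat p q" for u :: "int \<times> int" by (cases u) simp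
  from this[of "- v - e"] this[of "- v + e"] show ?thesis by (auto simp: pm_def algebra_simps)
qed

lemma pm_latI:
  "int p dvd x - a \<Longrightarrow> int q dvd y - b \<Longrightarrow> (x, y) \<in> pm (lat p q) (a, b)"
  "int p dvd x + a \<Longrightarrow> int q dvd y + b \<Longrightarrow> (x, y) \<in> pm (lat p q) (a, b)"
  by (simp_all add: pm_def)

section \<open>Lifting along the projection to the second factor\<close>

definition lift :: "nat \<Rightarrow> (int \<times> int \<times> int) set \<Rightarrow> ((int \<times> int) \<times> (int \<times> int) \<times> (int \<times> int)) set" where
  "lift p T = (\<lambda>(x, a, b, c). ((x, a), (x, b), (- 2 * x, c))) ` ({0..<int p} \<times> T)"

definition base :: "(int \<times> int \<times> int) set \<Rightarrow> ((int \<times> int) \<times> (int \<times> int) \<times> (int \<times> int)) set" where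
  "base T = (\<lambda>(a, b, c). ((a, 0), (b, 0), (c, 0))) ` T"

lemma lift_card: "finite T \<Longrightarrow> card (lift p T) \<le> p * card T"
  unfolding lift_def by (rule order_trans[OF card_image_le]) (auto simp: card_cartesian_product)

text \<open>The fibres over a and b are filled because x runs through all residues modulo p; the
  fibre over c is filled because -2 is a unit modulo the odd number p, so that -2 * x does so as
  well.\<close>

lemma lift_cover:
  assumes "odd p" "e \<in> supp T" "y \<in> pm (cyc q) e"
  shows "\<exists>e'\<in>supp (lift p T). (x, y) \<in> pm (lat p q) e'"
proof -
  have main: "\<exists>e'\<in>supp (lift p T). (x, y) \<in> pm (lat p q) e'" if "int q dvd y - e" for x y
  proof -
    obtain a b c where abc: "(a, b, c) \<in> T" "e \<in> {a, b, c}" using suppE[OF assms(2)] .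
    obtain k where k: "int p = 2 * k + 1" using assms(1) by (metis even_of_nat oddE)
    have mem: "{(z mod int p, a), (z mod int p, b), (- 2 * (z mod int p), c)} \<subseteq> supp (lift p T)" for z
    proof (rule supp_triple)
      have "z mod int p \<in> {0..<int p}" using k assms(1) by (cases p) auto
      then show "((z mod int p, a), (z mod int p, b), (- 2 * (z mod int p), c)) \<in> lift p T"
        using abc(1) unfolding lift_def by force
    qed
    show ?thesis
    proof (cases "e = c")
      case True
      \<comment> \<open>With \<open>int p = 2 * k + 1\<close>, the solution z of -2 * z = x modulo p
        is z = k * x.\<close>
      have "int p dvd x * int p + 2 * (k * x mod int p - k * x)"
        by (metis dvd_add dvd_mult dvd_refl dvd_minus_mod dvd_diff_commute)
      also have "x * int p + 2 * (k * x mod int p - k * x) = x + 2 * (k * x mod int p)"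
        using k by (simp add: algebra_simps)
      finally have "(x, y) \<in> pm (lat p q) (- 2 * (k * x mod int p), c)"
        using that True by (intro pm_latI(1)) (auto simp: algebra_simps)
      then show ?thesis using mem[of "k * x"] by blast
    next
      case False
      then have "(x, y) \<in> pm (lat p q) (x mod int p, e)" using that by (intro pm_latI(1)) auto
      moreover have "(x mod int p, e) \<in> supp (lift p T)" using mem[of x] False abc(2) by auto
      ultimately show ?thesis by blast
    qed
  qed
  from assms(3) consider "int q dvd y - e" | "int q dvd y + e" by (auto simp: pm_def cyc_def)
  then show ?thesis
  proof cases
    case 2
    then have "int q dvd (- y) - e" by (metis diff_conv_add_uminus dvd_minus_iff minus_add_distrib)
    from main[OF this, of "- x"] show ?thesis
      using uminus_pm_lat[of "(x, y)"] by auto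
  qed (rule main)
qed

lemma lift_zero_sum:
  assumes "\<And>a b c. (a, b, c) \<in> T \<Longrightarrow> a + b + c \<in> cyc q" "(u, v, w) \<in> lift p T"
  shows "u + v + w \<in> lat p q"
  using assms by (auto simp: lift_def cyc_def)

lemma base_zero_sum:
  assumes "\<And>a b c. (a, b, c) \<in> T \<Longrightarrow> a + b + c \<in> cyc p" "(u, v, w) \<in> base T"
  shows "u + v + w \<in> lat p q"
  using assms by (auto simp: base_def cyc_def)

lemma base_cover:
  assumes "x \<in> pm (cyc p) e" "int q dvd y"
  shows "(x, y) \<in> pm (lat p q) (e, 0)"
  using assms by (auto simp: pm_def cyc_def)

lemma base_supp: "e \<in> supp T \<Longrightarrow> (e, 0) \<in> supp (base T)"
  unfolding supp_def base_def by force

text \<open>The lifted triples exhaust everything outside the fibre over 0. That fibre is a copy of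
  Z_p, where a cyclic cover leaves at most two classes over.\<close>

lemma cover_mod_1:
  assumes p: "odd p" and q: "q mod 6 = 1"
  shows "\<exists>T E. zs_cover (lat p q) (p * q) T E \<and> card E \<le> 2"
proof -
  obtain T where T: "zs_cover (cyc q) q T {}" using full_cover[OF q] by blast
  obtain S E where S: "zs_cover (cyc p) p S E" "card E \<le> 2" using small_cover[OF p] by blast
  note T' = zs_coverD[OF T] and S' = zs_coverD[OF S(1)]
  define E' where "E' = (\<lambda>e. (e, 0 :: int)) ` E"
  have cE: "card E' \<le> card E" unfolding E'_def using S'(2) by (rule card_image_le)
  have cB: "card (base S) \<le> card S" unfolding base_def using S'(1) by (rule card_image_le)
  have "zs_cover (lat p q) (p * q) (lift p T \<union> base S) E'"
  proof (rule zs_coverI)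
    show "finite (lift p T \<union> base S)" "finite E'"
      using T' S' by (auto simp: lift_def base_def E'_def)
    have "p * (6 * card T + 1) \<le> p * q" using T'(3) by (intro mult_le_mono2) simp
    then show "6 * card (lift p T \<union> base S) + 2 * card E' + 1 \<le> p * q"
      using card_Un_le[of "lift p T" "base S"] lift_card[OF T'(1), of p] cB cE S'(3)
      by (simp add: algebra_simps)
  next
    fix a b c assume "(a, b, c) \<in> lift p T \<union> base S"
    then show "a + b + c \<in> lat p q"
      using lift_zero_sum[OF T'(4)] base_zero_sum[OF S'(4)] by blast
  next
    fix v assume v: "v \<notin> lat p q"
    obtain x y where xy: "v = (x, y)" by fastforce
    show "\<exists>e\<in>supp (lift p T \<union> base S) \<union> E'. v \<in> pm (lat p q) e"
    proof (cases "int q dvd y")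
      case True
      then have "x \<notin> cyc p" using v xy by (simp add: cyc_def)
      then obtain e where e: "e \<in> supp S \<union> E" "x \<in> pm (cyc p) e" using S'(5) by blast
      from e(1) have "(e, 0) \<in> supp (base S) \<union> E'" using base_supp by (auto simp: E'_def)
      with base_cover[OF e(2) True] show ?thesis unfolding xy by auto
    next
      case False
      then have "y \<notin> cyc q" by (simp add: cyc_def)
      then obtain e where "e \<in> supp T" "y \<in> pm (cyc q) e" using T'(5) by auto
      from lift_cover[OF p this] show ?thesis unfolding xy by auto
    qed
  qed
  then show ?thesis using cE S(2) by (meson order_trans)
qed

section \<open>Explicit covers checked by evaluation\<close>

lemma lat_coverI:
  assumes pq: "p > 0" "q > 0" and "finite T" "finite E" "6 * card T + 2 * card E + 1 \<le> p * q"
    and "\<And>a b c. (a, b, c) \<in> T \<Longrightarrow> a + b + c \<in> lat p q"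
    and cov: "\<And>x y. 0 \<le> x \<Longrightarrow> x < int p \<Longrightarrow> 0 \<le> y \<Longrightarrow> y < int q \<Longrightarrow> (x, y) \<noteq> 0 \<Longrightarrow>
      \<exists>e\<in>supp T \<union> E. (x, y) \<in> pm (lat p q) e"
  shows "zs_cover (lat p q) (p * q) T E"
proof (rule zs_coverI)
  fix v assume v: "v \<notin> lat p q"
  obtain x y where xy: "v = (x, y)" by fastforce
  define z where "z = (x mod int p, y mod int q)"
  have d: "v - z \<in> lat p q" by (simp add: xy z_def)
  have "z \<noteq> 0" using v by (auto simp: xy z_def zero_prod_def dvd_eq_mod_eq_0)
  then obtain e where e: "e \<in> supp T \<union> E" "z \<in> pm (lat p q) e"
    using cov[of "x mod int p" "y mod int q"] pq unfolding z_def by auto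
  have add: "u + w \<in> lat p q" if "u \<in> lat p q" "w \<in> lat p q" for u w :: "int \<times> int"
    using that by (auto simp: lat_def)
  have "v \<in> pm (lat p q) e"
    using e(2) add[OF d, of "z - e"] add[OF d, of "z + e"] by (auto simp: pm_def)
  with e(1) show "\<exists>e\<in>supp T \<union> E. v \<in> pm (lat p q) e" by blast
qed (use assms in auto)

text \<open>Stated with lists and \<open>mod\<close> on a box of representatives so that it can be
  evaluated. Distinctness of the entries is not tested; the bound on the lengths takes care of the
  count.\<close>

definition check_cover ::
  "int \<Rightarrow> int \<Rightarrow> ((int \<times> int) \<times> (int \<times> int) \<times> (int \<times> int)) list \<Rightarrow> (int \<times> int) list \<Rightarrow> bool" where
  "check_cover p q ts es \<longleftrightarrow> 
     list_all (\<lambda>((a, a'), (b, b'), (c, c')). (a + b + c) mod p = 0 \<and> (a' + b' + c') mod q = 0) ts \<and>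
     list_all (\<lambda>x. list_all (\<lambda>y. x = 0 \<and> y = 0 \<or>
         list_ex (\<lambda>(a, b). (x - a) mod p = 0 \<and> (y - b) mod q = 0 \<or> (x + a) mod p = 0 \<and> (y + b) mod q = 0)
           (concat (map (\<lambda>(a, b, c). [a, b, c]) ts) @ es)) [0..q - 1]) [0..p - 1]"

lemma check_cover:
  assumes chk: "check_cover (int p) (int q) ts es" and pq: "p > 0" "q > 0"
    and len: "6 * length ts + 2 * length es + 1 \<le> p * q"
  shows "zs_cover (lat p q) (p * q) (set ts) (set es)"
proof (rule lat_coverI[OF pq])
  show "6 * card (set ts) + 2 * card (set es) + 1 \<le> p * q"
    using len card_length[of ts] card_length[of es] by linarith
  show "a + b + c \<in> lat p q" if "(a, b, c) \<in> set ts" for a b c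
    using chk that by (fastforce simp: check_cover_def list_all_iff lat_def dvd_eq_mod_eq_0)
next
  fix x y :: int assume "0 \<le> x" "x < int p" "0 \<le> y" "y < int q" "(x, y) \<noteq> 0"
  then have xy: "x \<in> set [0..int p - 1]" "y \<in> set [0..int q - 1]" "\<not> (x = 0 \<and> y = 0)"
    by (auto simp: zero_prod_def)
  have "\<forall>x\<in>set [0..int p - 1]. \<forall>y\<in>set [0..int q - 1]. x = 0 \<and> y = 0 \<or>
      list_ex (\<lambda>(a, b). (x - a) mod p = 0 \<and> (y - b) mod q = 0 \<or> (x + a) mod p = 0 \<and> (y + b) mod q = 0)
      (concat (map (\<lambda>(a, b, c). [a, b, c]) ts) @ es)"
    using chk unfolding check_cover_def list_all_iff by blast
  with xy have "list_ex (\<lambda>(a, b). (x - a) mod p = 0 \<and> (y - b) mod q = 0 \<or> (x + a) mod p = 0 \<and> (y + b) mod q = 0)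
      (concat (map (\<lambda>(a, b, c). [a, b, c]) ts) @ es)"
    by blast
  then obtain a b where ab: "(a, b) \<in> set (concat (map (\<lambda>(a, b, c). [a, b, c]) ts) @ es)"
    "(x - a) mod p = 0 \<and> (y - b) mod q = 0 \<or> (x + a) mod p = 0 \<and> (y + b) mod q = 0"
    unfolding list_ex_iff Bex_def split_paired_Ex prod.case by (elim exE conjE) (rule that)
  have "set (concat (map (\<lambda>(a, b, c). [a, b, c]) ts) @ es) = supp (set ts) \<union> set es"
    by (auto simp: supp_def)
  with ab(1) have "(a, b) \<in> supp (set ts) \<union> set es" by (simp only:)
  moreover have "(x, y) \<in> pm (lat p q) (a, b)" using ab(2) by (auto simp: pm_def dvd_eq_mod_eq_0)
  ultimately show "\<exists>e\<in>supp (set ts) \<union> set es. (x, y) \<in> pm (lat p q) e" by blast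
qed simp_all

definition scale_all where
  "scale_all ms ts = concat (map (\<lambda>m. map (\<lambda>((a, a'), (b, b'), (c, c')).
     ((m * a, m * a'), (m * b, m * b'), (m * c, m * c'))) ts) ms)"

text \<open>The lists were found by computer among the families that are invariant, up to sign, under
  multiplication by 3 modulo 11 and by 2 modulo 9.\<close>

lemma cover_11_11: "\<exists>T. zs_cover (lat 11 11) (11 * 11) T {}"
proof -
  let ?ts = "scale_all [1, 3, 9, 5, 4] [((0, 1), (1, 0), (10, 10)), ((1, 2), (9, 5), (1, 4)),
    ((1, 5), (9, 10), (1, 7)), ((1, 8), (9, 4), (1, 10))] :: ((int \<times> int) \<times> (int \<times> int) \<times> (int \<times> int)) list"
  have "check_cover 11 11 ?ts []" by code_simp
  then have "zs_cover (lat 11 11) (11 * 11) (set ?ts) (set [])"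
    by (intro check_cover) (simp_all add: scale_all_def)
  then show ?thesis by auto
qed

text \<open>The leftovers represent the four classes of order 3. The last one is written with -6 =
  -2 * 3 to match the form in \<open>cover_mod_3_3\<close>.\<close>

lemma cover_9_9: "\<exists>T. zs_cover (lat 9 9) (9 * 9) T {(0, 3), (3, 3), (3, -3), (-6, 0)}"
proof -
  let ?ts = "scale_all [1, 2, 4] [((0, 1), (1, 0), (8, 8)), ((1, 2), (7, 3), (1, 4)),
    ((1, 5), (5, 3), (3, 1)), ((1, 7), (2, 7), (6, 4))] :: ((int \<times> int) \<times> (int \<times> int) \<times> (int \<times> int)) list"
  have "check_cover 9 9 ?ts [(0, 3), (3, 3), (3, -3), (-6, 0)]" by code_simp
  then have "zs_cover (lat 9 9) (9 * 9) (set ?ts) (set [(0, 3), (3, 3), (3, -3), (-6, 0)])"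
    by (intro check_cover) (simp_all add: scale_all_def)
  then show ?thesis by auto
qed

section \<open>Second factor an odd multiple of 3\<close>

definition column :: "int \<Rightarrow> int set \<Rightarrow> ((int \<times> int) \<times> (int \<times> int) \<times> (int \<times> int)) set" where
  "column d X = (\<lambda>x. ((x, d), (x, - d), (- 2 * x, 0))) ` X"

text \<open>The lift leaves the fibres over 0, d and -d. As (x, -d) is the class of (-x, d), the
  points (x, d) and (x, -d) with 1 <= x <= (p - 1) / 2 exhaust the fibres over d and -d except (0,
  d), and the points (-2 * x, 0) exhaust the fibre over 0. \<open>X\<close> collects the columns
  that are dissolved into leftovers.\<close>

lemma column_cover:
  assumes p: "odd p" and T: "zs_cover (cyc q) q T {d}"
    and X: "X \<subseteq> {1..(int p - 1) div 2}"
    and E: "finite E" "card E \<le> 1 + 3 * card X" "(0, d) \<in> E"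
      "\<And>x. x \<in> X \<Longrightarrow> {(x, d), (x, - d), (- 2 * x, 0)} \<subseteq> E"
  shows "zs_cover (lat p q) (p * q) (lift p T \<union> column d ({1..(int p - 1) div 2} - X)) E"
    (is "zs_cover _ _ (_ \<union> column d (?S - X)) E")
proof (rule zs_coverI)
  note T' = zs_coverD[OF T]
  have fX: "finite X" using X finite_subset by blast
  show "finite (lift p T \<union> column d (?S - X))" using T'(1) by (auto simp: lift_def column_def)
  have "card (column d (?S - X)) \<le> card ?S - card X"
    unfolding column_def using card_image_le[of "?S - X"] card_Diff_subset[OF fX X] by fastforce
  moreover have "2 * card ?S + 1 = p" using p by (auto elim!: oddE)
  moreover have "card X \<le> card ?S" using X by (intro card_mono) auto
  \<comment> \<open>Three fibres have 3 * p elements, and 6 * ((p - 1) / 2) + 2 + 1 = 3 * p;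
    dissolving a column trades 6 for 2 * 3.\<close>
  moreover have "6 * (p * card T) + 3 * p \<le> p * q"
    using mult_le_mono2[OF T'(3), of p] by (simp add: algebra_simps)
  ultimately show "6 * card (lift p T \<union> column d (?S - X)) + 2 * card E + 1 \<le> p * q"
    using card_Un_le[of "lift p T" "column d (?S - X)"] lift_card[OF T'(1), of p] E(2) by linarith
next
  fix a b c assume "(a, b, c) \<in> lift p T \<union> column d (?S - X)"
  moreover have "a + b + c \<in> lat p q" if "(a, b, c) \<in> column d (?S - X)"
    using that by (auto simp: column_def)
  ultimately show "a + b + c \<in> lat p q" using lift_zero_sum[OF zs_coverD(4)[OF T]] by blast
next
  fix v assume v: "v \<notin> lat p q"
  let ?C = "\<lambda>v. \<exists>e\<in>supp (lift p T \<union> column d (?S - X)) \<union> E. v \<in> pm (lat p q) e"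
  have in_col: "{(r, d), (r, - d), (- 2 * r, 0)} \<subseteq> supp (lift p T \<union> column d (?S - X)) \<union> E"
    if "1 \<le> r" "2 * r < int p" for r
  proof (cases "r \<in> X")
    case False
    have "r \<le> (int p - 1) div 2" using that(2) by linarith
    then have "((r, d), (r, - d), (- 2 * r, 0)) \<in> column d (?S - X)"
      using that False by (auto simp: column_def)
    from supp_triple[OF this] show ?thesis by auto
  qed (use E(4) in blast)
  have col: "?C (x, y)" if d: "int q dvd y - d" for x y
  proof (cases "int p dvd x")
    case True
    then have "(x, y) \<in> pm (lat p q) (0, d)" using d by (intro pm_latI(1)) auto
    then show ?thesis using E(3) by blast
  next
    case False
    then obtain r where r: "1 \<le> r" "2 * r < int p" "int p dvd x - r \<or> int p dvd x + r"
      using half_range[OF p] by blast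
    have "(x, y) \<in> pm (lat p q) (r, d) \<or> (x, y) \<in> pm (lat p q) (r, - d)"
      using r(3) d pm_latI(1)[of p x r q y d] pm_latI(2)[of p x r q y "- d"] by auto
    then show ?thesis using in_col[OF r(1,2)] by blast
  qed
  obtain x y where xy: "v = (x, y)" by fastforce
  show "?C v"
  proof (cases "int q dvd y")
    case True
    then have "\<not> int p dvd x" using v xy by simp
    then obtain r where r: "1 \<le> r" "2 * r < int p" "int p dvd x - 2 * r \<or> int p dvd x + 2 * r"
      using half_range_double[OF p] by blast
    then have "(x, y) \<in> pm (lat p q) (- 2 * r, 0)"
      using True pm_latI(1)[of p x "- 2 * r" q y 0] pm_latI(2)[of p x "- 2 * r" q y 0] by auto
    then show ?thesis using in_col[OF r(1,2)] unfolding xy by blast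
  next
    case False
    then have "y \<notin> cyc q" by (simp add: cyc_def)
    then consider e where "e \<in> supp T" "y \<in> pm (cyc q) e" | "int q dvd y - d" | "int q dvd y + d"
      using zs_coverD(5)[OF T] by (auto simp: pm_def cyc_def)
    then show ?thesis
    proof cases
      case 1
      from lift_cover[OF p this, of x] show ?thesis unfolding xy by auto
    next
      case 2
      then show ?thesis unfolding xy by (rule col)
    next
      case 3
      then have "int q dvd (- y) - d" by (metis diff_conv_add_uminus dvd_minus_iff minus_add_distrib)
      from col[OF this, of "- x"] show ?thesis unfolding xy using uminus_pm_lat[of "(x, y)"] by auto
    qed
  qed
qed (rule E(1))

lemma cover_mod_3:
  assumes "odd p" "q mod 6 = 3"
  shows "\<exists>T e. zs_cover (lat p q) (p * q) T {e}"
proof -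
  obtain T d where "zs_cover (cyc q) q T {d}" using hole_cover[OF assms(2)] by blast
  from column_cover[OF assms(1) this, of "{}" "{(0, d)}"] show ?thesis by auto
qed

text \<open>The leftover of the cyclic cover is chosen as the third of q. Dissolving the single
  column at the third of p then sets free representatives of all four classes of order 3.\<close>

lemma cover_mod_3_3:
  assumes "p mod 6 = 3" "q mod 6 = 3" "q \<noteq> 9"
  defines "a \<equiv> int (p div 3)" and "b \<equiv> int (q div 3)"
  shows "\<exists>T. zs_cover (lat p q) (p * q) T {(0, b), (a, b), (a, - b), (- 2 * a, 0)}"
proof -
  obtain T where T: "zs_cover (cyc q) q T {b}" using third_cover assms by blast
  have "odd p" "1 \<le> a" "a \<le> (int p - 1) div 2" using assms(1) unfolding a_def by presburger+
  moreover have "card {(0, b), (a, b), (a, - b), (- 2 * a, 0)} \<le> 1 + 3 * card {a}"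
    using card_length[of "[(0, b), (a, b), (a, - b), (- 2 * a, 0)]"] by simp
  ultimately have "zs_cover (lat p q) (p * q) (lift p T \<union> column b ({1..(int p - 1) div 2} - {a}))
      {(0, b), (a, b), (a, - b), (- 2 * a, 0)}"
    by (intro column_cover[OF _ T]) auto
  then show ?thesis by blast
qed

section \<open>Both factors congruent to 5 modulo 6\<close>

text \<open>The five triples cover the classes of \<open>(x, y)\<close> with \<open>x \<in> {\<plusminus>a, \<plusminus>b, \<plusminus>c}\<close> and \<open>y \<in> {\<plusminus>d, \<plusminus>2d}\<close>
  together with those of \<open>(2a, 0)\<close>, \<open>(2b, 0)\<close>, \<open>(2c, 0)\<close>, each exactly once.\<close>

fun quint :: "int \<Rightarrow> int \<times> int \<times> int \<Rightarrow> ((int \<times> int) \<times> (int \<times> int) \<times> (int \<times> int)) set" where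
  "quint d (a, b, c) = set
     [((a, 2 * d), (a, - 2 * d), (- 2 * a, 0)), ((b, 2 * d), (b, - 2 * d), (- 2 * b, 0)),
      ((c, d), (c, - d), (- 2 * c, 0)), ((a, d), (b, d), (c, - 2 * d)), ((- a, d), (- b, d), (- c, - 2 * d))]"

lemma quint_card:
  assumes "finite S"
  shows "finite (\<Union>(quint d ` S))" "card (\<Union>(quint d ` S)) \<le> 5 * card S"
proof -
  have q: "finite (quint d t) \<and> card (quint d t) \<le> 5" for t
  proof (cases t)
    case (fields a b c)
    show ?thesis unfolding fields quint.simps by (rule conjI[OF finite_set order_trans[OF card_length]]) simp
  qed
  then show "finite (\<Union>(quint d ` S))" using assms by blast
  have "card (\<Union>(quint d ` S)) \<le> (\<Sum>t\<in>S. card (quint d t))" by (rule card_UN_le[OF assms])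
  also have "\<dots> \<le> (\<Sum>t\<in>S. 5)" using q by (intro sum_mono) blast
  finally show "card (\<Union>(quint d ` S)) \<le> 5 * card S" by simp
qed

text \<open>The lift of T leaves the fibres over 0 and over the signed multiples d and 2 * d. Above
  each triple of a cyclic cover of Z_p these fibres are filled by a \<open>quint\<close>. What
  remains lies above the two leftovers r, s of Z_p and above 0.\<close>

lemma cover_mod_5:
  assumes p: "p mod 6 = 5" and q: "q mod 6 = 5" "q \<noteq> 11"
  shows "\<exists>T E. zs_cover (lat p q) (p * q) T E \<and> card E \<le> 3"
proof -
  obtain T d where T: "zs_cover (cyc q) q T {d, 2 * d}" using double_cover[OF q] by blast
  obtain S r s where S: "zs_cover (cyc p) p S {r, s}" using two_cover[OF p] by blast
  note T' = zs_coverD[OF T] and S' = zs_coverD[OF S]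
  have op: "odd p" using p by presburger
  \<comment> \<open>Twelve classes remain: five each for r and s, and (0, d), (0, 2 * d). Three
    triples take nine of them, and \<open>E\<close> keeps the other three.\<close>
  define X where "X = {((r, d), (- r, d), (0, - 2 * d)), ((s, d), (s, - d), (- 2 * s, 0)),
      ((r, 2 * d), (r, - 2 * d), (- 2 * r, 0))}"
  define U where "U = lift p T \<union> \<Union>(quint d ` S) \<union> X"
  define E where "E = {(0, d), (s, 2 * d), (s, - 2 * d)}"
  let ?C = "\<lambda>v. \<exists>e\<in>supp U \<union> E. v \<in> pm (lat p q) e"
  have cE: "card E \<le> 3" and cX: "card X \<le> 3" by (simp_all add: E_def X_def card_insert_if)
  \<comment> \<open>Closing the covered elements under negation avoids tracking the signs with which
    they occur in the triples.\<close>
  define Z where "Z = {v. v \<in> supp U \<union> E \<or> - v \<in> supp U \<union> E}"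
  have uZ: "- v \<in> Z \<longleftrightarrow> v \<in> Z" for v by (auto simp: Z_def)
  have ZI: "?C v" if "v - z \<in> lat p q" "z \<in> Z" for v z
  proof -
    have "v \<in> pm (lat p q) z" using that(1) by (simp add: pm_def)
    then show ?thesis using that(2) pm_lat_uminus[of v p q z] by (auto simp: Z_def)
  qed
  have sub: "supp (\<Union>(quint d ` S)) \<subseteq> Z" "supp X \<subseteq> Z" "E \<subseteq> Z" by (auto simp: Z_def U_def)
  have Z0: "(0, d) \<in> Z" "(0, 2 * d) \<in> Z"
    using sub(2,3) uZ[of "(0, 2 * d)"] by (auto simp: X_def E_def)
  have Ze: "{(e, d), (- e, d), (e, 2 * d), (- e, 2 * d), (- 2 * e, 0)} \<subseteq> Z"
    if e: "e \<in> supp S \<union> {r, s}" for e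
  proof -
    have neg: "(e, - d) \<in> Z \<Longrightarrow> (- e, d) \<in> Z" "(e, - 2 * d) \<in> Z \<Longrightarrow> (- e, 2 * d) \<in> Z"
      "(- e, - 2 * d) \<in> Z \<Longrightarrow> (e, 2 * d) \<in> Z" for e
      using uZ[of "(- e, d)"] uZ[of "(- e, 2 * d)"] uZ[of "(e, 2 * d)"] by simp_all
    from e consider "e = r" | "e = s" | "e \<in> supp S" by blast
    then show ?thesis
    proof cases
      case 1
      then show ?thesis using sub(2) neg[of r] by (auto simp: X_def)
    next
      case 2
      then show ?thesis using sub(2,3) neg[of s] by (auto simp: X_def E_def)
    next
      case 3
      then obtain a b c where abc: "(a, b, c) \<in> S" "e \<in> {a, b, c}" by (rule suppE)
      then have "supp (quint d (a, b, c)) \<subseteq> supp (\<Union>(quint d ` S))" unfolding supp_def by blast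
      then have "supp (quint d (a, b, c)) \<subseteq> Z" using sub(1) by blast
      then show ?thesis using abc(2) neg[of a] neg[of b] neg[of c] by auto
    qed
  qed
  have "zs_cover (lat p q) (p * q) U E"
  proof (rule zs_coverI)
    show "finite U" using T'(1) S'(1) quint_card(1)[OF S'(1), of d] by (simp add: U_def X_def lift_def)
    show "finite E" by (simp add: E_def)
    \<comment> \<open>The residue 5 modulo 6 restores the constant 5 even if the two listed
      leftovers should coincide, when the cover itself grants only 3.\<close>
    have "6 * card T + 5 \<le> q" "6 * card S + 5 \<le> p"
      using T'(3) S'(3) p q card_insert_le[of "{2 * d}" d] card_insert_le[of "{s}" r] by simp_all presburger+
    moreover from this(1) have "6 * (p * card T) + 5 * p \<le> p * q"
      using mult_le_mono2[of "6 * card T + 5" q p] by (simp add: algebra_simps)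
    moreover have "card U \<le> card (lift p T) + card (\<Union>(quint d ` S)) + card X"
      unfolding U_def by (meson card_Un_le add_le_mono order_trans order_refl)
    ultimately show "6 * card U + 2 * card E + 1 \<le> p * q"
      using lift_card[OF T'(1), of p] quint_card(2)[OF S'(1), of d] cX cE by linarith
  next
    fix a b c assume "(a, b, c) \<in> U"
    moreover have "a + b + c \<in> lat p q" if "(a, b, c) \<in> \<Union>(quint d ` S)"
    proof -
      from that obtain t where t: "t \<in> S" "(a, b, c) \<in> quint d t" by (rule UN_E)
      obtain x y z where "t = (x, y, z)" by (rule prod_cases3)
      with t have S: "(x, y, z) \<in> S" and *: "(a, b, c) \<in> quint d (x, y, z)" by (simp_all only:)
      have "int p dvd x + y + z" using S'(4)[OF S] by (simp add: cyc_def)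
      moreover from this have "int p dvd - x - y - z"
        by (metis diff_conv_add_uminus dvd_minus_iff minus_add_distrib)
      ultimately show ?thesis using * by auto
    qed
    moreover have "a + b + c \<in> lat p q" if "(a, b, c) \<in> X"
      using that by (auto simp: X_def)
    ultimately show "a + b + c \<in> lat p q"
      using lift_zero_sum[OF T'(4)] unfolding U_def by blast
  next
    fix v assume v: "v \<notin> lat p q"
    have dd: "?C (x, y)" if "int q dvd y - k * d" "k = 1 \<or> k = 2" for x y k
    proof (cases "int p dvd x")
      case True
      then show ?thesis using that Z0 by (intro ZI[of _ "(0, k * d)"]) auto
    next
      case False
      then obtain e where e: "e \<in> supp S \<union> {r, s}" "int p dvd x - e \<or> int p dvd x + e"
        using S'(5)[of x] by (auto simp: cyc_def pm_def)
      have Zk: "(e, k * d) \<in> Z" "(- e, k * d) \<in> Z" using that(2) Ze[OF e(1)] by auto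
      from e(2) show ?thesis
      proof
        assume "int p dvd x - e"
        then show ?thesis using that(1) by (intro ZI[OF _ Zk(1)]) auto
      next
        assume "int p dvd x + e"
        then show ?thesis using that(1) by (intro ZI[OF _ Zk(2)]) auto
      qed
    qed
    obtain x y where xy: "v = (x, y)" by fastforce
    show "?C v"
    proof (cases "int q dvd y")
      case True
      then have "\<not> int p dvd x" using v xy by simp
      then obtain k where k: "int p dvd x - 2 * k \<or> int p dvd x + 2 * k" "1 \<le> k" "2 * k < int p"
        using half_range_double[OF op] by blast
      have "\<not> int p dvd k" using zdvd_not_zless[of k "int p"] k(2,3) by simp
      then obtain e where e: "e \<in> supp S \<union> {r, s}" "int p dvd k - e \<or> int p dvd k + e"
        using S'(5)[of k] by (auto simp: cyc_def pm_def)
      have e2: "int p dvd 2 * (k - e) \<or> int p dvd 2 * (k + e)" using e(2) by (metis dvd_mult)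
      have "x - 2 * e = (x - 2 * k) + 2 * (k - e)" "x + 2 * e = (x - 2 * k) + 2 * (k + e)"
        "x - 2 * e = (x + 2 * k) - 2 * (k + e)" "x + 2 * e = (x + 2 * k) - 2 * (k - e)"
        by simp_all
      with k(1) e2 have "int p dvd x - 2 * e \<or> int p dvd x + 2 * e" by (metis dvd_add dvd_diff)
      then show ?thesis unfolding xy
      proof
        assume "int p dvd x - 2 * e"
        moreover have "(2 * e, 0) \<in> Z" using Ze[OF e(1)] uZ[of "(2 * e, 0)"] by simp
        ultimately show "?C (x, y)" using True by (intro ZI[of _ "(2 * e, 0)"]) auto
      next
        assume "int p dvd x + 2 * e"
        moreover have "(- 2 * e, 0) \<in> Z" using Ze[OF e(1)] by simp
        ultimately show "?C (x, y)" using True by (intro ZI[of _ "(- 2 * e, 0)"]) auto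
      qed
    next
      case False
      then have "y \<notin> cyc q" by (simp add: cyc_def)
      then consider e where "e \<in> supp T" "y \<in> pm (cyc q) e"
        | k where "k = 1 \<or> k = 2" "int q dvd y - k * d \<or> int q dvd y + k * d"
        using T'(5)[of y] by (fastforce simp: pm_def cyc_def)
      then show ?thesis
      proof cases
        case 1
        from lift_cover[OF op this, of x] show ?thesis unfolding xy U_def by auto
      next
        case 2
        have "int q dvd - y - k * d" if "int q dvd y + k * d"
          using that by (metis diff_conv_add_uminus dvd_minus_iff minus_add_distrib)
        then have "?C (x, y) \<or> ?C (- x, - y)" using 2 dd[of y k x] dd[of "- y" k "- x"] by blast
        then show ?thesis unfolding xy using uminus_pm_lat[of "(x, y)"] by auto
      qed
    qed
  qed
  then show ?thesis using cE by blast
qed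


section \<open>Choosing a cover and freeing the classes of order 3\<close>

lemma zs_cover_swap:
  assumes "zs_cover (lat p q) h T E"
  shows "zs_cover (lat q p) h (map_prod prod.swap (map_prod prod.swap prod.swap) ` T) (prod.swap ` E)"
    (is "zs_cover _ _ (?f ` T) _")
proof (rule zs_coverI)
  note C = zs_coverD[OF assms]
  show "finite (?f ` T)" "finite (prod.swap ` E)" using C by auto
  show "6 * card (?f ` T) + 2 * card (prod.swap ` E) + 1 \<le> h"
    using C(3) card_image_le[OF C(1), of ?f] card_image_le[OF C(2), of prod.swap] by linarith
  show "a + b + c \<in> lat q p" if "(a, b, c) \<in> ?f ` T" for a b c
  proof -
    from that obtain t where t: "(a, b, c) = ?f t" "t \<in> T" by (rule imageE)
    obtain a' b' c' where "t = (a', b', c')" by (cases t)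
    with t have *: "(a', b', c') \<in> T" "a = prod.swap a'" "b = prod.swap b'" "c = prod.swap c'"
      by simp_all
    show ?thesis using C(4)[OF *(1)] *(2-4) by (auto simp: lat_def)
  qed
  show "\<exists>e\<in>supp (?f ` T) \<union> prod.swap ` E. v \<in> pm (lat q p) e" if "v \<notin> lat q p" for v
  proof -
    have "prod.swap v \<notin> lat p q" using that by (auto simp: lat_def)
    then obtain e where e: "e \<in> supp T \<union> E" "prod.swap v \<in> pm (lat p q) e" using C(5) by blast
    have "prod.swap e \<in> supp (?f ` T)" if "e \<in> supp T"
    proof -
      from that obtain a b c where abc: "(a, b, c) \<in> T" "e \<in> {a, b, c}" by (rule suppE)
      have "?f (a, b, c) \<in> ?f ` T" using abc(1) by (rule imageI)
      then have "{prod.swap a, prod.swap b, prod.swap c} \<subseteq> supp (?f ` T)"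
        unfolding map_prod_simp by (rule supp_triple)
      then show ?thesis using abc(2) by auto
    qed
    then have "prod.swap e \<in> supp (?f ` T) \<union> prod.swap ` E" using e(1) by auto
    moreover have "v \<in> pm (lat q p) (prod.swap e)" using e(2) by (auto simp: pm_def lat_def)
    ultimately show ?thesis by blast
  qed
qed

text \<open>Exchanging the factors moves a favourable residue to the second factor and the
  exceptional modulus 11 away from it, unless both factors are 11. The single leftover for multiples
  of 3 prepares \<open>zs_cover_exchange\<close>, which adds up to three.\<close>

lemma cover_exists:
  assumes "odd p" "odd q"
  shows "\<exists>T E. zs_cover (lat p q) (p * q) T E \<and> card E \<le> 3 \<and> (3 dvd p \<or> 3 dvd q \<longrightarrow> card E = 1)"
proof -
  have swap: "\<exists>T E. zs_cover (lat p q) (p * q) T E \<and> card E \<le> n"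
    if "\<exists>T E. zs_cover (lat q p) (q * p) T E \<and> card E \<le> n" for p q n :: nat
  proof -
    from that obtain T E where C: "zs_cover (lat q p) (q * p) T E" "card E \<le> n" by blast
    have "card (prod.swap ` E) \<le> n"
      using card_image_le[OF zs_coverD(2)[OF C(1)], of prod.swap] C(2) by linarith
    with zs_cover_swap[OF C(1)] show ?thesis unfolding mult.commute[of q p] by blast
  qed
  have cases: "p mod 6 = 1 \<or> p mod 6 = 3 \<or> p mod 6 = 5" "q mod 6 = 1 \<or> q mod 6 = 3 \<or> q mod 6 = 5"
    using assms by presburger+
  show ?thesis
  proof (cases "3 dvd p \<or> 3 dvd q")
    case True
    then have "p mod 6 = 3 \<or> q mod 6 = 3" using cases by presburger
    moreover have "\<exists>T e. zs_cover (lat p q) (p * q) T {e}" if p: "p mod 6 = 3"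
    proof -
      obtain T e where "zs_cover (lat q p) (q * p) T {e}" using cover_mod_3[OF assms(2) p] by blast
      from zs_cover_swap[OF this] have "zs_cover (lat p q) (p * q)
        (map_prod prod.swap (map_prod prod.swap prod.swap) ` T) {prod.swap e}" by (simp add: mult.commute)
      then show ?thesis by blast
    qed
    ultimately obtain T e where "zs_cover (lat p q) (p * q) T {e}" using cover_mod_3[OF assms(1)] by blast
    then show ?thesis by (intro exI[of _ T] exI[of _ "{e}"]) simp
  next
    case False
    then have m: "p mod 6 = 1 \<or> p mod 6 = 5" "q mod 6 = 1 \<or> q mod 6 = 5" using cases by presburger+
    then consider "q mod 6 = 1" | "p mod 6 = 1" | "p mod 6 = 5" "q mod 6 = 5" "q \<noteq> 11"
      | "p mod 6 = 5" "q mod 6 = 5" "p \<noteq> 11" | "p = 11" "q = 11" by blast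
    then have "\<exists>T E. zs_cover (lat p q) (p * q) T E \<and> card E \<le> 3"
    proof cases
      case 1
      then obtain T E where TE: "zs_cover (lat p q) (p * q) T E" "card E \<le> 2"
        using cover_mod_1[OF assms(1)] by blast
      then have "card E \<le> 3" by simp
      then show ?thesis using TE by blast
    next
      case 2
      then obtain T E where TE: "zs_cover (lat p q) (p * q) T E" "card E \<le> 2"
        using swap[OF cover_mod_1[OF assms(2)]] by blast
      then have "card E \<le> 3" by simp
      then show ?thesis using TE by blast
    next
      case 3
      then show ?thesis by (rule cover_mod_5)
    next
      case 4
      then show ?thesis using swap[OF cover_mod_5] by blast
    next
      case 5
      obtain T where T: "zs_cover (lat 11 11) (11 * 11) T {}" using cover_11_11 by blast
      show ?thesis unfolding 5 by (intro exI[of _ T] exI[of _ "{}"] conjI T) simp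
    qed
    then show ?thesis using False by blast
  qed
qed

lemma pm_lat_trans: "u \<in> pm (lat p q) e \<Longrightarrow> v \<in> pm (lat p q) e \<Longrightarrow> v \<in> pm (lat p q) u"
proof -
  assume u: "u \<in> pm (lat p q) e" and v: "v \<in> pm (lat p q) e"
  have add: "x + y \<in> lat p q" "x - y \<in> lat p q" if "x \<in> lat p q" "y \<in> lat p q" for x y :: "int \<times> int"
    using that by (auto simp: lat_def)
  show ?thesis
    using u v add[of "v - e" "u - e"] add[of "v - e" "u + e"] add[of "v + e" "u - e"] add[of "v + e" "u + e"]
    by (auto simp: pm_def algebra_simps)
qed

text \<open>Makes a prescribed class a leftover. The triple that covers it is given up, so its other
  two entries and the old leftover r are left over as well: three besides u.\<close>

lemma zs_cover_exchange:
  assumes T: "zs_cover (lat p q) h T {r}" and u: "u \<notin> lat p q"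
  shows "\<exists>T E. zs_cover (lat p q) h T E \<and> u \<in> E \<and> card (E - {u}) \<le> 3"
proof -
  note C = zs_coverD[OF T]
  obtain e where e: "e \<in> supp T \<union> {r}" "u \<in> pm (lat p q) e" using C(5)[OF u] by blast
  note eu = pm_lat_trans[OF e(2)]
  show ?thesis
  proof (cases "e = r")
    case True
    have "zs_cover (lat p q) h T {u}"
    proof (rule zs_coverI)
      show "6 * card T + 2 * card {u} + 1 \<le> h" using C(3) by simp
      show "\<exists>f\<in>supp T \<union> {u}. v \<in> pm (lat p q) f" if "v \<notin> lat p q" for v
        using C(5)[OF that] eu[of v] True by blast
    qed (use C(1,4) in simp_all)
    then show ?thesis by (intro exI[of _ T] exI[of _ "{u}"]) simp
  next
    case False
    then obtain a b c where t: "(a, b, c) \<in> T" "e \<in> {a, b, c}" using e(1) by (auto elim: suppE)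
    define E where "E = insert u ({r, a, b, c} - {e})"
    have "card ({a, b, c} - {e}) + 1 \<le> 3"
      using card_Suc_Diff1[OF _ t(2)] card_length[of "[a, b, c]"] by simp
    then have "card (insert r ({a, b, c} - {e})) \<le> 3"
      using card_insert_le_m1[of 3 "{a, b, c} - {e}" r] by simp
    moreover have "E - {u} \<subseteq> insert r ({a, b, c} - {e})" by (auto simp: E_def)
    ultimately have E3: "card (E - {u}) \<le> 3"
      using card_mono[of "insert r ({a, b, c} - {e})" "E - {u}"] by simp
    have "card E \<le> 4" using card_Suc_Diff1[of E u] E3 by (simp add: E_def)
    moreover have "card (T - {(a, b, c)}) + 1 = card T" using card_Suc_Diff1[OF C(1) t(1)] by simp
    ultimately have "6 * card (T - {(a, b, c)}) + 2 * card E + 1 \<le> h" using C(3) by simp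
    then have "zs_cover (lat p q) h (T - {(a, b, c)}) E"
    proof (rule zs_coverI[rotated 2])
      fix v assume "v \<notin> lat p q"
      then obtain f where f: "f \<in> supp T \<union> {r}" "v \<in> pm (lat p q) f" using C(5) by blast
      have "supp T \<subseteq> supp (T - {(a, b, c)}) \<union> {a, b, c}" by (auto simp: supp_def)
      then have "f \<in> supp (T - {(a, b, c)}) \<union> {r, a, b, c}" using f(1) by blast
      then show "\<exists>f\<in>supp (T - {(a, b, c)}) \<union> E. v \<in> pm (lat p q) f"
        using f(2) eu by (cases "f = e") (auto simp: E_def)
    qed (use C in \<open>auto simp: E_def\<close>)
    then show ?thesis using E3 by (intro exI[of _ "T - {(a, b, c)}"] exI[of _ E]) (simp add: E_def)
  qed
qed

lemma dvd_triple:
  fixes x :: int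
  assumes "\<not> 3 dvd p" "int p dvd x + x + x" shows "int p dvd x"
proof -
  define k where "k = int (p div 3)"
  have "int p = 3 * k + 1 \<or> int p = 3 * k + 2" using assms(1) unfolding k_def by presburger
  \<comment> \<open>For p = 3 * k + 1 the difference p * x - k * (3 * x) is x itself; for p = 3 * k
    + 2 it is 2 * x, which is then subtracted from 3 * x.\<close>
  then have "x = int p * x - k * (x + x + x) \<or> x = (x + x + x) - (int p * x - k * (x + x + x))"
    by (auto simp: algebra_simps)
  then show ?thesis using assms(2) by (metis dvd_diff dvd_mult dvd_triv_left)
qed

lemma dvd_third:
  fixes x :: int
  assumes "3 dvd p" "int p dvd x + x + x"
  shows "int p dvd x \<or> int p dvd x - int (p div 3) \<or> int p dvd x + int (p div 3)"
proof (cases "p = 0")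
  case False
  define a where "a = int (p div 3)"
  have p: "int p = 3 * a" using assms(1) by (auto simp: a_def)
  have "3 * a dvd 3 * x" using assms(2) p by simp
  then obtain k where x: "x = a * k" by auto
  have "\<exists>l. k = 3 * l \<or> k - 1 = 3 * l \<or> k + 1 = 3 * l" by presburger
  then obtain l where "k = 3 * l \<or> k - 1 = 3 * l \<or> k + 1 = 3 * l" by blast
  moreover have "x - a = a * (k - 1)" "x + a = a * (k + 1)" by (simp_all add: x algebra_simps)
  ultimately show ?thesis unfolding a_def[symmetric] p by (auto simp: x)
qed (use assms in auto)

definition order3 :: "nat \<Rightarrow> nat \<Rightarrow> (int \<times> int) set" where
  "order3 p q = {v. v + v + v \<in> lat p q \<and> v \<notin> lat p q}"

lemma order3_pair:
  "(x, y) \<in> order3 p q \<longleftrightarrow>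
    int p dvd x + x + x \<and> int q dvd y + y + y \<and> \<not> (int p dvd x \<and> int q dvd y)"
  by (simp add: order3_def)

text \<open>There are 0, 1 or 4 classes of order 3. A single one is set free by an exchange; four
  are exactly the leftovers of \<open>cover_mod_3_3\<close> or of the explicit cover for 9 x 9.
  \<open>O'\<close> collects them, and at most three leftovers are left to be matched with
  involutions.\<close>

lemma cover_order3:
  assumes pq: "odd p" "odd q"
  shows "\<exists>T E O'. zs_cover (lat p q) (p * q) T E \<and> O' \<subseteq> E \<and> card (E - O') \<le> 3 \<and>
    O' \<subseteq> order3 p q \<and> order3 p q \<subseteq> (\<Union>e\<in>O'. pm (lat p q) e)"
proof -
  have p0: "p > 0" "q > 0" using pq by (auto intro: Nat.gr0I)
  have third: "\<not> int p dvd int (p div 3)" "\<not> int p dvd 2 * int (p div 3)"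
     "int p = 3 * int (p div 3)" if "3 dvd p" "p > 0" for p
  proof -
    show p: "int p = 3 * int (p div 3)" using that by auto
    have "0 < int (p div 3)" "int (p div 3) < int p" "2 * int (p div 3) < int p"
      using p that(2) by linarith+
    then show "\<not> int p dvd int (p div 3)" "\<not> int p dvd 2 * int (p div 3)"
      by (intro zdvd_not_zless; linarith)+
  qed
  define a b where "a = int (p div 3)" and "b = int (q div 3)"
  have single: ?thesis if u: "3 dvd p \<or> 3 dvd q" "u \<in> order3 p q" "order3 p q \<subseteq> pm (lat p q) u" for u
  proof -
    obtain T E where TE: "zs_cover (lat p q) (p * q) T E" "card E = 1"
      using cover_exists[OF pq] u(1) by blast
    obtain e where "E = {e}" using TE(2) by (rule card_1_singletonE)
    with TE have T: "zs_cover (lat p q) (p * q) T {e}" by simp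
    obtain T' E where "zs_cover (lat p q) (p * q) T' E" "u \<in> E" "card (E - {u}) \<le> 3"
      using zs_cover_exchange[OF T] u(2) unfolding order3_def by blast
    then show ?thesis using u by (intro exI[of _ T'] exI[of _ E] exI[of _ "{u}"]) simp
  qed
  consider "\<not> 3 dvd p" "\<not> 3 dvd q" | "3 dvd p" "\<not> 3 dvd q" | "\<not> 3 dvd p" "3 dvd q" | "3 dvd p" "3 dvd q"
    by blast
  then show ?thesis
  proof cases
    case 1
    have "v \<notin> order3 p q" for v
      using dvd_triple[OF 1(1), of "fst v"] dvd_triple[OF 1(2), of "snd v"] order3_pair[of "fst v" "snd v"]
      by auto
    then have "order3 p q = {}" by blast
    moreover obtain T E where "zs_cover (lat p q) (p * q) T E" "card E \<le> 3" using cover_exists[OF pq] by blast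
    ultimately show ?thesis by (intro exI[of _ T] exI[of _ E] exI[of _ "{}"]) simp
  next
    case 2
    show ?thesis
    proof (rule single[of "(a, 0)"])
      show "(a, 0) \<in> order3 p q" using third[OF 2(1) p0(1)] by (simp add: order3_def a_def)
      have "v \<in> pm (lat p q) (a, 0)" if "v \<in> order3 p q" for v
        using that dvd_third[OF 2(1), of "fst v"] dvd_triple[OF 2(2), of "snd v"] order3_pair[of "fst v" "snd v"]
        by (cases v) (auto simp: pm_def a_def)
      then show "order3 p q \<subseteq> pm (lat p q) (a, 0)" by blast
    qed (use 2 in blast)
  next
    case 3
    show ?thesis
    proof (rule single[of "(0, b)"])
      show "(0, b) \<in> order3 p q" using third[OF 3(2) p0(2)] by (simp add: order3_def b_def)
      have "v \<in> pm (lat p q) (0, b)" if "v \<in> order3 p q" for v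
        using that dvd_third[OF 3(2), of "snd v"] dvd_triple[OF 3(1), of "fst v"] order3_pair[of "fst v" "snd v"]
        by (cases v) (auto simp: pm_def b_def)
      then show "order3 p q \<subseteq> pm (lat p q) (0, b)" by blast
    qed (use 3 in blast)
  next
    case 4
    \<comment> \<open>Two systems of representatives of the same four classes: \<open>O2\<close>
      comes from the construction with the factors exchanged, which serves if q = 9.\<close>
    define O1 where "O1 = {(0, b), (a, b), (a, - b), (- 2 * a, 0 :: int)}"
    define O2 where "O2 = {(a, 0), (a, b), (- a, b), (0 :: int, - 2 * b)}"
    have m: "p mod 6 = 3" "q mod 6 = 3" using pq 4 by presburger+
    note tp = third[OF 4(1) p0(1), folded a_def] and tq = third[OF 4(2) p0(2), folded b_def]
    have sub: "O1 \<subseteq> order3 p q" "O2 \<subseteq> order3 p q" using tp tq by (auto simp: O1_def O2_def order3_def)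
    have a2: "int p dvd x + 2 * a \<longleftrightarrow> int p dvd x - a" "int p dvd x - 2 * a \<longleftrightarrow> int p dvd x + a" for x
      using tp(3) dvd_add_right_iff[of "int p" "3 * a" "x - a"] dvd_add_right_iff[of "int p" "3 * a" "x - 2 * a"]
      by (simp_all add: algebra_simps)
    have b2: "int q dvd x + 2 * b \<longleftrightarrow> int q dvd x - b" "int q dvd x - 2 * b \<longleftrightarrow> int q dvd x + b" for x
      using tq(3) dvd_add_right_iff[of "int q" "3 * b" "x - b"] dvd_add_right_iff[of "int q" "3 * b" "x - 2 * b"]
      by (simp_all add: algebra_simps)
    have cov: "\<exists>e\<in>O1. v \<in> pm (lat p q) e" "\<exists>e\<in>O2. v \<in> pm (lat p q) e" if "v \<in> order3 p q" for v
    proof -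
      obtain x y where v: "v = (x, y)" by fastforce
      have "int p dvd x \<or> int p dvd x - a \<or> int p dvd x + a" "int q dvd y \<or> int q dvd y - b \<or> int q dvd y + b"
        "\<not> (int p dvd x \<and> int q dvd y)"
        using that dvd_third[OF 4(1), of x] dvd_third[OF 4(2), of y] order3_pair[of x y p q]
        unfolding v a_def b_def by blast+
      then show "\<exists>e\<in>O1. v \<in> pm (lat p q) e" "\<exists>e\<in>O2. v \<in> pm (lat p q) e"
        by (auto simp: v O1_def O2_def pm_def a2 b2)
    qed
    have "\<exists>T. zs_cover (lat p q) (p * q) T O1 \<or> zs_cover (lat p q) (p * q) T O2"
    proof -
      consider "q \<noteq> 9" | "p \<noteq> 9" | "p = 9" "q = 9" by blast
      then show ?thesis
      proof cases
        case 1
        then show ?thesis using cover_mod_3_3[OF m] unfolding O1_def a_def b_def by blast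
      next
        case 2
        then obtain T where "zs_cover (lat q p) (q * p) T {(0, a), (b, a), (b, - a), (- 2 * b, 0)}"
          using cover_mod_3_3[OF m(2,1)] unfolding a_def b_def by blast
        from zs_cover_swap[OF this] show ?thesis unfolding O2_def by (auto simp: mult.commute)
      next
        case 3
        then show ?thesis using cover_9_9 unfolding O1_def a_def b_def by auto
      qed
    qed
    then show ?thesis
    proof (elim exE disjE)
      fix T assume "zs_cover (lat p q) (p * q) T O1"
      then show ?thesis using sub cov by (intro exI[of _ T] exI[of _ O1]) auto
    next
      fix T assume "zs_cover (lat p q) (p * q) T O2"
      then show ?thesis using sub cov by (intro exI[of _ T] exI[of _ O2]) auto
    qed
  qed
qed

section \<open>Codes and difference sets\<close>

definition red :: "nat \<Rightarrow> nat \<Rightarrow> int \<times> int \<Rightarrow> int \<times> int" where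
  "red m n v = (fst v mod int m, snd v mod int n)"

text \<open>Saturated under the lattice rather than restricted to the carrier, so that difference
  sets can be compared directly with the sets \<open>pm\<close>.\<close>

definition diffs :: "nat \<Rightarrow> nat \<Rightarrow> (int \<times> int) set \<Rightarrow> (int \<times> int) set" where
  "diffs m n X = {v. v \<notin> lat m n \<and> (\<exists>x\<in>X. \<exists>y\<in>X. v - (x - y) \<in> lat m n)}"

lemma diffsI:
  "x \<in> X \<Longrightarrow> y \<in> X \<Longrightarrow> v \<notin> lat m n \<Longrightarrow> v - (x - y) \<in> lat m n \<Longrightarrow> v \<in> diffs m n X"
  unfolding diffs_def by blast

lemma lat_zero [simp]: "0 \<in> lat m n"
  by (simp add: lat_def)

lemma lat_add: "u \<in> lat m n \<Longrightarrow> v \<in> lat m n \<Longrightarrow> u + v \<in> lat m n"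
  and lat_diff: "u \<in> lat m n \<Longrightarrow> v \<in> lat m n \<Longrightarrow> u - v \<in> lat m n"
  and lat_uminus: "- u \<in> lat m n \<longleftrightarrow> u \<in> lat m n"
  by (auto simp: lat_def)

lemma lat_cong: "u - v \<in> lat m n \<Longrightarrow> u \<in> lat m n \<longleftrightarrow> v \<in> lat m n"
  using lat_add[of "u - v" m n v] lat_diff[of u m n "u - v"] by auto

lemma lat_minus_commute: "u - v \<in> lat m n \<longleftrightarrow> v - u \<in> lat m n"
  using lat_uminus[of "u - v" m n] by simp

section \<open>Translates in integer coordinates\<close>

context
  fixes m n :: nat
  assumes pos: "m > 0" "n > 0"
begin

lemma carrier_Zmn: "carrier (Zmn m n) = {0..<int m} \<times> {0..<int n}"
  and mult_Zmn: "u \<otimes>\<^bsub>Zmn m n\<^esub> v = red m n (u + v)"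
  and one_Zmn: "\<one>\<^bsub>Zmn m n\<^esub> = 0"
  using pos by (auto simp: integer_mod_group_def DirProd_def red_def case_prod_unfold zero_prod_def)

lemma red_carrier: "red m n v \<in> carrier (Zmn m n)"
  unfolding carrier_Zmn red_def using pos by simp

lemma red_cong: "red m n v - v \<in> lat m n"
  by (simp add: red_def lat_def mod_eq_dvd_iff[symmetric])

lemma red_eq_iff: "red m n u = red m n v \<longleftrightarrow> u - v \<in> lat m n"
  by (auto simp: red_def lat_def mod_eq_dvd_iff)

lemma red_id: "v \<in> carrier (Zmn m n) \<Longrightarrow> red m n v = v"
  unfolding carrier_Zmn red_def by auto

lemma carrier_eq_iff:
  "u \<in> carrier (Zmn m n) \<Longrightarrow> v \<in> carrier (Zmn m n) \<Longrightarrow> u = v \<longleftrightarrow> u - v \<in> lat m n"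
  using red_eq_iff[of u v] by (simp add: red_id)

lemma coset_Zmn: "X #>\<^bsub>Zmn m n\<^esub> g = (\<lambda>x. red m n (x + g)) ` X"
  by (auto simp: r_coset_def mult_Zmn)

lemma finite_carrier_Zmn: "finite (carrier (Zmn m n))"
  unfolding carrier_Zmn by simp

lemma in_coset_iff:
  assumes "x \<in> carrier (Zmn m n)"
  shows "x \<in> Y #>\<^bsub>Zmn m n\<^esub> g \<longleftrightarrow> (\<exists>y\<in>Y. x - (y + g) \<in> lat m n)"
  using assms red_eq_iff[of x] unfolding coset_Zmn image_iff by (simp add: red_id)

text \<open>Two points of X in a translate of Y have the same difference as their preimages in Y.
  Conversely, a common difference x - x' = y - y' yields the translation by x - y, which takes y to
  x and y' to x'.\<close>

lemma cross_iff:
  assumes X: "X \<subseteq> carrier (Zmn m n)" and Y: "Y \<subseteq> carrier (Zmn m n)"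
  shows "(\<forall>g\<in>carrier (Zmn m n). card (X \<inter> (Y #>\<^bsub>Zmn m n\<^esub> g)) \<le> 1) \<longleftrightarrow> diffs m n X \<inter> diffs m n Y = {}"
proof
  assume L: "\<forall>g\<in>carrier (Zmn m n). card (X \<inter> (Y #>\<^bsub>Zmn m n\<^esub> g)) \<le> 1"
  show "diffs m n X \<inter> diffs m n Y = {}"
  proof (rule ccontr)
    assume "\<not> ?thesis"
    then obtain v x x' y y' where v: "v \<notin> lat m n" and x: "x \<in> X" "x' \<in> X" "v - (x - x') \<in> lat m n"
      and y: "y \<in> Y" "y' \<in> Y" "v - (y - y') \<in> lat m n" unfolding diffs_def by blast
    define g where "g = red m n (x - y)"
    have g: "g - (x - y) \<in> lat m n" unfolding g_def by (rule red_cong)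
    have "x - (y + g) \<in> lat m n" using lat_uminus[of "g - (x - y)" m n] g by (simp add: algebra_simps)
    moreover have "x' - (y' + g) \<in> lat m n"
      using lat_diff[OF lat_diff[OF x(3) y(3)] g] by (simp add: algebra_simps)
    ultimately have "{x, x'} \<subseteq> X \<inter> (Y #>\<^bsub>Zmn m n\<^esub> g)"
      using x y in_coset_iff[of x Y g] in_coset_iff[of x' Y g] X by blast
    moreover have "x \<noteq> x'" using x(3) v by auto
    moreover have "finite (X \<inter> (Y #>\<^bsub>Zmn m n\<^esub> g))"
      using X finite_carrier_Zmn finite_subset by blast
    ultimately have "2 \<le> card (X \<inter> (Y #>\<^bsub>Zmn m n\<^esub> g))"
      using card_mono[of "X \<inter> (Y #>\<^bsub>Zmn m n\<^esub> g)" "{x, x'}"] by simp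
    moreover have "card (X \<inter> (Y #>\<^bsub>Zmn m n\<^esub> g)) \<le> 1"
      unfolding g_def by (rule bspec[OF L red_carrier])
    ultimately show False by simp
  qed
next
  assume D: "diffs m n X \<inter> diffs m n Y = {}"
  show "\<forall>g\<in>carrier (Zmn m n). card (X \<inter> (Y #>\<^bsub>Zmn m n\<^esub> g)) \<le> 1"
  proof (rule ballI, rule ccontr)
    fix g assume "\<not> card (X \<inter> (Y #>\<^bsub>Zmn m n\<^esub> g)) \<le> 1"
    then obtain x x' where x: "x \<in> X \<inter> (Y #>\<^bsub>Zmn m n\<^esub> g)" "x' \<in> X \<inter> (Y #>\<^bsub>Zmn m n\<^esub> g)" "x \<noteq> x'"
      by (metis card_le_Suc0_iff_eq One_nat_def card.infinite zero_le_one)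
    have xC: "x \<in> carrier (Zmn m n)" "x' \<in> carrier (Zmn m n)" using x X by auto
    obtain y y' where y: "y \<in> Y" "y' \<in> Y" "x - (y + g) \<in> lat m n" "x' - (y' + g) \<in> lat m n"
      using x in_coset_iff[OF xC(1), of Y g] in_coset_iff[OF xC(2), of Y g] by blast
    have "x - x' \<notin> lat m n" using x(3) carrier_eq_iff[OF xC] by blast
    moreover have "x - x' - (y - y') \<in> lat m n"
      using lat_diff[OF y(3,4)] by (simp add: algebra_simps)
    ultimately have "x - x' \<in> diffs m n X \<inter> diffs m n Y"
      using x y diffsI[of x X x' "x - x'"] diffsI[of y Y y' "x - x'"] by simp
    then show False using D by blast
  qed
qed

lemma is_OOSPC_iff:
  "is_OOSPC m n 3 la 1 F \<longleftrightarrow>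
     (\<forall>X\<in>F. X \<subseteq> carrier (Zmn m n) \<and> card X = 3) \<and>
     (\<forall>X\<in>F. \<forall>g\<in>carrier (Zmn m n) - {0}. card (X \<inter> (X #>\<^bsub>Zmn m n\<^esub> g)) \<le> la) \<and>
     (\<forall>X\<in>F. \<forall>Y\<in>F. X \<noteq> Y \<longrightarrow> diffs m n X \<inter> diffs m n Y = {})"
  proof (cases "\<forall>X\<in>F. X \<subseteq> carrier (Zmn m n)")
  case True
  then have fin: "\<forall>X\<in>F. finite X" using finite_subset finite_carrier_Zmn by blast
  then have f: "(\<forall>X\<in>F. X \<subseteq> carrier (Zmn m n) \<and> finite X \<and> card X = 3) \<longleftrightarrow>
    (\<forall>X\<in>F. X \<subseteq> carrier (Zmn m n) \<and> card X = 3)" by blast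
  have e: "(\<forall>X\<in>F. \<forall>Y\<in>F. X \<noteq> Y \<longrightarrow> (\<forall>g\<in>carrier (Zmn m n). card (X \<inter> (Y #>\<^bsub>Zmn m n\<^esub> g)) \<le> 1)) \<longleftrightarrow>
    (\<forall>X\<in>F. \<forall>Y\<in>F. X \<noteq> Y \<longrightarrow> diffs m n X \<inter> diffs m n Y = {})"
    using True by (intro ball_cong refl imp_cong cross_iff) auto
  show ?thesis unfolding is_OOSPC_def one_Zmn e f ..
next
  case False
  then have "\<not> (\<forall>X\<in>F. X \<subseteq> carrier (Zmn m n) \<and> finite X \<and> card X = 3)"
    "\<not> (\<forall>X\<in>F. X \<subseteq> carrier (Zmn m n) \<and> card X = 3)" by blast+
  then show ?thesis unfolding is_OOSPC_def by (simp only: simp_thms)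
qed

lemma OOSPC_D:
  assumes "is_OOSPC m n 3 la 1 F" "X \<in> F"
  shows "X \<subseteq> carrier (Zmn m n)" "card X = 3"
    and "g \<in> carrier (Zmn m n) - {0} \<Longrightarrow> card (X \<inter> (X #>\<^bsub>Zmn m n\<^esub> g)) \<le> la"
    and "Y \<in> F \<Longrightarrow> X \<noteq> Y \<Longrightarrow> diffs m n X \<inter> diffs m n Y = {}"
  using assms unfolding is_OOSPC_iff by metis+

lemma OOSPC_I:
  assumes "\<And>X. X \<in> F \<Longrightarrow> X \<subseteq> carrier (Zmn m n)" "\<And>X. X \<in> F \<Longrightarrow> card X = 3"
    and "\<And>X g. X \<in> F \<Longrightarrow> g \<in> carrier (Zmn m n) - {0} \<Longrightarrow> card (X \<inter> (X #>\<^bsub>Zmn m n\<^esub> g)) \<le> la"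
    and "\<And>X Y. X \<in> F \<Longrightarrow> Y \<in> F \<Longrightarrow> X \<noteq> Y \<Longrightarrow> diffs m n X \<inter> diffs m n Y = {}"
  shows "is_OOSPC m n 3 la 1 F"
  unfolding is_OOSPC_iff by (intro conjI ballI impI assms)

lemma finite_OOSPC:
  assumes "is_OOSPC m n k la lc F" shows "F \<subseteq> Pow (carrier (Zmn m n))" "finite F"
proof -
  show F: "F \<subseteq> Pow (carrier (Zmn m n))" using assms unfolding is_OOSPC_def by blast
  show "finite F" by (rule finite_subset[OF F]) (simp only: finite_Pow_iff finite_carrier_Zmn)
qed

lemma finite_OOSPC_sizes: "finite {card F |F. is_OOSPC m n k la lc F}"
proof (rule finite_subset)
  show "{card F |F. is_OOSPC m n k la lc F} \<subseteq> card ` Pow (Pow (carrier (Zmn m n)))"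
    using finite_OOSPC(1) by blast
qed (simp only: finite_Pow_iff finite_carrier_Zmn finite_imageI)

lemma Theta_ge: "is_OOSPC m n k la lc F \<Longrightarrow> card F \<le> Theta m n k la lc"
  unfolding Theta_def using finite_OOSPC_sizes by (intro Max_ge) auto

lemma Theta_attained: obtains F where "is_OOSPC m n k la lc F" "card F = Theta m n k la lc"
proof -
  have "is_OOSPC m n k la lc {}" by (simp add: is_OOSPC_def)
  then have "Theta m n k la lc \<in> {card F |F. is_OOSPC m n k la lc F}"
    unfolding Theta_def using finite_OOSPC_sizes by (intro Max_in) auto
  then show thesis using that by auto
qed

section \<open>Codes with differences in a prescribed set\<close>

definition packs :: "nat \<Rightarrow> (int \<times> int) set \<Rightarrow> nat \<Rightarrow> bool" where
  "packs la A k \<longleftrightarrow> (\<exists>F. is_OOSPC m n 3 la 1 F \<and> card F = k \<and> (\<forall>X\<in>F. diffs m n X \<subseteq> A))"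

lemma packs_Theta: "packs la A k \<Longrightarrow> k \<le> Theta m n 3 la 1"
  using Theta_ge unfolding packs_def by blast

lemma packs_empty: "packs la A 0"
  unfolding packs_def by (rule exI[of _ "{}"]) (simp add: is_OOSPC_def)

lemma packs_mono: "packs la A k \<Longrightarrow> A \<subseteq> B \<Longrightarrow> packs la B k"
  unfolding packs_def by blast

text \<open>Guarantees that codes living in disjoint regions share no codeword, so that their sizes
  add up in \<open>packs_Un\<close>.\<close>

lemma diffs_nonempty:
  assumes "X \<subseteq> carrier (Zmn m n)" "card X = 3"
  shows "diffs m n X \<noteq> {}"
proof -
  obtain x y where xy: "x \<in> X" "y \<in> X" "x \<noteq> y"
    using assms(2) by (metis card_3_iff insertI1 insertI2)
  then have "x - y \<notin> lat m n" using assms(1) carrier_eq_iff[of x y] by blast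
  then have "x - y \<in> diffs m n X" using xy diffsI[of x X y "x - y"] by simp
  then show ?thesis by blast
qed

lemma packs_Un:
  assumes "packs la A k" "packs la B l" "A \<inter> B = {}"
  shows "packs la (A \<union> B) (k + l)"
proof -
  obtain F G where F: "is_OOSPC m n 3 la 1 F" "card F = k" "\<forall>X\<in>F. diffs m n X \<subseteq> A"
    and G: "is_OOSPC m n 3 la 1 G" "card G = l" "\<forall>X\<in>G. diffs m n X \<subseteq> B"
    using assms unfolding packs_def by blast
  have "F \<inter> G = {}"
  proof (rule ccontr)
    assume "F \<inter> G \<noteq> {}"
    then obtain X where X: "X \<in> F" "X \<in> G" by blast
    then have "diffs m n X \<noteq> {}" using OOSPC_D(1,2)[OF F(1)] diffs_nonempty by metis
    then show False using F(3) G(3) X assms(3) by blast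
  qed
  then have "card (F \<union> G) = k + l"
    using F(2) G(2) card_Un_disjoint finite_OOSPC(2)[OF F(1)] finite_OOSPC(2)[OF G(1)] by blast
  moreover have "diffs m n X \<inter> diffs m n Y = {}" if "X \<in> F \<union> G" "Y \<in> F \<union> G" "X \<noteq> Y" for X Y
    using that OOSPC_D(4)[OF F(1), of X Y] OOSPC_D(4)[OF G(1), of X Y] F(3) G(3) assms(3) by blast
  then have "is_OOSPC m n 3 la 1 (F \<union> G)"
    by (intro OOSPC_I) (metis Un_iff OOSPC_D(1-3)[OF F(1)] OOSPC_D(1-3)[OF G(1)])+
  ultimately show ?thesis using F(3) G(3) unfolding packs_def by blast
qed

text \<open>The codeword is {0, a, b}. It meets a nontrivial translate in three points only if it is
  invariant under that translation; it is then a subgroup of order 3, so 3 * a = 0.\<close>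

lemma packs_single:
  assumes la: "la = 3 \<or> la = 2 \<and> a + a + a \<notin> lat m n"
    and ab: "a \<notin> lat m n" "b \<notin> lat m n" "a - b \<notin> lat m n"
  shows "packs la (pm (lat m n) a \<union> pm (lat m n) b \<union> pm (lat m n) (a - b)) 1"
proof -
  define X where "X = red m n ` {0, a, b}"
  have X3: "card X = 3"
    using ab lat_uminus[of a m n] lat_uminus[of b m n] by (simp add: X_def red_eq_iff)
  have XC: "X \<subseteq> carrier (Zmn m n)" using red_carrier by (auto simp: X_def)
  have X: "x \<in> X \<longleftrightarrow> x \<in> lat m n \<or> x - a \<in> lat m n \<or> x - b \<in> lat m n" if "x \<in> carrier (Zmn m n)" for x
  proof -
    have "x \<in> X \<longleftrightarrow> red m n x = red m n 0 \<or> red m n x = red m n a \<or> red m n x = red m n b"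
      using red_id[OF that] by (auto simp: X_def)
    then show ?thesis by (simp add: red_eq_iff)
  qed
  have self: "card (X \<inter> (X #>\<^bsub>Zmn m n\<^esub> g)) \<le> la" if g: "g \<in> carrier (Zmn m n) - {0}" for g
  proof -
    have fX: "finite X" by (simp add: X_def)
    have le3: "card (X \<inter> (X #>\<^bsub>Zmn m n\<^esub> g)) \<le> 3" using card_mono[OF fX, of "X \<inter> (X #>\<^bsub>Zmn m n\<^esub> g)"] X3 by simp
    show ?thesis
    proof (rule ccontr)
      assume "\<not> ?thesis"
      with la le3 have la2: "la = 2" "a + a + a \<notin> lat m n" and "card (X \<inter> (X #>\<^bsub>Zmn m n\<^esub> g)) = card X"
        using X3 by auto
      then have "X \<inter> (X #>\<^bsub>Zmn m n\<^esub> g) = X" using fX by (intro card_subset_eq) auto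
      moreover have "card (X #>\<^bsub>Zmn m n\<^esub> g) \<le> card X" unfolding coset_Zmn using fX by (rule card_image_le)
      moreover have "finite (X #>\<^bsub>Zmn m n\<^esub> g)" using fX by (simp add: coset_Zmn)
      ultimately have "X #>\<^bsub>Zmn m n\<^esub> g = X" by (metis card_seteq inf.absorb_iff1)
      then have shift: "red m n (x + g) \<in> X" if "x \<in> X" for x using that by (auto simp: coset_Zmn)
      have g0: "g \<notin> lat m n" using g red_eq_iff[of g 0] red_id[of g] pos by (auto simp: red_def zero_prod_def)
      have mem: "v + g \<in> lat m n \<or> v + g - a \<in> lat m n \<or> v + g - b \<in> lat m n" if v: "v \<in> {0, a, b}" for v
      proof -
        have "red m n v \<in> X" using v unfolding X_def by (rule imageI)
        then have "red m n (red m n v + g) \<in> X" by (rule shift)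
        moreover have "red m n (red m n v + g) = red m n (v + g)"
          using red_cong[of v] by (simp add: red_eq_iff algebra_simps)
        ultimately have "red m n (v + g) \<in> X" by simp
        then have "red m n (v + g) = red m n 0 \<or> red m n (v + g) = red m n a \<or> red m n (v + g) = red m n b"
          unfolding X_def by blast
        then show ?thesis by (simp add: red_eq_iff)
      qed
      have mem0: "g - a \<in> lat m n \<or> g - b \<in> lat m n" using mem[of 0] g0 by simp
      have mema: "a + g \<in> lat m n \<or> a + g - b \<in> lat m n" using mem[of a] g0 by auto
      have memb: "b + g \<in> lat m n \<or> b + g - a \<in> lat m n" using mem[of b] g0 by auto
      \<comment> \<open>Translation by g permutes 0, a, b without fixed points. Among the
        combinations only the two 3-cycles are consistent, and adding up their three congruences
        gives 3 * a = 0.\<close>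
      from mema memb have "a + b + g + g \<in> lat m n \<and> False \<or> a + g \<in> lat m n \<and> b + g - a \<in> lat m n \<or>
          a + g - b \<in> lat m n \<and> b + g \<in> lat m n \<or> a + g - b \<in> lat m n \<and> b + g - a \<in> lat m n"
        using ab(3) lat_diff[of "a + g" m n "b + g"] by auto
      then show False
      proof (elim disjE conjE)
        assume 1: "a + g \<in> lat m n" "b + g - a \<in> lat m n"
        from mem0 show False
        proof
          assume "g - a \<in> lat m n"
          from lat_diff[OF 1(2) this] show False using ab(2) by simp
        next
          assume gb: "g - b \<in> lat m n"
          have "(a + g) + (a + g) + (a + g) - ((b + g - a) + (g - b) + (a + g)) \<in> lat m n"
            using lat_diff[OF lat_add[OF lat_add[OF 1(1) 1(1)] 1(1)] lat_add[OF lat_add[OF 1(2) gb] 1(1)]] .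
          then show False using la2(2) by (simp add: algebra_simps)
        qed
      next
        assume 2: "a + g - b \<in> lat m n" "b + g \<in> lat m n"
        from mem0 show False
        proof
          assume ga: "g - a \<in> lat m n"
          have "(a + g - b) + (b + g) - (g - a) - (g - a) \<in> lat m n"
            using lat_diff[OF lat_diff[OF lat_add[OF 2] ga] ga] .
          then show False using la2(2) by (simp add: algebra_simps)
        next
          assume "g - b \<in> lat m n"
          from lat_diff[OF 2(1) this] show False using ab(1) by simp
        qed
      next
        assume 3: "a + g - b \<in> lat m n" "b + g - a \<in> lat m n"
        from mem0 show False
        proof
          assume "g - a \<in> lat m n"
          from lat_diff[OF 3(2) this] show False using ab(2) by simp
        next
          assume "g - b \<in> lat m n"
          from lat_diff[OF 3(1) this] show False using ab(1) by simp
        qed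
      qed (simp)
    qed
  qed
  have "diffs m n X \<subseteq> pm (lat m n) a \<union> pm (lat m n) b \<union> pm (lat m n) (a - b)"
  proof
    fix v assume "v \<in> diffs m n X"
    then obtain x y where xy: "x \<in> {0, a, b}" "y \<in> {0, a, b}" and v: "v \<notin> lat m n"
      "v - (red m n x - red m n y) \<in> lat m n" unfolding diffs_def X_def by blast
    have "v - (x - y) \<in> lat m n"
      using lat_add[OF v(2) lat_diff[OF red_cong[of x] red_cong[of y]]] by (simp add: algebra_simps)
    then show "v \<in> pm (lat m n) a \<union> pm (lat m n) b \<union> pm (lat m n) (a - b)"
      using xy v(1) by (auto simp: pm_def algebra_simps)
  qed
  moreover have "is_OOSPC m n 3 la 1 {X}" using X3 XC self by (intro OOSPC_I) auto
  ultimately show ?thesis unfolding packs_def by (intro exI[of _ "{X}"]) simp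
qed

end

section \<open>Construction of codes\<close>

definition par :: "int \<times> int \<Rightarrow> bool \<times> bool" where
  "par v = (odd (fst v), odd (snd v))"

text \<open>By the Chinese remainder theorem an element is given by its parities and its residues
  modulo p and q. The four cells of e form one block. The all-even cell is indexed by half its
  residue, so that the difference 2 * x of {0, x, -x} stays in the block of x.\<close>

definition cell :: "nat \<Rightarrow> nat \<Rightarrow> bool \<times> bool \<Rightarrow> int \<times> int \<Rightarrow> (int \<times> int) set" where
  "cell p q c e = {v. par v = c \<and> v \<in> pm (lat p q) (if c = (False, False) then e + e else e)}"

definition cells :: "nat \<Rightarrow> nat \<Rightarrow> ((bool \<times> bool) \<times> int \<times> int) set \<Rightarrow> (int \<times> int) set" where
  "cells p q I = (\<Union>(c, e)\<in>I. cell p q c e)"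

definition flat :: "('a \<times> 'a \<times> 'a) list \<Rightarrow> 'a list" where
  "flat ts = concat (map (\<lambda>(a, b, c). [a, b, c]) ts)"

lemma flat_simps [simp]: "flat [] = []" "flat ((a, b, c) # ts) = a # b # c # flat ts"
  by (simp_all add: flat_def)

lemma set_flat: "set (flat ts) = supp (set ts)"
  by (auto simp: flat_def supp_def)

lemma length_flat: "length (flat ts) = 3 * length ts"
  by (induction ts) auto

lemma pm_lat_sym: "u \<in> pm (lat p q) v \<Longrightarrow> v \<in> pm (lat p q) u"
  using lat_minus_commute[of u v p q] by (auto simp: pm_def add.commute)

lemma pm_lat_self: "v \<in> pm (lat p q) v"
  by (simp add: pm_def)

lemma pm_lat_eq_iff: "pm (lat p q) u = pm (lat p q) v \<longleftrightarrow> u \<in> pm (lat p q) v"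
proof
  assume "u \<in> pm (lat p q) v"
  then show "pm (lat p q) u = pm (lat p q) v"
    using pm_lat_sym pm_lat_trans by blast
qed (use pm_lat_self in blast)

text \<open>In the group of order p * q a class has at most two elements. So
  \<open>length xs\<close> classes reach all nonzero elements only if they are distinct, none is
  zero, and the bound is an equality.\<close>

lemma cover_counting:
  assumes pq: "p > 0" "q > 0"
    and cov: "\<And>v. v \<notin> lat p q \<Longrightarrow> \<exists>e\<in>set xs. v \<in> pm (lat p q) e" and len: "2 * length xs + 1 \<le> p * q"
  shows "distinct (map (pm (lat p q)) xs)" "set xs \<inter> lat p q = {}" "p * q = 2 * length xs + 1"
proof -
  let ?C = "carrier (Zmn p q)" and ?P = "pm (lat p q) ` (set xs - lat p q)"
  have card2: "card (pm (lat p q) e \<inter> ?C) \<le> 2" for e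
  proof -
    have "v = red p q e \<or> v = red p q (- e)" if "v \<in> pm (lat p q) e \<inter> ?C" for v
      using that red_eq_iff[OF pq, of v e] red_eq_iff[OF pq, of v "- e"] red_id[OF pq, of v] by (auto simp: pm_def)
    then have "pm (lat p q) e \<inter> ?C \<subseteq> {red p q e, red p q (- e)}" by blast
    from card_mono[OF _ this] show ?thesis by (simp add: card_insert_if split: if_splits)
  qed
  have "?C \<subseteq> {0} \<union> (\<Union>P\<in>?P. P \<inter> ?C)"
  proof
    fix v assume v: "v \<in> ?C"
    show "v \<in> {0} \<union> (\<Union>P\<in>?P. P \<inter> ?C)"
    proof (cases "v \<in> lat p q")
      case True
      have "0 \<in> ?C" unfolding carrier_Zmn[OF pq] using pq by (simp add: zero_prod_def)
      then have "v = 0" using True carrier_eq_iff[OF pq v, of 0] by simp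
      then show ?thesis by simp
    next
      case False
      then obtain e where e: "e \<in> set xs" "v \<in> pm (lat p q) e" using cov by blast
      have "e \<notin> lat p q"
      proof
        assume "e \<in> lat p q"
        then have "v \<in> lat p q" using e(2) lat_add[of "v - e" p q e] lat_diff[of "v + e" p q e] by (auto simp: pm_def)
        with False show False ..
      qed
      then show ?thesis using e v by blast
    qed
  qed
  moreover have "finite ?C" by (rule finite_carrier_Zmn[OF pq])
  ultimately have "card ?C \<le> card ({0} \<union> (\<Union>P\<in>?P. P \<inter> ?C))" by (intro card_mono) auto
  also have "\<dots> \<le> 1 + card (\<Union>P\<in>?P. P \<inter> ?C)" using card_Un_le[of "{0}"] by simp
  also have "card (\<Union>P\<in>?P. P \<inter> ?C) \<le> (\<Sum>P\<in>?P. card (P \<inter> ?C))" by (rule card_UN_le) simp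
  also have "\<dots> \<le> (\<Sum>P\<in>?P. 2)" using card2 by (intro sum_mono) auto
  also have "card ?C = p * q" unfolding carrier_Zmn[OF pq] by (simp add: card_cartesian_product)
  finally have c: "p * q \<le> 1 + 2 * card ?P" by simp
  have P1: "card ?P \<le> card (set xs - lat p q)" by (intro card_image_le) simp
  have P2: "card (set xs - lat p q) \<le> card (set xs)" by (intro card_mono) auto
  have P3: "card (set xs) \<le> length xs" by (rule card_length)
  show "p * q = 2 * length xs + 1" using c P1 P2 P3 len by linarith
  have "card (set xs - lat p q) = card (set xs)" using c P1 P2 P3 len by linarith
  then have "set xs - lat p q = set xs" by (intro card_subset_eq) auto
  then show "set xs \<inter> lat p q = {}" by blast
  have "card ?P \<le> card (set (map (pm (lat p q)) xs))" by (intro card_mono) auto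
  then have "card (set (map (pm (lat p q)) xs)) = length (map (pm (lat p q)) xs)"
    using c len card_length[of "map (pm (lat p q)) xs"] by simp
  then show "distinct (map (pm (lat p q)) xs)" by (rule card_distinct)
qed

lemma dvd_double_iff:
  fixes x :: int
  assumes "odd p" shows "int (2 * p) dvd x \<longleftrightarrow> even x \<and> int p dvd x"
proof
  assume "even x \<and> int p dvd x"
  then obtain k where k: "x = int p * k" "even x" by blast
  then have "even k" using assms by simp
  then show "int (2 * p) dvd x" using k(1) by (auto elim!: evenE)
qed (auto elim: dvd_trans[rotated])

lemma dvd_double_cancel:
  fixes x :: int
  assumes "odd p" "int p dvd x + x" shows "int p dvd x"
proof -
  obtain k where "int p = 2 * k + 1" using assms(1) by (metis even_of_nat oddE)
  then have "x = int p * x - k * (x + x)" by (simp add: algebra_simps)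
  then show ?thesis using assms(2) by (metis dvd_diff dvd_mult dvd_triv_left)
qed

section \<open>Codewords inside the cells\<close>

context
  fixes p q :: nat
  assumes odd_pq: "odd p" "odd q"
begin

lemma pos2: "2 * p > 0" "2 * q > 0"
  using odd_pq by (auto intro: Nat.gr0I)

lemma lat2_iff: "v \<in> lat (2 * p) (2 * q) \<longleftrightarrow> par v = (False, False) \<and> v \<in> lat p q"
  unfolding lat_def par_def using dvd_double_iff[OF odd_pq(1)] dvd_double_iff[OF odd_pq(2)] by auto

lemma par_lat2: "u - v \<in> lat (2 * p) (2 * q) \<Longrightarrow> par u = par v"
  "u + v \<in> lat (2 * p) (2 * q) \<Longrightarrow> par u = par v"
  unfolding lat2_iff by (auto simp: par_def)

lemma lat_double_cancel: "v + v \<in> lat p q \<Longrightarrow> v \<in> lat p q"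
  using dvd_double_cancel[OF odd_pq(1), of "fst v"] dvd_double_cancel[OF odd_pq(2), of "snd v"]
  by (simp add: lat_def)

text \<open>Adding the odd number p or q to a coordinate changes its parity but not its
  residue.\<close>

lemma point_exists: obtains a where "par a = c" "a - e \<in> lat p q"
proof -
  have "\<exists>y. odd y = b \<and> int r dvd y - x" if r: "odd r" for r b and x :: int
    using r by (intro exI[of _ "if odd x = b then x else x + int r"]) auto
  from this[OF odd_pq(1), of "fst c" "fst e"] this[OF odd_pq(2), of "snd c" "snd e"]
  obtain y z where "odd y = fst c" "int p dvd y - fst e" "odd z = snd c" "int q dvd z - snd e" by blast
  then show thesis by (intro that[of "(y, z)"]) (auto simp: par_def lat_def)
qed

lemma pm_subset_cell:
  assumes "a \<in> pm (lat p q) (if par a = (False, False) then e + e else e)"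
  shows "pm (lat (2 * p) (2 * q)) a \<subseteq> cell p q (par a) e"
proof
  fix v assume v: "v \<in> pm (lat (2 * p) (2 * q)) a"
  then have "par v = par a" using par_lat2[of v a] unfolding pm_def by blast
  moreover have "v \<in> pm (lat p q) a" using v by (auto simp: pm_def lat2_iff)
  then have "v \<in> pm (lat p q) (if par a = (False, False) then e + e else e)"
    using assms pm_lat_eq_iff by blast
  ultimately show "v \<in> cell p q (par a) e" by (simp add: cell_def)
qed

text \<open>Even in the all-even cells different classes stay apart, since doubling is injective
  modulo odd numbers.\<close>

lemma cells_disjoint:
  assumes "\<And>c e e'. (c, e) \<in> I \<Longrightarrow> (c, e') \<in> J \<Longrightarrow> pm (lat p q) e \<noteq> pm (lat p q) e'"
  shows "cells p q I \<inter> cells p q J = {}"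
proof (rule ccontr)
  assume "\<not> ?thesis"
  then obtain v c e c' e' where v: "(c, e) \<in> I" "v \<in> cell p q c e" "(c', e') \<in> J" "v \<in> cell p q c' e'"
    unfolding cells_def by blast
  then have c: "c' = c" by (auto simp: cell_def)
  have "pm (lat p q) e = pm (lat p q) e'"
  proof (cases "c = (False, False)")
    case True
    then have "v \<in> pm (lat p q) (e + e)" "v \<in> pm (lat p q) (e' + e')" using v c by (auto simp: cell_def)
    then have "e + e \<in> pm (lat p q) (e' + e')" using pm_lat_eq_iff by blast
    then have "(e - e') + (e - e') \<in> lat p q \<or> (e + e') + (e + e') \<in> lat p q"
      by (simp add: pm_def algebra_simps)
    then have "e - e' \<in> lat p q \<or> e + e' \<in> lat p q" using lat_double_cancel by blast
    then show ?thesis unfolding pm_lat_eq_iff by (simp add: pm_def)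
  next
    case False
    then have "v \<in> pm (lat p q) e" "v \<in> pm (lat p q) e'" using v c by (auto simp: cell_def)
    then show ?thesis using pm_lat_eq_iff by blast
  qed
  then show False using assms v(1,3) c by blast
qed

lemma packs_cells_Un:
  assumes "packs (2 * p) (2 * q) la (cells p q I) k" "packs (2 * p) (2 * q) la (cells p q J) l"
    and "\<And>c e e'. (c, e) \<in> I \<Longrightarrow> (c, e') \<in> J \<Longrightarrow> pm (lat p q) e \<noteq> pm (lat p q) e'"
  shows "packs (2 * p) (2 * q) la (cells p q (I \<union> J)) (k + l)"
proof -
  have "cells p q (I \<union> J) = cells p q I \<union> cells p q J" by (auto simp: cells_def)
  then show ?thesis using packs_Un[OF pos2 assms(1,2) cells_disjoint[OF assms(3)]] by simp
qed

lemma packs_cells_mono: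
  "packs (2 * p) (2 * q) la (cells p q I) k \<Longrightarrow> I \<subseteq> J \<Longrightarrow> packs (2 * p) (2 * q) la (cells p q J) k"
  by (erule packs_mono[OF pos2]) (auto simp: cells_def)

text \<open>The codeword is {0, x, -y} with differences x, y, x + y. Their parities are the three
  nonzero ones, so 3 * x is nonzero and both values of \<open>la\<close> are admissible.\<close>

lemma packs_three:
  assumes la: "la \<in> {2, 3}" and c: "(a, b) \<noteq> (False, False)" "(c, d) \<noteq> (False, False)" "(a, b) \<noteq> (c, d)"
    and e: "e1 + e2 \<in> pm (lat p q) e3"
  shows "packs (2 * p) (2 * q) la (cells p q {((a, b), e1), ((c, d), e2), ((a \<noteq> c, b \<noteq> d), e3)}) 1"
proof -
  obtain x where x: "par x = (a, b)" "x - e1 \<in> lat p q" using point_exists .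
  obtain y where y: "par y = (c, d)" "y - e2 \<in> lat p q" using point_exists .
  have p: "par (- y) = (c, d)" "par (x - - y) = (a \<noteq> c, b \<noteq> d)" "par (x + x + x) = (a, b)"
    using x(1) y(1) by (auto simp: par_def)
  have n: "(a \<noteq> c, b \<noteq> d) \<noteq> (False, False)" using c(3) by auto
  have "x \<in> pm (lat p q) e1" "- y \<in> pm (lat p q) e2"
    using x(2) y(2) lat_minus_commute[of y e2 p q] by (auto simp: pm_def)
  moreover have "x - - y \<in> pm (lat p q) e3"
    using e lat_add[OF lat_add[OF x(2) y(2)], of "e1 + e2 - e3"] lat_add[OF lat_add[OF x(2) y(2)], of "e1 + e2 + e3"]
    by (auto simp: pm_def algebra_simps)
  ultimately have "pm (lat (2 * p) (2 * q)) x \<subseteq> cell p q (a, b) e1"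
    "pm (lat (2 * p) (2 * q)) (- y) \<subseteq> cell p q (c, d) e2"
    "pm (lat (2 * p) (2 * q)) (x - - y) \<subseteq> cell p q (a \<noteq> c, b \<noteq> d) e3"
    using pm_subset_cell[of x e1] pm_subset_cell[of "- y" e2] pm_subset_cell[of "x - - y" e3]
    unfolding p x(1) using c n by (simp_all only: if_False)
  then have sub: "pm (lat (2 * p) (2 * q)) x \<union> pm (lat (2 * p) (2 * q)) (- y) \<union> pm (lat (2 * p) (2 * q)) (x - - y)
    \<subseteq> cells p q {((a, b), e1), ((c, d), e2), ((a \<noteq> c, b \<noteq> d), e3)}"
    unfolding cells_def by blast
  have "x \<notin> lat (2 * p) (2 * q)" "- y \<notin> lat (2 * p) (2 * q)" "x - - y \<notin> lat (2 * p) (2 * q)"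
    "x + x + x \<notin> lat (2 * p) (2 * q)"
    unfolding lat2_iff p x(1) using c n by blast+
  then show ?thesis using la by (intro packs_mono[OF pos2 packs_single[OF pos2] sub]) auto
qed

text \<open>The codeword is {0, x, -x}, with differences x and 2 * x up to sign. Phrasing the
  condition on x + x through \<open>pm\<close> also admits an x = 2 * e of order 3, for which 2 * x
  = e = -2 * e falls back into the all-even cell.\<close>

lemma packs_pm:
  assumes la: "la = 3 \<or> la = 2 \<and> x + x + x \<notin> lat (2 * p) (2 * q)" and e: "e \<notin> lat p q"
    and x: "x - (if par x = (False, False) then e + e else e) \<in> lat p q" "x + x \<in> pm (lat p q) (e + e)"
  shows "packs (2 * p) (2 * q) la (cells p q {(par x, e), ((False, False), e)}) 1"
proof -
  have p: "par (- x) = par x" "par (x - - x) = (False, False)" by (auto simp: par_def)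
  have "x \<in> pm (lat p q) (if par x = (False, False) then e + e else e)" using x(1) by (simp add: pm_def)
  then have "pm (lat (2 * p) (2 * q)) x \<subseteq> cell p q (par x) e" by (rule pm_subset_cell)
  moreover have "pm (lat (2 * p) (2 * q)) (- x) = pm (lat (2 * p) (2 * q)) x"
    unfolding pm_lat_eq_iff by (simp add: pm_def)
  moreover have "pm (lat (2 * p) (2 * q)) (x - - x) \<subseteq> cell p q (False, False) e"
    using pm_subset_cell[of "x - - x" e] x(2) unfolding p by simp
  ultimately have sub: "pm (lat (2 * p) (2 * q)) x \<union> pm (lat (2 * p) (2 * q)) (- x) \<union>
      pm (lat (2 * p) (2 * q)) (x - - x) \<subseteq> cells p q {(par x, e), ((False, False), e)}"
    unfolding cells_def by blast
  have "x - - x \<notin> lat (2 * p) (2 * q)"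
  proof
    assume "x - - x \<in> lat (2 * p) (2 * q)"
    then have "x + x \<in> lat p q" by (simp add: lat2_iff)
    then have "e + e \<in> lat p q"
      using x(2) lat_diff[of "x + x" p q "x + x - (e + e)"] lat_diff[of "x + x + (e + e)" p q "x + x"]
      by (auto simp: pm_def)
    then show False using e lat_double_cancel by blast
  qed
  moreover from this have "x \<notin> lat (2 * p) (2 * q)" using lat_add[of x "2 * p" "2 * q" x] by auto
  moreover from this have "- x \<notin> lat (2 * p) (2 * q)" by (simp add: lat_uminus)
  ultimately show ?thesis using la by (intro packs_mono[OF pos2 packs_single[OF pos2] sub]) auto
qed

lemma packs_double:
  assumes la: "la \<in> {2, 3}" and c: "c \<noteq> (False, False)" and e: "e \<notin> lat p q"
  shows "packs (2 * p) (2 * q) la (cells p q {(c, e), ((False, False), e)}) 1"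
proof -
  obtain x where x: "par x = c" "x - e \<in> lat p q" using point_exists .
  have "par (x + x + x) = c" using x(1) by (auto simp: par_def)
  then have "x + x + x \<notin> lat (2 * p) (2 * q)" using c by (simp add: lat2_iff)
  moreover have "x + x \<in> pm (lat p q) (e + e)"
    using lat_add[OF x(2) x(2)] by (simp add: pm_def algebra_simps)
  ultimately show ?thesis using packs_pm[of la x e] la c e x by auto
qed

text \<open>The subgroup {0, x, -x} of order 3 occupies only the all-even cell. The other three
  cells of the block then take one more codeword, because e + e = -e.\<close>

lemma packs_order3:
  assumes e: "e \<in> order3 p q"
  shows "packs (2 * p) (2 * q) 3 (cells p q (UNIV \<times> {e})) 2"
proof -
  have e': "e \<notin> lat p q" "e + e + e \<in> lat p q" using e by (auto simp: order3_def)
  obtain x where x: "par x = (False, False)" "x - (e + e) \<in> lat p q" using point_exists .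
  have "x + x \<in> pm (lat p q) (e + e)"
    using lat_add[OF lat_add[OF lat_add[OF x(2) x(2)] e'(2)] e'(2)] by (simp add: pm_def algebra_simps)
  then have 1: "packs (2 * p) (2 * q) 3 (cells p q {((False, False), e)}) 1"
    using packs_pm[of 3 x e] e' x by simp
  have "e + e \<in> pm (lat p q) e" using e'(2) by (simp add: pm_def)
  from packs_three[of 3 False True True False, OF _ _ _ _ this]
  have 2: "packs (2 * p) (2 * q) 3 (cells p q {((False, True), e), ((True, False), e), ((True, True), e)}) 1"
    by simp
  have "packs (2 * p) (2 * q) 3 (cells p q ({((False, False), e)} \<union>
      {((False, True), e), ((True, False), e), ((True, True), e)})) (1 + 1)"
    by (rule packs_cells_Un[OF 1 2]) auto
  then have "packs (2 * p) (2 * q) 3 (cells p q (UNIV \<times> {e})) (1 + 1)"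
    by (rule packs_cells_mono) auto
  then show ?thesis by (simp add: numeral_2_eq_2)
qed

text \<open>Each codeword {0, x, -x} uses one all-even cell and one other cell. The nine cells
  outside H form a square with rows a, b, c and the nonzero parities as columns. It is split into
  three transversals: one serves the three symmetric codewords, and each of the other two holds one
  codeword, by the zero sum.\<close>

lemma packs_triple:
  assumes la: "la \<in> {2, 3}" and z: "a + b + c \<in> lat p q" and n: "a \<notin> lat p q" "b \<notin> lat p q" "c \<notin> lat p q"
    and d: "distinct (map (pm (lat p q)) [a, b, c])"
  shows "packs (2 * p) (2 * q) la (cells p q (UNIV \<times> {a, b, c})) 5"
proof -
  have ab: "a + b \<in> pm (lat p q) c" "a + c \<in> pm (lat p q) b" using z by (auto simp: pm_def algebra_simps)
  have 1: "packs (2 * p) (2 * q) la (cells p q {((True, True), a), ((False, False), a)}) 1"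
    "packs (2 * p) (2 * q) la (cells p q {((False, True), b), ((False, False), b)}) 1"
    "packs (2 * p) (2 * q) la (cells p q {((True, False), c), ((False, False), c)}) 1"
    using packs_double[OF la] n by simp_all
  have 2: "packs (2 * p) (2 * q) la (cells p q {((False, True), a), ((True, False), b), ((True, True), c)}) 1"
    using packs_three[OF la, of False True True False a b c] ab by simp
  have 3: "packs (2 * p) (2 * q) la (cells p q {((True, False), a), ((False, True), c), ((True, True), b)}) 1"
    using packs_three[OF la, of True False False True a c b] ab by simp
  have "packs (2 * p) (2 * q) la (cells p q (((({((True, True), a), ((False, False), a)} \<union>
      {((False, True), b), ((False, False), b)}) \<union> {((True, False), c), ((False, False), c)}) \<union>
      {((False, True), a), ((True, False), b), ((True, True), c)}) \<union>
      {((True, False), a), ((False, True), c), ((True, True), b)})) ((((1 + 1) + 1) + 1) + 1)"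
    by (intro packs_cells_Un 1 2 3) (use d in auto)
  then have "packs (2 * p) (2 * q) la (cells p q (UNIV \<times> {a, b, c})) ((((1 + 1) + 1) + 1) + 1)"
    by (rule packs_cells_mono) auto
  then show ?thesis by (simp add: eval_nat_numeral)
qed

text \<open>Opposite residues r and -r with the two parities other than c add up to the involution
  of parity c, which gives one codeword. The cells of parity c and of even parity over r give the
  codeword {0, x, -x}.\<close>

lemma packs_leftover:
  assumes la: "la \<in> {2, 3}" and c: "c \<noteq> (False, False)" and r: "r \<notin> lat p q"
  shows "packs (2 * p) (2 * q) la (cells p q (insert (c, 0) (UNIV \<times> {r}))) 2"
proof -
  obtain x y z w where xy: "(x, y) \<noteq> (False, False)" "(z, w) \<noteq> (False, False)" "(x, y) \<noteq> (z, w)"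
    "c = (x \<noteq> z, y \<noteq> w)" "(x, y) \<noteq> c" "(z, w) \<noteq> c"
  proof -
    obtain s t where "c = (s, t)" by fastforce
    then show thesis
      using c that[of False True True True] that[of False True True False] that[of True False True True]
      by (cases s; cases t) auto
  qed
  have z0: "pm (lat p q) 0 \<noteq> pm (lat p q) r"
    unfolding pm_lat_eq_iff using r lat_uminus[of r p q] by (auto simp: pm_def)
  have "packs (2 * p) (2 * q) la (cells p q {((x, y), r), ((z, w), - r), (c, 0)}) 1"
    using packs_three[OF la xy(1-3), of r "- r" 0] unfolding xy(4) by (simp add: pm_def)
  moreover have "cell p q (z, w) (- r) = cell p q (z, w) r"
    using xy(2) pm_lat_eq_iff[of p q "- r" r] by (auto simp: cell_def pm_def)
  ultimately have 1: "packs (2 * p) (2 * q) la (cells p q {((x, y), r), ((z, w), r), (c, 0)}) 1"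
    by (simp add: cells_def)
  have "packs (2 * p) (2 * q) la (cells p q ({((x, y), r), ((z, w), r), (c, 0)} \<union> {(c, r), ((False, False), r)})) (1 + 1)"
    by (rule packs_cells_Un[OF 1 packs_double[OF la c r]]) (use z0 c xy(1,2,5,6) in blast)
  then have "packs (2 * p) (2 * q) la (cells p q (insert (c, 0) (UNIV \<times> {r}))) (1 + 1)"
    by (rule packs_cells_mono) auto
  then show ?thesis by (simp add: numeral_2_eq_2)
qed

lemma packs_triples:
  assumes "la \<in> {2, 3}" "\<And>a b c. (a, b, c) \<in> set ts \<Longrightarrow> a + b + c \<in> lat p q"
    and "set (flat ts) \<inter> lat p q = {}" "distinct (map (pm (lat p q)) (flat ts))"
  shows "packs (2 * p) (2 * q) la (cells p q (UNIV \<times> set (flat ts))) (5 * length ts)"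
  using assms(2-4)
proof (induction ts)
  case Nil
  then show ?case using packs_empty[OF pos2] by simp
next
  case (Cons t ts)
  obtain a b c where t: "t = (a, b, c)" by (rule prod_cases3)
  have 1: "packs (2 * p) (2 * q) la (cells p q (UNIV \<times> {a, b, c})) 5"
    using Cons.prems t by (intro packs_triple assms(1)) auto
  have 2: "packs (2 * p) (2 * q) la (cells p q (UNIV \<times> set (flat ts))) (5 * length ts)"
    using Cons.prems t by (intro Cons.IH) auto
  have "packs (2 * p) (2 * q) la (cells p q (UNIV \<times> {a, b, c} \<union> UNIV \<times> set (flat ts))) (5 + 5 * length ts)"
    by (rule packs_cells_Un[OF 1 2]) (use Cons.prems t in auto)
  moreover have "(UNIV :: (bool \<times> bool) set) \<times> {a, b, c} \<union> UNIV \<times> set (flat ts) = UNIV \<times> set (flat (t # ts))" using t by auto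
  moreover have "5 + 5 * length ts = 5 * length (t # ts)" by simp
  ultimately show ?case by (simp only:)
qed

lemma packs_order3s:
  assumes "set os \<subseteq> order3 p q" "distinct (map (pm (lat p q)) os)"
  shows "packs (2 * p) (2 * q) 3 (cells p q (UNIV \<times> set os)) (2 * length os)"
  using assms
proof (induction os)
  case Nil
  then show ?case using packs_empty[OF pos2] by simp
next
  case (Cons e os)
  have "packs (2 * p) (2 * q) 3 (cells p q (UNIV \<times> {e} \<union> UNIV \<times> set os)) (2 + 2 * length os)"
    using Cons by (intro packs_cells_Un packs_order3 Cons.IH) auto
  moreover have "(UNIV :: (bool \<times> bool) set) \<times> {e} \<union> UNIV \<times> set os = UNIV \<times> set (e # os)" by auto
  moreover have "2 + 2 * length os = 2 * length (e # os)" by simp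
  ultimately show ?case by (simp only:)
qed

text \<open>\<open>cs\<close> hands every leftover class an involution of its own. There are three
  involutions, hence the bound 3 on the leftovers throughout.\<close>

lemma packs_leftovers:
  assumes "la \<in> {2, 3}" "set rs \<inter> lat p q = {}" "distinct (map (pm (lat p q)) rs)"
    "length cs = length rs" "distinct cs" "(False, False) \<notin> set cs"
  shows "packs (2 * p) (2 * q) la (cells p q (set cs \<times> {0} \<union> UNIV \<times> set rs)) (2 * length rs)"
  using assms(2-)
proof (induction rs arbitrary: cs)
  case Nil
  then show ?case using packs_empty[OF pos2] by simp
next
  case (Cons r rs)
  then obtain c cs' where cs: "cs = c # cs'" by (cases cs) auto
  have z: "pm (lat p q) 0 \<noteq> pm (lat p q) e" "pm (lat p q) e \<noteq> pm (lat p q) 0" if "e \<notin> lat p q" for e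
    unfolding pm_lat_eq_iff using that lat_uminus[of e p q] by (auto simp: pm_def)
  have nl: "e \<notin> lat p q" if "e = r \<or> e \<in> set rs" for e using Cons.prems(1) that by auto
  have 1: "packs (2 * p) (2 * q) la (cells p q (insert (c, 0) (UNIV \<times> {r}))) 2"
    using Cons.prems cs by (intro packs_leftover assms(1)) auto
  have 2: "packs (2 * p) (2 * q) la (cells p q (set cs' \<times> {0} \<union> UNIV \<times> set rs)) (2 * length rs)"
    using Cons.prems cs by (intro Cons.IH) auto
  have "packs (2 * p) (2 * q) la (cells p q (insert (c, 0) (UNIV \<times> {r}) \<union> (set cs' \<times> {0} \<union> UNIV \<times> set rs)))
      (2 + 2 * length rs)"
  proof (rule packs_cells_Un[OF 1 2])
    fix d e e' assume *: "(d, e) \<in> insert (c, 0) (UNIV \<times> {r})" "(d, e') \<in> set cs' \<times> {0} \<union> UNIV \<times> set rs"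
    have "c \<notin> set cs'" "\<forall>e\<in>set rs. pm (lat p q) r \<noteq> pm (lat p q) e" using Cons.prems cs by auto
    then show "pm (lat p q) e \<noteq> pm (lat p q) e'" using * z nl by blast
  qed
  moreover have "insert (c, 0) ((UNIV :: (bool \<times> bool) set) \<times> {r}) \<union> (set cs' \<times> {0} \<union> UNIV \<times> set rs) =
      set cs \<times> {0} \<union> UNIV \<times> set (r # rs)" using cs by auto
  moreover have "2 + 2 * length rs = 2 * length (r # rs)" by simp
  ultimately show ?case by (simp only:)
qed

text \<open>The involutions are the differences of a codeword inside the Klein four-group.\<close>

lemma packs_involutions:
  assumes "la \<in> {2, 3}"
  shows "packs (2 * p) (2 * q) la (cells p q ({(False, True), (True, False), (True, True)} \<times> {0})) 1"
proof -
  have "packs (2 * p) (2 * q) la (cells p q {((False, True), 0), ((True, False), 0), ((True, True), 0)}) 1"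
    using packs_three[OF assms, of False True True False 0 0 0] by (simp add: pm_def)
  then show ?thesis by (rule packs_cells_mono) auto
qed

lemma Theta_lower:
  assumes la: "la \<in> {2, 3}" and cov: "zs_cover (lat p q) (p * q) T E"
    and R: "O' \<subseteq> E" "card (E - O') \<le> 3" and O': "O' \<subseteq> order3 p q" "O' \<noteq> {} \<Longrightarrow> la = 3"
  shows "(5 * (p * q) + 1 + 2 * card O') div 6 \<le> Theta (2 * p) (2 * q) 3 la 1"
proof -
  note C = zs_coverD[OF cov]
  have fO: "finite O'" using R(1) C(2) finite_subset by blast
  obtain ts where ts: "set ts = T" "distinct ts" using finite_distinct_list[OF C(1)] by blast
  obtain os where os: "set os = O'" "distinct os" using finite_distinct_list[OF fO] by blast
  obtain rs where rs: "set rs = E - O'" "distinct rs" using finite_distinct_list[of "E - O'"] C(2) by blast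
  have len: "length ts = card T" "length os = card O'" "length rs = card (E - O')"
    using ts os rs distinct_card by metis+
  have cE: "card E = card O' + card (E - O')"
    using card_Diff_subset[OF fO R(1)] card_mono[OF C(2) R(1)] by simp
  define xs where "xs = flat ts @ os @ rs"
  have p0: "p > 0" "q > 0" using odd_pq by (auto intro: Nat.gr0I)
  have "set xs = supp T \<union> E" using R(1) by (auto simp: xs_def set_flat ts os rs)
  moreover have lx: "length xs = 3 * card T + card E" by (simp add: xs_def length_flat len cE)
  ultimately have D: "distinct (map (pm (lat p q)) xs)" "set xs \<inter> lat p q = {}" "p * q = 2 * length xs + 1"
    using cover_counting[OF p0, of xs] C(3,5) by simp_all
  have nl: "e \<notin> lat p q" if "e \<in> set xs" for e using D(2) that by blast
  have z: "pm (lat p q) 0 \<noteq> pm (lat p q) e" "pm (lat p q) e \<noteq> pm (lat p q) 0" if "e \<in> set xs" for e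
    unfolding pm_lat_eq_iff using nl[OF that] lat_uminus[of e p q] by (auto simp: pm_def)
  have 1: "packs (2 * p) (2 * q) la (cells p q (UNIV \<times> set (flat ts))) (5 * length ts)"
    using C(4) D by (intro packs_triples la) (auto simp: ts xs_def)
  have 2: "packs (2 * p) (2 * q) la (cells p q (UNIV \<times> set os)) (2 * length os)"
  proof (cases "O' = {}")
    case True
    then show ?thesis using os packs_empty[OF pos2] by simp
  next
    case False
    then show ?thesis using O' D(1) packs_order3s[of os] by (simp add: os xs_def)
  qed
  \<comment> \<open>Without leftovers the involutions make up a codeword of their own; otherwise
    each leftover takes one of them.\<close>
  define cs where "cs = (if rs = [] then [(False, True), (True, False), (True, True)]
     else take (length rs) [(False, True), (True, False), (True, True)])"
  have 3: "packs (2 * p) (2 * q) la (cells p q (set cs \<times> {0} \<union> UNIV \<times> set rs)) (if rs = [] then 1 else 2 * length rs)"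
  proof (cases "rs = []")
    case True
    then show ?thesis using packs_involutions[OF la] by (simp add: cs_def)
  next
    case False
    have "(False, False) \<notin> set cs"
      using False set_take_subset[of "length rs" "[(False, True), (True, False), (True, True)]"] by (auto simp: cs_def)
    moreover have "length cs = length rs" using False R(2) len(3) by (simp add: cs_def)
    moreover have "distinct cs"
      using False distinct_take[of "[(False, True), (True, False), (True, True)]" "length rs"] by (simp add: cs_def)
    ultimately show ?thesis using False D packs_leftovers[OF la, of rs cs] by (simp add: xs_def disjoint_iff)
  qed
  have "packs (2 * p) (2 * q) la (cells p q ((UNIV \<times> set (flat ts) \<union> UNIV \<times> set os) \<union>
      (set cs \<times> {0} \<union> UNIV \<times> set rs))) (5 * length ts + 2 * length os + (if rs = [] then 1 else 2 * length rs))"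
  proof (intro packs_cells_Un 1 2 3)
    fix c e e' assume "(c, e) \<in> UNIV \<times> set (flat ts)" "(c, e') \<in> UNIV \<times> set os"
    then show "pm (lat p q) e \<noteq> pm (lat p q) e'" using D(1) by (auto simp: xs_def)
  next
    fix c e e' assume *: "(c, e) \<in> UNIV \<times> set (flat ts) \<union> UNIV \<times> set os" "(c, e') \<in> set cs \<times> {0} \<union> UNIV \<times> set rs"
    then have "e \<in> set xs" by (auto simp: xs_def)
    then show "pm (lat p q) e \<noteq> pm (lat p q) e'" using * z(2)[of e] D(1) by (auto simp: xs_def)
  qed
  from packs_Theta[OF pos2 this]
  have "5 * card T + 2 * card O' + (if rs = [] then 1 else 2 * card (E - O')) \<le> Theta (2 * p) (2 * q) 3 la 1"
    unfolding len .
  moreover have "card (E - O') = 0" if "rs = []" using len(3) that by simp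
  \<comment> \<open>With t triples, w classes in \<open>O'\<close> and r further leftovers, p * q =
    6t + 2w + 2r + 1, so the quotient is 5t + 2w + (10r + 6) div 6. The last summand is 1, 2, 4, 6
    for r = 0, 1, 2, 3.\<close>
  moreover have "(5 * (p * q) + 1 + 2 * card O') div 6 \<le>
      5 * card T + 2 * card O' + (if rs = [] then 1 else 2 * card (E - O'))"
    using D(3) R(2) lx cE len(3) by (cases rs) simp_all
  ultimately show ?thesis by linarith
qed

end

section \<open>The upper bound\<close>

definition order3_elems :: "nat \<Rightarrow> nat \<Rightarrow> (int \<times> int) set" where
  "order3_elems m n = {v \<in> carrier (Zmn m n). v \<noteq> 0 \<and> v + v + v \<in> lat m n}"

context
  fixes m n :: nat
  assumes pos: "m > 0" "n > 0"
begin

lemma group_Zmn: "group (Zmn m n)"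
  by (intro DirProd_group group_integer_mod_group)

lemma zero_carrier: "0 \<in> carrier (Zmn m n)"
  unfolding carrier_Zmn[OF pos] using pos by (simp add: zero_prod_def)

lemma carrier_lat_iff: "v \<in> carrier (Zmn m n) \<Longrightarrow> v \<in> lat m n \<longleftrightarrow> v = 0"
  using carrier_eq_iff[OF pos _ zero_carrier, of v] by auto

lemma order3_subgroup:
  assumes v: "v \<in> order3_elems m n"
  shows "subgroup {0, v, red m n (v + v)} (Zmn m n)" "card {0, v, red m n (v + v)} = 3"
proof -
  let ?w = "red m n (v + v)"
  interpret group "Zmn m n" by (rule group_Zmn)
  have vC: "v \<in> carrier (Zmn m n)" "v \<noteq> 0" "v + v + v \<in> lat m n" using v by (auto simp: order3_elems_def)
  have vL: "v \<notin> lat m n" using carrier_lat_iff vC by blast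
  have wC: "?w \<in> carrier (Zmn m n)" by (rule red_carrier[OF pos])
  have mult: "v \<otimes>\<^bsub>Zmn m n\<^esub> v = ?w" "v \<otimes>\<^bsub>Zmn m n\<^esub> ?w = 0" "?w \<otimes>\<^bsub>Zmn m n\<^esub> v = 0" "?w \<otimes>\<^bsub>Zmn m n\<^esub> ?w = v"
  proof -
    have r0: "red m n x = 0 \<longleftrightarrow> x \<in> lat m n" for x
      using red_eq_iff[OF pos, of x 0] red_id[OF pos zero_carrier] by simp
    have rv: "red m n x = v \<longleftrightarrow> x - v \<in> lat m n" for x
      using red_eq_iff[OF pos, of x v] red_id[OF pos vC(1)] by simp
    have d: "?w - (v + v) \<in> lat m n" by (rule red_cong[OF pos])
    show "v \<otimes>\<^bsub>Zmn m n\<^esub> v = ?w" by (simp only: mult_Zmn[OF pos])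
    show "v \<otimes>\<^bsub>Zmn m n\<^esub> ?w = 0" "?w \<otimes>\<^bsub>Zmn m n\<^esub> v = 0"
      unfolding mult_Zmn[OF pos] r0 using lat_add[OF d vC(3)] by (simp_all add: algebra_simps)
    show "?w \<otimes>\<^bsub>Zmn m n\<^esub> ?w = v"
      unfolding mult_Zmn[OF pos] rv using lat_add[OF lat_add[OF d d] vC(3)] by (simp add: algebra_simps)
  qed
  note one = one_Zmn[OF pos]
  have inv: "inv\<^bsub>Zmn m n\<^esub> v = ?w" "inv\<^bsub>Zmn m n\<^esub> ?w = v" "inv\<^bsub>Zmn m n\<^esub> 0 = 0"
    using inv_equality[OF _ vC(1) wC] inv_equality[OF _ wC vC(1)] mult(2,3) inv_one unfolding one by blast+
  have unit: "0 \<otimes>\<^bsub>Zmn m n\<^esub> x = x" "x \<otimes>\<^bsub>Zmn m n\<^esub> 0 = x" if "x \<in> carrier (Zmn m n)" for x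
    using l_one[OF that] r_one[OF that] unfolding one .
  show "subgroup {0, v, ?w} (Zmn m n)"
  proof (rule subgroupI)
    show "{0, v, ?w} \<subseteq> carrier (Zmn m n)" using zero_carrier vC(1) wC by blast
    show "inv\<^bsub>Zmn m n\<^esub> a \<in> {0, v, ?w}" if "a \<in> {0, v, ?w}" for a
      using that inv by blast
    show "a \<otimes>\<^bsub>Zmn m n\<^esub> b \<in> {0, v, ?w}" if "a \<in> {0, v, ?w}" "b \<in> {0, v, ?w}" for a b
      using that mult unit[OF vC(1)] unit[OF wC] unit[OF zero_carrier]
      by (elim insertE emptyE; hypsubst) simp_all
  qed simp
  have "?w \<noteq> 0"
  proof
    assume "?w = 0"
    then have "v + v \<in> lat m n" using red_cong[OF pos, of "v + v"] lat_uminus[of "v + v" m n] by simp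
    then show False using lat_diff[OF vC(3), of "v + v"] vL by simp
  qed
  moreover have "?w \<noteq> v"
  proof
    assume "?w = v"
    then have "v \<in> lat m n" using red_cong[OF pos, of "v + v"] lat_uminus[of v m n] by simp
    then show False using vL by blast
  qed
  ultimately show "card {0, v, ?w} = 3" using vC(2) by auto
qed

text \<open>Let u be the third element of H. By cancellation v + u is neither v nor u, hence 0.
  Similarly 2 * v is neither v nor 0, hence u, and therefore 3 * v = 0.\<close>

lemma subgroup_order3:
  assumes H: "subgroup H (Zmn m n)" "card H = 3" and v: "v \<in> H" "v \<noteq> 0"
  shows "v \<in> order3_elems m n" "H = {0, v, red m n (v + v)}"
proof -
  let ?w = "red m n (v + v)"
  have HC: "x \<in> carrier (Zmn m n)" if "x \<in> H" for x using subgroup.mem_carrier[OF H(1) that] .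
  have vC: "v \<in> carrier (Zmn m n)" by (rule HC[OF v(1)])
  have vL: "v \<notin> lat m n" using carrier_lat_iff[OF vC] v(2) by blast
  have closed: "red m n (x + y) \<in> H" if "x \<in> H" "y \<in> H" for x y
    using subgroup.m_closed[OF H(1) that] unfolding mult_Zmn[OF pos] .
  have H0: "0 \<in> H" using subgroup.one_closed[OF H(1)] unfolding one_Zmn[OF pos] .
  have eq: "red m n x = y \<longleftrightarrow> x - y \<in> lat m n" if "y \<in> H" for x y
    using red_eq_iff[OF pos, of x y] red_id[OF pos HC[OF that]] by simp
  have fH: "finite H" using H(2) by (metis card.infinite zero_neq_numeral)
  have wH: "?w \<in> H" using closed[OF v(1) v(1)] .
  have wv: "?w \<noteq> v" using eq[OF v(1)] vL by auto
  obtain u where u: "u \<in> H" "u \<noteq> 0" "u \<noteq> v" "H = {0, v, u}"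
  proof -
    have "card (H - {0, v}) = 1" using H(2) H0 v fH by (simp add: card_Diff_subset)
    then obtain u where u: "H - {0, v} = {u}" by (rule card_1_singletonE)
    show thesis
    proof (rule that)
      show "u \<in> H" "u \<noteq> 0" "u \<noteq> v" "H = {0, v, u}" using u H0 v(1) by blast+
    qed
  qed
  have uL: "u \<notin> lat m n" using carrier_lat_iff[OF HC[OF u(1)]] u(2) by blast
  have vu: "red m n (v + u) = 0"
  proof -
    have "red m n (v + u) \<noteq> v" using eq[OF v(1), of "v + u"] uL by auto
    moreover have "red m n (v + u) \<noteq> u" using eq[OF u(1), of "v + u"] vL by auto
    ultimately show ?thesis using closed[OF v(1) u(1)] u(4) by blast
  qed
  then have vuL: "v + u \<in> lat m n" using eq[OF H0, of "v + u"] by simp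
  have "?w \<noteq> 0"
  proof
    assume "?w = 0"
    then have "v + v \<in> lat m n" using eq[OF H0, of "v + v"] by simp
    from lat_diff[OF this vuL] have "v - u \<in> lat m n" by simp
    then show False using carrier_eq_iff[OF pos vC HC[OF u(1)]] u(3) by blast
  qed
  then have w: "?w = u" using wH wv u(4) by blast
  then show "H = {0, v, ?w}" using u(4) by blast
  have "v + v - u \<in> lat m n" using eq[OF u(1), of "v + v"] w by blast
  from lat_add[OF this vuL] have "v + v + v \<in> lat m n" by (simp add: algebra_simps)
  then show "v \<in> order3_elems m n" using vC v(2) by (simp add: order3_elems_def)
qed

text \<open>Every element of order 3 lies in exactly one subgroup of order 3, and each such subgroup
  has two of them.\<close>

lemma card_order3_elems: "card (order3_elems m n) = 2 * xi m n"
proof -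
  let ?S = "{H. subgroup H (Zmn m n) \<and> card H = 3}"
  have fS: "finite ?S"
  proof (rule finite_subset)
    show "?S \<subseteq> Pow (carrier (Zmn m n))" using subgroup.subset by blast
  qed (simp only: finite_Pow_iff finite_carrier_Zmn[OF pos])
  have fH: "finite H" if "card H = 3" for H :: "(int \<times> int) set"
    using that by (metis card.infinite zero_neq_numeral)
  have zero: "0 \<in> H" if "subgroup H (Zmn m n)" for H
    using subgroup.one_closed[OF that] unfolding one_Zmn[OF pos] .
  have "order3_elems m n = (\<Union>H\<in>?S. H - {0})"
  proof
    show "order3_elems m n \<subseteq> (\<Union>H\<in>?S. H - {0})"
    proof
      fix v assume v: "v \<in> order3_elems m n"
      then have "v \<noteq> 0" by (simp add: order3_elems_def)
      then show "v \<in> (\<Union>H\<in>?S. H - {0})"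
        using order3_subgroup[OF v] by (intro UN_I[of "{0, v, red m n (v + v)}"]) auto
    qed
  qed (use subgroup_order3(1) in blast)
  also have "card \<dots> = (\<Sum>H\<in>?S. card (H - {0}))"
  proof (rule card_UN_disjoint[OF fS])
    show "\<forall>H\<in>?S. finite (H - {0})" using fH by blast
    show "\<forall>H\<in>?S. \<forall>K\<in>?S. H \<noteq> K \<longrightarrow> (H - {0}) \<inter> (K - {0}) = {}"
    proof (intro ballI impI, rule ccontr)
      fix H K assume HK: "H \<in> ?S" "K \<in> ?S" "H \<noteq> K" "(H - {0}) \<inter> (K - {0}) \<noteq> {}"
      then obtain v where "v \<in> H" "v \<in> K" "v \<noteq> 0" by blast
      then have "H = {0, v, red m n (v + v)}" "K = {0, v, red m n (v + v)}"
        using subgroup_order3(2) HK(1,2) by blast+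
      then show False using HK(3) by simp
    qed
  qed
  also have "\<dots> = (\<Sum>H\<in>?S. 2)"
  proof (rule sum.cong[OF refl])
    fix H assume "H \<in> ?S"
    then show "card (H - {0}) = 2" using zero fH[of H] by (subst card_Diff_singleton) auto
  qed
  finally show ?thesis by (simp add: xi_def)
qed

end

text \<open>The weight with which the differences are counted is the dual solution of the linear
  programming bound: every codeword has a difference set of weight at least 6.\<close>

definition weight :: "nat \<Rightarrow> nat \<Rightarrow> nat \<Rightarrow> int \<times> int \<Rightarrow> nat" where
  "weight p q la v = 1 + (if par v = (False, False) then 1 else 0) +
     (if v + v \<in> lat (2 * p) (2 * q) then 1 else 0) +
     (if la = 3 \<and> v + v + v \<in> lat (2 * p) (2 * q) then 1 else 0)"

section \<open>Weights of difference sets\<close>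

context
  fixes p q la :: nat
  assumes odd_pq: "odd p" "odd q" and la: "la \<in> {2, 3}"
begin

abbreviation (input) "LL \<equiv> lat (2 * p) (2 * q)"
abbreviation (input) "CC \<equiv> carrier (Zmn (2 * p) (2 * q))"
abbreviation (input) "rd \<equiv> red (2 * p) (2 * q)"

lemma pos2': "2 * p > 0" "2 * q > 0"
  using odd_pq by (auto intro: Nat.gr0I)

lemma weight_cong:
  assumes "u - v \<in> LL"
  shows "weight p q la u = weight p q la v"
proof -
  have "par u = par v" using par_lat2(1)[OF odd_pq assms] .
  moreover have "u + u \<in> LL \<longleftrightarrow> v + v \<in> LL"
    using lat_add[OF assms assms] by (intro lat_cong) (simp add: algebra_simps)
  moreover have "u + u + u \<in> LL \<longleftrightarrow> v + v + v \<in> LL"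
    using lat_add[OF lat_add[OF assms assms] assms] by (intro lat_cong) (simp add: algebra_simps)
  ultimately show ?thesis by (simp add: weight_def)
qed

lemma weight_uminus: "weight p q la (- v) = weight p q la v"
  using lat_uminus[of "v + v" "2 * p" "2 * q"] lat_uminus[of "v + v + v" "2 * p" "2 * q"]
  by (simp add: weight_def par_def)

definition pair :: "int \<times> int \<Rightarrow> (int \<times> int) set" where
  "pair e = {rd e, rd (- e)}"

lemma pair_weight: "(\<Sum>v\<in>pair e. weight p q la v) =
  (if e + e \<in> LL then weight p q la e else 2 * weight p q la e)"
proof -
  have "rd e = rd (- e) \<longleftrightarrow> e + e \<in> LL" using red_eq_iff[OF pos2', of e "- e"] by simp
  moreover have "weight p q la (rd e) = weight p q la e" "weight p q la (rd (- e)) = weight p q la e"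
    using weight_cong[OF red_cong[OF pos2']] weight_uminus by simp_all
  ultimately show ?thesis by (auto simp: pair_def)
qed

lemma even_double: "par e = (False, False) \<Longrightarrow> e + e \<in> LL \<Longrightarrow> e \<in> LL"
  using lat_double_cancel[OF odd_pq, of e] by (simp add: lat2_iff[OF odd_pq])

text \<open>A pair has two elements unless it is an involution, whose extra weight makes up for the
  missing partner. H has odd order and contains no involution, so a nonzero pair in H weighs at
  least 2 * 2, and 2 * 3 if order 3 is rewarded.\<close>

lemma pair_weight_ge:
  assumes "e \<notin> LL"
  shows "2 \<le> (\<Sum>v\<in>pair e. weight p q la v)"
    and "par e = (False, False) \<Longrightarrow> 4 \<le> (\<Sum>v\<in>pair e. weight p q la v)"
    and "la = 3 \<Longrightarrow> e + e + e \<in> LL \<Longrightarrow> 6 \<le> (\<Sum>v\<in>pair e. weight p q la v)"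
proof -
  show "2 \<le> (\<Sum>v\<in>pair e. weight p q la v)" unfolding pair_weight by (simp add: weight_def)
  show "4 \<le> (\<Sum>v\<in>pair e. weight p q la v)" if "par e = (False, False)"
  proof -
    have "e + e \<notin> LL" using even_double[OF that] assms by blast
    then show ?thesis unfolding pair_weight using that by (simp add: weight_def)
  qed
  show "6 \<le> (\<Sum>v\<in>pair e. weight p q la v)" if *: "la = 3" "e + e + e \<in> LL"
  proof -
    have "par (e + e + e) = (False, False)" using *(2) by (simp add: lat2_iff[OF odd_pq])
    then have pe: "par e = (False, False)" by (simp add: par_def)
    then have "e + e \<notin> LL" using even_double assms by blast
    then show ?thesis unfolding pair_weight using * pe by (simp add: weight_def)
  qed
qed

lemma pair_disjoint: "e \<notin> pm LL f \<Longrightarrow> pair e \<inter> pair f = {}"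
  using red_eq_iff[OF pos2', of e f] red_eq_iff[OF pos2', of e "- f"]
    red_eq_iff[OF pos2', of "- e" f] red_eq_iff[OF pos2', of "- e" "- f"]
    lat_uminus[of "e - f" "2 * p" "2 * q"] lat_uminus[of "e + f" "2 * p" "2 * q"]
  by (auto simp: pair_def pm_def add.commute)

lemma pair_diffs:
  assumes "x \<in> X" "y \<in> X" "x - y \<notin> LL"
  shows "pair (x - y) \<subseteq> diffs (2 * p) (2 * q) X \<inter> CC"
proof -
  have "rd (x - y) \<in> diffs (2 * p) (2 * q) X"
    using assms red_cong[OF pos2', of "x - y"] lat_cong[OF red_cong[OF pos2', of "x - y"]]
    by (intro diffsI[of x X y]) auto
  moreover have "rd (y - x) \<in> diffs (2 * p) (2 * q) X"
    using assms red_cong[OF pos2', of "y - x"] lat_cong[OF red_cong[OF pos2', of "y - x"]]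
      lat_minus_commute[of x y "2 * p" "2 * q"]
    by (intro diffsI[of y X x]) auto
  moreover have "pair (x - y) = {rd (x - y), rd (y - x)}" by (simp add: pair_def)
  moreover have "rd (x - y) \<in> CC" "rd (y - x) \<in> CC" by (rule red_carrier[OF pos2'])+
  ultimately show ?thesis by (simp only: insert_subset Int_iff empty_subsetI simp_thms)
qed

lemma weight_sum_mono:
  assumes "A \<subseteq> diffs (2 * p) (2 * q) X \<inter> CC"
  shows "(\<Sum>v\<in>A. weight p q la v) \<le> (\<Sum>v\<in>diffs (2 * p) (2 * q) X \<inter> CC. weight p q la v)"
  using assms finite_carrier_Zmn[OF pos2'] by (intro sum_mono2) auto

text \<open>X is an arithmetic progression of step e. Its differences are e and 2 * e up to sign,
  and 2 * e lies in H, so they weigh at least 2 + 4. If 3 * e = 0 the two pairs coincide, but then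
  \<open>la = 3\<close> and this one pair weighs 6.\<close>

lemma progression_weight:
  assumes X: "X = {x, y, z}" "X \<subseteq> CC" "x \<noteq> y" "y \<noteq> z" "z \<noteq> x"
    and self: "\<And>g. g \<in> CC - {0} \<Longrightarrow> card (X \<inter> (X #>\<^bsub>Zmn (2 * p) (2 * q)\<^esub> g)) \<le> la"
    and coin: "y - z \<in> pm LL (x - y)"
  shows "6 \<le> (\<Sum>v\<in>diffs (2 * p) (2 * q) X \<inter> CC. weight p q la v)"
proof -
  have C: "x \<in> CC" "y \<in> CC" "z \<in> CC" using X by auto
  have n: "x - y \<notin> LL" "y - z \<notin> LL" "z - x \<notin> LL"
    using carrier_eq_iff[OF pos2' C(1,2)] carrier_eq_iff[OF pos2' C(2,3)] carrier_eq_iff[OF pos2' C(3,1)] X by blast+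
  define e where "e = x - y"
  \<comment> \<open>The other sign would give z = x.\<close>
  have "y - z + (x - y) \<notin> LL" using n(3) lat_minus_commute[of x z] by simp
  then have d: "y - z - e \<in> LL" using coin by (auto simp: pm_def e_def)
  have ze: "z - x - (- (e + e)) \<in> LL" using d lat_minus_commute[of "y - z" e] by (simp add: e_def algebra_simps)
  have eL: "e \<notin> LL" "e + e \<notin> LL"
    using n(1) n(3) lat_cong[OF ze] lat_uminus[of "e + e"] by (auto simp: e_def)
  have pe: "pair e \<subseteq> diffs (2 * p) (2 * q) X \<inter> CC"
    unfolding e_def using pair_diffs[of x X y] n X(1) by simp
  have "pair (e + e) = pair (z - x)"
    using red_eq_iff[OF pos2', of "z - x" "- (e + e)"] red_eq_iff[OF pos2', of "- (z - x)" "e + e"] ze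
      lat_minus_commute[of "z - x" "- (e + e)" "2 * p" "2 * q"]
    by (auto simp: pair_def algebra_simps)
  then have p2: "pair (e + e) \<subseteq> diffs (2 * p) (2 * q) X \<inter> CC"
    using pair_diffs[of z X x] n X(1) by simp
  show ?thesis
  proof (cases "e + e + e \<in> LL")
    case True
    have "la = 3"
    proof (rule ccontr)
      assume "la \<noteq> 3"
      then have la2: "la = 2" using la by simp
      \<comment> \<open>Translation by e takes z to y, y to x and x to z, so X meets this translate
        in three points.\<close>
      have shift: "red (2 * p) (2 * q) (u + rd e) = w" if "u + e - w \<in> LL" "w \<in> CC" for u w
      proof -
        have "u + rd e - w \<in> LL" using lat_add[OF that(1) red_cong[OF pos2', of e]] by (simp add: algebra_simps)
        then show ?thesis using red_eq_iff[OF pos2', of "u + rd e" w] red_id[OF pos2' that(2)] by simp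
      qed
      have "rd (y + rd e) = x" using C by (intro shift) (auto simp: e_def)
      moreover have "rd (z + rd e) = y"
        using d lat_minus_commute[of "y - z" e "2 * p" "2 * q"] C by (intro shift) (auto simp: algebra_simps)
      moreover have "rd (x + rd e) = z"
        using lat_diff[OF True ze] C by (intro shift) (auto simp: algebra_simps)
      ultimately have "X #>\<^bsub>Zmn (2 * p) (2 * q)\<^esub> rd e = X"
        unfolding coset_Zmn[OF pos2'] X(1) by auto
      moreover have "card X = 3" using X by simp
      moreover have "rd e \<in> CC - {0}"
      proof -
        have "rd e \<noteq> 0"
          using red_eq_iff[OF pos2', of e 0] red_id[OF pos2' zero_carrier[OF pos2']] eL(1) by simp
        then show ?thesis using red_carrier[OF pos2', of e] by blast
      qed
      ultimately show False using self[of "rd e"] la2 by simp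
    qed
    then have "6 \<le> (\<Sum>v\<in>pair e. weight p q la v)" using pair_weight_ge(3)[OF eL(1)] True by blast
    also note weight_sum_mono[OF pe]
    finally show ?thesis .
  next
    case False
    have "e \<notin> pm LL (e + e)" using eL(1) False lat_uminus[of e "2 * p" "2 * q"] by (auto simp: pm_def add.assoc)
    note disj = pair_disjoint[OF this]
    have "par (e + e) = (False, False)" by (simp add: par_def)
    then have "6 \<le> (\<Sum>v\<in>pair e. weight p q la v) + (\<Sum>v\<in>pair (e + e). weight p q la v)"
      using pair_weight_ge(1)[OF eL(1)] pair_weight_ge(2)[OF eL(2)] by simp
    also have "\<dots> = (\<Sum>v\<in>pair e \<union> pair (e + e). weight p q la v)"
      using disj by (intro sum.union_disjoint[symmetric]) (auto simp: pair_def)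
    also have "\<dots> \<le> (\<Sum>v\<in>diffs (2 * p) (2 * q) X \<inter> CC. weight p q la v)"
      using pe p2 by (intro weight_sum_mono) blast
    finally show ?thesis .
  qed
qed

text \<open>If no two of the three difference pairs coincide, they are disjoint and weigh at least 2
  each. Otherwise a cyclic relabelling turns X into a progression.\<close>

lemma codeword_weight:
  assumes X: "X \<subseteq> CC" "card X = 3"
    and self: "\<And>g. g \<in> CC - {0} \<Longrightarrow> card (X \<inter> (X #>\<^bsub>Zmn (2 * p) (2 * q)\<^esub> g)) \<le> la"
  shows "6 \<le> (\<Sum>v\<in>diffs (2 * p) (2 * q) X \<inter> CC. weight p q la v)"
proof -
  obtain x y z where xyz: "X = {x, y, z}" "x \<noteq> y" "y \<noteq> z" "z \<noteq> x"
    using X(2) by (auto simp: card_3_iff)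
  have C: "x \<in> CC" "y \<in> CC" "z \<in> CC" using X(1) xyz(1) by auto
  have n: "x - y \<notin> LL" "y - z \<notin> LL" "z - x \<notin> LL"
    using carrier_eq_iff[OF pos2' C(1,2)] carrier_eq_iff[OF pos2' C(2,3)] carrier_eq_iff[OF pos2' C(3,1)] xyz by blast+
  consider "y - z \<in> pm LL (x - y)" | "z - x \<in> pm LL (y - z)" | "x - y \<in> pm LL (z - x)"
    | "y - z \<notin> pm LL (x - y)" "z - x \<notin> pm LL (y - z)" "x - y \<notin> pm LL (z - x)" by blast
  then show ?thesis
  proof cases
    case 1
    show ?thesis by (rule progression_weight[OF xyz(1) X(1) xyz(2-4) self 1])
  next
    case 2
    have "X = {y, z, x}" using xyz(1) by auto
    then show ?thesis by (rule progression_weight[OF _ X(1) xyz(3,4,2) self 2])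
  next
    case 3
    have "X = {z, x, y}" using xyz(1) by auto
    then show ?thesis by (rule progression_weight[OF _ X(1) xyz(4,2,3) self 3])
  next
    case 4
    have f: "finite (pair e)" for e by (simp add: pair_def)
    have "6 \<le> (\<Sum>v\<in>pair (x - y). weight p q la v) + (\<Sum>v\<in>pair (y - z). weight p q la v) +
        (\<Sum>v\<in>pair (z - x). weight p q la v)"
      using pair_weight_ge(1)[OF n(1)] pair_weight_ge(1)[OF n(2)] pair_weight_ge(1)[OF n(3)] by linarith
    also have "\<dots> = (\<Sum>v\<in>pair (x - y) \<union> pair (y - z) \<union> pair (z - x). weight p q la v)"
      using pair_disjoint[OF 4(1)] pair_disjoint[OF 4(2)] pair_disjoint[OF 4(3)] f
      by (subst sum.union_disjoint; (subst sum.union_disjoint)?) auto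
    also have "\<dots> \<le> (\<Sum>v\<in>diffs (2 * p) (2 * q) X \<inter> CC. weight p q la v)"
      using pair_diffs[of x X y] pair_diffs[of y X z] pair_diffs[of z X x] n xyz(1)
      by (intro weight_sum_mono) simp
    finally show ?thesis .
  qed
qed

lemma card_even: "card {v \<in> CC - {0}. par v = (False, False)} \<le> p * q - 1"
proof -
  have "{v \<in> CC - {0}. par v = (False, False)} \<subseteq>
      (\<lambda>(x, y). (2 * x, 2 * y)) ` ({0..<int p} \<times> {0..<int q} - {(0, 0)})"
  proof
    fix v assume v: "v \<in> {v \<in> CC - {0}. par v = (False, False)}"
    obtain x y where xy: "v = (2 * x, 2 * y)"
      using v by (cases v) (auto simp: par_def elim!: evenE)
    then have "(x, y) \<in> {0..<int p} \<times> {0..<int q} - {(0, 0)}"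
      using v unfolding carrier_Zmn[OF pos2'] by (auto simp: zero_prod_def)
    then show "v \<in> (\<lambda>(x, y). (2 * x, 2 * y)) ` ({0..<int p} \<times> {0..<int q} - {(0, 0)})"
      unfolding xy by force
  qed
  then have "card {v \<in> CC - {0}. par v = (False, False)} \<le>
      card ((\<lambda>(x, y). (2 * x, 2 * y)) ` ({0..<int p} \<times> {0..<int q} - {(0, 0)}))"
    by (intro card_mono) auto
  also have "\<dots> \<le> card ({0..<int p} \<times> {0..<int q} - {(0, 0)})" by (intro card_image_le) auto
  also have "\<dots> = p * q - 1" using pos2' by (simp add: card_Diff_singleton card_cartesian_product)
  finally show ?thesis .
qed

lemma card_involutions: "card {v \<in> CC - {0}. v + v \<in> LL} \<le> 3"
proof -
  have half: "x = 0 \<or> x = int r" if "0 \<le> x" "x < 2 * int r" "2 * int r dvd x + x" for x and r :: nat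
  proof -
    have "int r dvd x" using that(3) by simp
    then obtain k where k: "x = int r * k" ..
    have "r > 0" using that by linarith
    have "k = 0 \<or> k = 1"
    proof -
      have "0 \<le> k" using that(1) k \<open>r > 0\<close> by (simp add: zero_le_mult_iff)
      moreover have "k < 2" using that(2) k \<open>r > 0\<close> by (simp add: mult.commute[of "int r"])
      ultimately show ?thesis by linarith
    qed
    then show ?thesis using k by auto
  qed
  have "v = (0, int q) \<or> v = (int p, 0) \<or> v = (int p, int q)" if v: "v \<in> {v \<in> CC - {0}. v + v \<in> LL}" for v
  proof -
    obtain x y where xy: "v = (x, y)" by fastforce
    have "x = 0 \<or> x = int p" "y = 0 \<or> y = int q"
      using v half[of x p] half[of y q] unfolding xy carrier_Zmn[OF pos2'] by auto
    then show ?thesis using v xy by (auto simp: zero_prod_def)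
  qed
  then have "{v \<in> CC - {0}. v + v \<in> LL} \<subseteq> {(0, int q), (int p, 0), (int p, int q)}" by blast
  from card_mono[OF _ this] show ?thesis by (auto simp: card_insert_if split: if_splits)
qed

text \<open>The contributions are 4h - 1 for the nonzero elements, h - 1 for H, 3 for the
  involutions and two for each rewarded subgroup of order 3, where h = p * q.\<close>

lemma total_weight:
  "(\<Sum>v\<in>CC - {0}. weight p q la v) \<le> 5 * (p * q) + 1 + 2 * (if la = 2 then 0 else xi (2 * p) (2 * q))"
proof -
  have fC: "finite (CC - {0})" using finite_carrier_Zmn[OF pos2'] by blast
  have count: "(\<Sum>v\<in>CC - {0}. if P v then 1 else 0) = card {v \<in> CC - {0}. P v}" for P
    using fC by (simp add: sum.If_cases Int_def)
  have "card CC = 4 * (p * q)"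
    unfolding carrier_Zmn[OF pos2'] by (simp add: card_cartesian_product nat_mult_distrib)
  then have c1: "card (CC - {0}) = 4 * (p * q) - 1"
    using zero_carrier[OF pos2'] by (simp only: card_Diff_singleton)
  have c2: "card {v \<in> CC - {0}. la = 3 \<and> v + v + v \<in> LL} = 2 * (if la = 2 then 0 else xi (2 * p) (2 * q))"
  proof (cases "la = 2")
    case False
    then have "{v \<in> CC - {0}. la = 3 \<and> v + v + v \<in> LL} = order3_elems (2 * p) (2 * q)"
      using la by (auto simp: order3_elems_def)
    then show ?thesis using False card_order3_elems[OF pos2'] by simp
  qed simp
  have "(\<Sum>v\<in>CC - {0}. weight p q la v) = card (CC - {0}) + card {v \<in> CC - {0}. par v = (False, False)} +
     card {v \<in> CC - {0}. v + v \<in> LL} + card {v \<in> CC - {0}. la = 3 \<and> v + v + v \<in> LL}"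
    unfolding weight_def sum.distrib count by simp
  moreover have "p * q \<ge> 1" using pos2' by simp
  ultimately show ?thesis using c1 c2 card_even card_involutions by linarith
qed

lemma Theta_upper:
  "6 * Theta (2 * p) (2 * q) 3 la 1 \<le> 5 * (p * q) + 1 + 2 * (if la = 2 then 0 else xi (2 * p) (2 * q))"
proof -
  obtain F where F: "is_OOSPC (2 * p) (2 * q) 3 la 1 F" "card F = Theta (2 * p) (2 * q) 3 la 1"
    using Theta_attained[OF pos2'] .
  note D = OOSPC_D[OF pos2' F(1)]
  have fF: "finite F" using finite_OOSPC(2)[OF pos2' F(1)] .
  let ?D = "\<lambda>X. diffs (2 * p) (2 * q) X \<inter> CC"
  have fD: "finite (?D X)" for X using finite_carrier_Zmn[OF pos2'] by blast
  have "6 * card F = (\<Sum>X\<in>F. 6)" by simp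
  also have "\<dots> \<le> (\<Sum>X\<in>F. \<Sum>v\<in>?D X. weight p q la v)"
    by (intro sum_mono codeword_weight) (use D in blast)+
  also have "\<dots> = (\<Sum>v\<in>(\<Union>X\<in>F. ?D X). weight p q la v)"
    using fF fD D(4) by (intro sum.UNION_disjoint[symmetric]) auto
  also have "\<dots> \<le> (\<Sum>v\<in>CC - {0}. weight p q la v)"
  proof (intro sum_mono2)
    show "finite (CC - {0})" using finite_carrier_Zmn[OF pos2'] by blast
    have "0 \<notin> diffs (2 * p) (2 * q) X" for X by (simp add: diffs_def)
    then show "(\<Union>X\<in>F. ?D X) \<subseteq> CC - {0}" by blast
  qed simp
  also note total_weight
  finally show ?thesis unfolding F(2) .
qed

end

text \<open>Each class accounts for at most two elements of order 3, and a subgroup of order 3 has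
  exactly two. The inequality points in the direction that the lower bound requires.\<close>

lemma xi_le_card:
  assumes odd_pq: "odd p" "odd q" and O': "finite O'" "order3 p q \<subseteq> (\<Union>e\<in>O'. pm (lat p q) e)"
  shows "xi (2 * p) (2 * q) \<le> card O'"
proof -
  have pos: "2 * p > 0" "2 * q > 0" using odd_pq by (auto intro: Nat.gr0I)
  let ?S = "order3_elems (2 * p) (2 * q)"
  have S: "v \<in> CC \<and> par v = (False, False) \<and> v \<in> order3 p q"
    if "v \<in> ?S" and CC: "CC = carrier (Zmn (2 * p) (2 * q))" for v CC
  proof -
    have v: "v \<in> CC" "v \<notin> lat (2 * p) (2 * q)" "v + v + v \<in> lat (2 * p) (2 * q)"
      using that carrier_lat_iff[OF pos, of v] by (auto simp: order3_elems_def)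
    then have "par (v + v + v) = (False, False)" "v + v + v \<in> lat p q" by (auto simp: lat2_iff[OF odd_pq])
    moreover from this have "par v = (False, False)" by (simp add: par_def)
    ultimately show ?thesis using v by (simp add: lat2_iff[OF odd_pq] order3_def)
  qed
  have two: "finite (?S \<inter> pm (lat p q) e) \<and> card (?S \<inter> pm (lat p q) e) \<le> 2" for e
  proof -
    \<comment> \<open>Elements of order 3 have even coordinates, so e is replaced by the congruent
      point of that parity.\<close>
    obtain a where a: "par a = (False, False)" "a - e \<in> lat p q" using point_exists[OF odd_pq] .
    have "v = red (2 * p) (2 * q) a \<or> v = red (2 * p) (2 * q) (- a)" if v: "v \<in> ?S \<inter> pm (lat p q) e" for v
    proof -
      have vv: "v \<in> carrier (Zmn (2 * p) (2 * q))" "par v = (False, False)" using S v by blast+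
      have "v - a \<in> lat p q \<or> v + a \<in> lat p q"
        using v lat_diff[OF _ a(2), of "v - e"] lat_add[OF _ a(2), of "v + e"] by (auto simp: pm_def)
      moreover have "par (v - a) = (False, False)" "par (v + a) = (False, False)"
        using vv(2) a(1) by (auto simp: par_def)
      ultimately have "v - a \<in> lat (2 * p) (2 * q) \<or> v + a \<in> lat (2 * p) (2 * q)"
        by (simp add: lat2_iff[OF odd_pq])
      then show ?thesis
        using red_eq_iff[OF pos, of v a] red_eq_iff[OF pos, of v "- a"] red_id[OF pos vv(1)] by simp
    qed
    then have sub: "?S \<inter> pm (lat p q) e \<subseteq> {red (2 * p) (2 * q) a, red (2 * p) (2 * q) (- a)}" by blast
    from card_mono[OF _ this] finite_subset[OF this] show ?thesis
      by (simp add: card_insert_if split: if_splits)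
  qed
  have "?S \<subseteq> (\<Union>e\<in>O'. ?S \<inter> pm (lat p q) e)" using S O'(2) by blast
  then have "card ?S \<le> card (\<Union>e\<in>O'. ?S \<inter> pm (lat p q) e)" using O'(1) two by (intro card_mono finite_UN_I) blast+
  also have "\<dots> \<le> (\<Sum>e\<in>O'. card (?S \<inter> pm (lat p q) e))" by (rule card_UN_le[OF O'(1)])
  also have "\<dots> \<le> (\<Sum>e\<in>O'. 2)" using two by (intro sum_mono) blast
  finally show ?thesis using card_order3_elems[OF pos] by simp
qed

section \<open>The two bounds combined\<close>

lemma Theta_eq:
  assumes odd_pq: "odd p" "odd q" and la: "la \<in> {2, 3}"
  shows "Theta (2 * p) (2 * q) 3 la 1 =
    (5 * (p * q) + 1 + 2 * (if la = 2 then 0 else xi (2 * p) (2 * q))) div 6"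
proof (rule antisym)
  show "Theta (2 * p) (2 * q) 3 la 1 \<le>
      (5 * (p * q) + 1 + 2 * (if la = 2 then 0 else xi (2 * p) (2 * q))) div 6"
    using Theta_upper[OF assms] by linarith
  show "(5 * (p * q) + 1 + 2 * (if la = 2 then 0 else xi (2 * p) (2 * q))) div 6 \<le>
      Theta (2 * p) (2 * q) 3 la 1"
  proof (cases "la = 2")
    case True
    \<comment> \<open>For \<open>la = 2\<close> no extra weight is given to order 3, so its classes
      may stay inside triples and \<open>O'\<close> is empty.\<close>
    obtain T E where "zs_cover (lat p q) (p * q) T E" "card E \<le> 3" using cover_exists[OF odd_pq] by blast
    then show ?thesis using Theta_lower[OF odd_pq la, of T E "{}"] True by simp
  next
    case False
    then have la3: "la = 3" using la by simp
    obtain T E O' where C: "zs_cover (lat p q) (p * q) T E" "O' \<subseteq> E" "card (E - O') \<le> 3"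
      "O' \<subseteq> order3 p q" "order3 p q \<subseteq> (\<Union>e\<in>O'. pm (lat p q) e)"
      using cover_order3[OF odd_pq] by blast
    have "finite O'" using C(1,2) zs_coverD(2) finite_subset by blast
    then have "xi (2 * p) (2 * q) \<le> card O'" using xi_le_card[OF odd_pq _ C(5)] by blast
    then have "(5 * (p * q) + 1 + 2 * xi (2 * p) (2 * q)) div 6 \<le> (5 * (p * q) + 1 + 2 * card O') div 6"
      by (intro div_le_mono) simp
    also have "\<dots> \<le> Theta (2 * p) (2 * q) 3 la 1"
      using Theta_lower[OF odd_pq la C(1-4)] la3 by blast
    finally show ?thesis using False by simp
  qed
qed

theorem theorem1p4:
  fixes m n la \<omega> :: nat
  assumes "la \<in> {2, 3}"
    and "m > 0" and "n > 0"
    and "[m = 2] (mod 4)" and "[n = 2] (mod 4)"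
    and "\<omega> = (if la = 2 then 0 else xi m n)"
  shows "int (Theta m n 3 la 1) =
    \<lfloor>(5 * real m * real n + 4 + 8 * real \<omega>) / 24\<rfloor>"
proof -
  define p q where "p = m div 2" and "q = n div 2"
  have p: "m = 2 * p" "odd p" using assms(4) unfolding p_def cong_def by presburger+
  have q: "n = 2 * q" "odd q" using assms(5) unfolding q_def cong_def by presburger+
  have "(5 * real m * real n + 4 + 8 * real \<omega>) / 24 = real (5 * (p * q) + 1 + 2 * \<omega>) / real 6"
    unfolding p(1) q(1) by (simp add: field_simps)
  also have "\<lfloor>\<dots>\<rfloor> = int ((5 * (p * q) + 1 + 2 * \<omega>) div 6)" by (rule floor_divide_of_nat_eq)
  also have "(5 * (p * q) + 1 + 2 * \<omega>) div 6 = Theta m n 3 la 1"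
    using Theta_eq[OF p(2) q(2) assms(1)] unfolding assms(6) p(1) q(1) by simp
  finally show ?thesis by simp
qed

end
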